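(* Let $p>2$ be a prime. If the $p$-rank of the relative class group of $K=\mathbb{Q}(\zeta)$ satisfies $\mathrm{rk}_p(C\ell^-)\le\rho':=[\sqrt{p+1}-1.5]$, then the first case of Fermat's last theorem holds for the prime $p$, i.e. there are no integers $a,b,c$ with $p\nmid abc$ and $a^p+b^p+c^p=0$.
   Context: $\zeta$ is a primitive $p$-th root of unity, $K^+$ is the maximal real subfield of $K$, and $C\ell^-$ is the $p$-part of the relative class group $\mathrm{Ker}(\mathrm{N}_{K/K^+}: C_K\to C_{K^+})$ ($C_F$ being the ideal class group of $F$). For an abelian group $A$, $\mathrm{rk}_p(A)$ is the $\mathbb{F}_p$-dimension of $A/A^p$. $[\,\cdot\,]$ denotes the integer part. *)

theory Defs
  imports
    Complex_Main
    "HOL-Algebra.Algebra"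
    "HOL-Algebra.Algebraic_Closure_Type"
    "HOL-Number_Theory.Residues"
    "Jordan_Normal_Form.Missing_VectorSpace"
begin

text \<open>Number fields are treated as subsets of the complex numbers, and ideals and fractional
  ideals as sets of complex numbers.\<close>

abbreviation complex_ring :: "complex ring"
  where "complex_ring \<equiv> ring_of_type_algebra"

definition primitive_root_of_unity :: "nat \<Rightarrow> complex \<Rightarrow> bool"
  where "primitive_root_of_unity n z \<longleftrightarrow> n > 0 \<and> z ^ n = 1 \<and> (\<forall>k. 0 < k \<and> k < n \<longrightarrow> z ^ k \<noteq> 1)"

text \<open>The field generated by \<open>z\<close> in characteristic zero, i.e. \<open>\<rat>(z)\<close>.\<close>
definition rat_adjoin :: "complex \<Rightarrow> complex set"
  where "rat_adjoin z = generate_field complex_ring {z}"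

text \<open>The real subfields of \<open>F\<close> have a largest member, the intersection of \<open>F\<close> with
  the reals.\<close>
definition max_real_subfield :: "complex set \<Rightarrow> complex set"
  where "max_real_subfield F = F \<inter> \<real>"


subsection \<open>Ideal class groups\<close>

definition integers_of :: "complex set \<Rightarrow> complex set"
  where "integers_of F = {x \<in> F. algebraic_int x}"

definition fractional_ideal :: "complex set \<Rightarrow> complex set \<Rightarrow> bool"
  where "fractional_ideal F I \<longleftrightarrow> I \<subseteq> F \<and> I \<noteq> {0} \<and>
    (\<exists>d \<in> integers_of F - {0}. ideal ((*) d ` I) (complex_ring\<lparr>carrier := integers_of F\<rparr>))"

definition fractional_ideal_group :: "complex set \<Rightarrow> complex set monoid"
  where "fractional_ideal_group F =
    \<lparr>carrier = {I. fractional_ideal F I}, monoid.mult = ideal_prod complex_ring, one = integers_of F\<rparr>"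

definition principal_fractional_ideals :: "complex set \<Rightarrow> complex set set"
  where "principal_fractional_ideals F = {(*) x ` integers_of F | x. x \<in> F - {0}}"

definition class_group :: "complex set \<Rightarrow> complex set set monoid"
  where "class_group F = fractional_ideal_group F Mod principal_fractional_ideals F"


subsection \<open>Norms for a Galois extension \<open>L\<close> of \<open>F\<close>\<close>

text \<open>Automorphisms are taken to be extensional, so that each of them is counted only once
  in the product defining the norm.\<close>
definition galois_group :: "complex set \<Rightarrow> complex set \<Rightarrow> (complex \<Rightarrow> complex) set"
  where "galois_group L F =
    {\<sigma> \<in> ring_iso (complex_ring\<lparr>carrier := L\<rparr>) (complex_ring\<lparr>carrier := L\<rparr>) \<inter> extensional L.
       \<forall>x\<in>F. \<sigma> x = x}"

definition field_norm :: "complex set \<Rightarrow> complex set \<Rightarrow> complex \<Rightarrow> complex"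
  where "field_norm L F x = (\<Prod>\<sigma>\<in>galois_group L F. \<sigma> x)"

text \<open>The fractional ideal of \<open>F\<close> generated by the norms of the elements of \<open>I\<close>. The set of norms
  is not itself an ideal: \<open>ideal_prod\<close> is used here only to form all finite sums of products
  of an integer of \<open>F\<close> and a norm.\<close>
definition ideal_norm :: "complex set \<Rightarrow> complex set \<Rightarrow> complex set \<Rightarrow> complex set"
  where "ideal_norm L F I = ideal_prod complex_ring (integers_of F) (field_norm L F ` I)"

text \<open>\<open>the_elem\<close> selects the common value of the class of the norm on all members of \<open>C\<close>.\<close>
definition class_norm :: "complex set \<Rightarrow> complex set \<Rightarrow> complex set set \<Rightarrow> complex set set"
  where "class_norm L F C =
    the_elem ((\<lambda>I. principal_fractional_ideals F #>\<^bsub>fractional_ideal_group F\<^esub> ideal_norm L F I) ` C)"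

definition relative_class_group :: "complex set \<Rightarrow> complex set \<Rightarrow> complex set set monoid"
  where "relative_class_group L F =
    (class_group L)\<lparr>carrier := kernel (class_group L) (class_group F) (class_norm L F)\<rparr>"


subsection \<open>\<open>p\<close>-parts and \<open>p\<close>-ranks of abelian groups\<close>

definition p_part :: "nat \<Rightarrow> 'a monoid \<Rightarrow> 'a monoid"
  where "p_part p A = A\<lparr>carrier := {x \<in> carrier A. \<exists>k::nat. x [^]\<^bsub>A\<^esub> (p ^ k) = \<one>\<^bsub>A\<^esub>}\<rparr>"

definition mod_p_powers :: "nat \<Rightarrow> 'a monoid \<Rightarrow> 'a set monoid"
  where "mod_p_powers p A = A Mod ((\<lambda>x. x [^]\<^bsub>A\<^esub> p) ` carrier A)"

text \<open>The group \<open>A / A\<^sup>p\<close> as a vector space over the field with \<open>p\<close> elements. The type of modules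
  extends the type of rings; the ring multiplication and unit are irrelevant and have dummy
  values.\<close>
definition mod_p_space :: "nat \<Rightarrow> 'a monoid \<Rightarrow> (int, 'a set) module"
  where "mod_p_space p A =
    \<lparr>carrier = carrier (mod_p_powers p A),
     monoid.mult = (\<lambda>x y. \<one>\<^bsub>mod_p_powers p A\<^esub>),
     one = \<one>\<^bsub>mod_p_powers p A\<^esub>,
     ring.zero = \<one>\<^bsub>mod_p_powers p A\<^esub>,
     add = (\<otimes>\<^bsub>mod_p_powers p A\<^esub>),
     module.smult = (\<lambda>k x. x [^]\<^bsub>mod_p_powers p A\<^esub> k)\<rparr>"

definition p_rank :: "nat \<Rightarrow> 'a monoid \<Rightarrow> nat"
  where "p_rank p A = vectorspace.dim (residue_ring (int p)) (mod_p_space p A)"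

end

theory Submission
  imports Defs
begin

text \<open>Eichler's argument. Let \<open>x\<^sup>p + y\<^sup>p + z\<^sup>p = 0\<close> with \<open>x\<close>, \<open>y\<close> coprime and \<open>p\<close> not dividing \<open>x y z\<close>. The
  ideals \<open>(x + \<zeta>\<^sup>k y)\<close> are pairwise coprime, hence \<open>p\<close>-th powers of ideals \<open>I\<^sub>k\<close>. If \<open>r\<close> exceeds the
  rank, the classes of \<open>I\<^sub>k\<close> divided by its complex conjugate, \<open>1 \<le> k \<le> r\<close>, satisfy a nontrivial
  relation modulo \<open>p\<close>. As \<open>u / cnj u\<close> is a root of unity for every unit \<open>u\<close>, and a \<open>p\<close>-th power is
  congruent to an integer modulo \<open>p \<pi>\<close> for \<open>\<pi> = \<zeta> - 1\<close>, the relation becomes a congruence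
  between the product of the \<open>(x + \<zeta>\<^sup>k y)\<^bsup>e(k)\<^esup>\<close> and a power of \<open>\<zeta>\<close> times its conjugate. In terms of
  polynomials this holds modulo \<open>p\<close> and \<open>(X - 1)\<^sup>p\<close>. Its logarithmic derivative has a numerator of
  degree at most \<open>r (r + 1)\<close>, which is less than \<open>p\<close> for \<open>r = \<rho>' + 1\<close>, so the numerator vanishes
  modulo \<open>p\<close>; its lowest coefficients then show that \<open>p\<close> divides every \<open>e(k)\<close>, provided
  that \<open>x\<^sup>2\<close> and \<open>y\<^sup>2\<close> are incongruent. For \<open>p > 3\<close> this can be achieved by permuting \<open>x\<close>, \<open>y\<close>, \<open>z\<close>.\<close>

hide_const (open) UnivPoly.coeff UnivPoly.monom Polynomials.degree

subsection \<open>The cyclotomic ring\<close>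

text \<open>The modulus is \<open>p * (\<zeta> - 1)\<close> rather than \<open>p\<close> because the
  argument differentiates. Lifted to polynomials it becomes the ideal generated by \<open>p\<close>
  and \<open>(X - 1)^p\<close>, which is stable under derivation since the derivative of
  \<open>(X - 1)^p\<close> is a multiple of \<open>p\<close>; with \<open>(X - 1)^(p-1)\<close>
  instead, one factor would be lost. For this reason elements of \<open>\<int>[\<zeta>]\<close> are
  handled throughout as values of integer polynomials. The constant in the rank bound is a degree
  count: index k contributes 2k, in total \<open>2 (1 + ... + r) = r (r + 1)\<close>. For r one more
  than the rank R this is \<open>(R + 1.5)^2 - 1/4\<close>, and the parity of \<open>p\<close> turns
  the resulting weak inequality into a strict one. The rank is defined by A/A^p, while the relation
  is sought among classes killed by \<open>p\<close>. For finite A these two groups have the same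
  order, so finiteness of the class group is essential. It is proved by Hurwitz's box argument, and
  invertibility of ideals is then deduced from it.\<close>

definition evp :: "complex \<Rightarrow> int poly \<Rightarrow> complex"
  where "evp z f = poly (map_poly of_int f) z"

lemma evp_0 [simp]: "evp z 0 = 0"
  by (simp add: evp_def)

lemma evp_pCons [simp]: "evp z (pCons a f) = of_int a + z * evp z f"
  by (simp add: evp_def map_poly_pCons)

lemma evp_1 [simp]: "evp z 1 = 1"
  unfolding one_pCons by simp

lemma evp_add [simp]: "evp z (f + g) = evp z f + evp z g"
proof (induction f arbitrary: g)
  case (pCons a f)
  obtain b g' where g: "g = pCons b g'" by (cases g)
  show ?case unfolding g by (simp add: pCons.IH algebra_simps)
qed simp

lemma evp_smult [simp]: "evp z (Polynomial.smult c f) = of_int c * evp z f"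
  by (induction f) (simp_all add: algebra_simps)

lemma evp_minus [simp]: "evp z (- f) = - evp z f"
  using evp_smult[of z "-1" f] by simp

lemma evp_diff [simp]: "evp z (f - g) = evp z f - evp z g"
  using evp_add[of z f "- g"] by simp

lemma evp_mult [simp]: "evp z (f * g) = evp z f * evp z g"
  by (induction f) (simp_all add: algebra_simps)

lemma evp_power [simp]: "evp z (f ^ n) = evp z f ^ n"
  by (induction n) simp_all

lemma evp_sum [simp]: "evp z (sum f A) = (\<Sum>x\<in>A. evp z (f x))"
  by (induction A rule: infinite_finite_induct) simp_all

lemma evp_prod [simp]: "evp z (prod f A) = (\<Prod>x\<in>A. evp z (f x))"
  by (induction A rule: infinite_finite_induct) simp_all

lemma evp_of_int [simp]: "evp z (of_int n) = of_int n"
  by (simp add: of_int_poly)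

lemma evp_of_nat [simp]: "evp z (of_nat n) = of_nat n"
  by (simp add: of_nat_poly)

lemma evp_numeral [simp]: "evp z (numeral n) = numeral n"
  using evp_of_nat[of z "numeral n"] by simp

lemma evp_monom [simp]: "evp z (monom c n) = of_int c * z ^ n"
  by (induction n) (simp_all add: monom_0 monom_Suc)

lemma evp_pcompose [simp]: "evp z (pcompose f g) = evp (evp z g) f"
  by (induction f) (simp_all add: pcompose_pCons)

lemma evp_one [simp]: "evp 1 f = of_int (poly f 1)"
  by (induction f) simp_all

lemma evp_altdef: "degree f < n \<Longrightarrow> evp z f = (\<Sum>i<n. of_int (coeff f i) * z ^ i)"
proof (induction f arbitrary: n)
  case (pCons a f)
  show ?case
  proof (cases "f = 0")
    case True
    then have "n > 0" using pCons.prems by simp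
    then obtain m where n: "n = Suc m" by (cases n) auto
    show ?thesis using True unfolding n sum.lessThan_Suc_shift by simp
  next
    case False
    then obtain m where n: "n = Suc m" "degree f < m" using pCons.prems by (cases n) auto
    show ?thesis
      unfolding n sum.lessThan_Suc_shift using pCons.IH[OF n(2)]
      by (simp add: sum_distrib_left algebra_simps)
  qed
qed simp

lemma evp_cnj: "cnj (evp z f) = evp (cnj z) f"
  by (induction f) simp_all

lemma poly_div_X_minus_1:
  fixes f :: "int poly"
  obtains q where "f = [:poly f 1:] + [:-1, 1:] * q"
proof -
  have "poly (f - [:poly f 1:]) 1 = 0" by simp
  then obtain q where "f - [:poly f 1:] = [:-1, 1:] * q"
    unfolding poly_eq_0_iff_dvd by (auto elim: dvdE)
  then have "f = [:poly f 1:] + [:-1, 1:] * q" by (simp add: algebra_simps)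
  with that show thesis by blast
qed

text \<open>One factor \<open>b\<close> is kept in the error term: if \<open>b\<close> is a multiple
  of \<open>\<zeta> - 1\<close>, the error is a multiple of \<open>p * (\<zeta> - 1)\<close>, the
  precision required for congruences between p-th powers.\<close>

lemma prime_power_sum:
  fixes a b :: "'a::comm_ring_1"
  assumes "Factorial_Ring.prime p"
  obtains c where "(a + b) ^ p = a ^ p + b ^ p + of_nat p * b * c"
proof -
  have p: "p > 0" using assms prime_gt_0_nat by blast
  define d where "d k = (p choose k) div p" for k
  have d: "p choose k = p * d k" if "0 < k" "k < p" for k
    unfolding d_def using dvd_choose_prime[of k p] that assms by simp
  have "(a + b) ^ p = (\<Sum>k\<le>p. of_nat (p choose k) * b ^ k * a ^ (p - k))"
    using binomial_ring[of b a p] by (simp add: add.commute)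
  also have "{..p} = insert 0 (insert p {0<..<p})" using p by auto
  also have "(\<Sum>k\<in>insert 0 (insert p {0<..<p}). of_nat (p choose k) * b ^ k * a ^ (p - k)) =
      a ^ p + b ^ p + (\<Sum>k\<in>{0<..<p}. of_nat (p choose k) * b ^ k * a ^ (p - k))"
    using p by simp
  also have "(\<Sum>k\<in>{0<..<p}. of_nat (p choose k) * b ^ k * a ^ (p - k)) =
      (\<Sum>k\<in>{0<..<p}. of_nat p * b * (of_nat (d k) * b ^ (k - 1) * a ^ (p - k)))"
  proof (intro sum.cong refl)
    fix k assume k: "k \<in> {0<..<p}"
    then have "b ^ k = b * b ^ (k - 1)" by (cases k) auto
    moreover have "p choose k = p * d k" using d k by auto
    ultimately show "of_nat (p choose k) * b ^ k * a ^ (p - k) =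
      of_nat p * b * (of_nat (d k) * b ^ (k - 1) * a ^ (p - k))"
      by (simp add: algebra_simps)
  qed
  also have "\<dots> = of_nat p * b * (\<Sum>k\<in>{0<..<p}. of_nat (d k) * b ^ (k - 1) * a ^ (p - k))"
    by (rule sum_distrib_left[symmetric])
  finally show thesis by (rule that)
qed

locale cyclotomic =
  fixes p :: nat and \<zeta> :: complex
  assumes prime_p: "Factorial_Ring.prime p" and p_gt_2: "p > 2"
    and primitive: "primitive_root_of_unity p \<zeta>"
begin

lemma odd_p: "odd p"
  using prime_p p_gt_2 prime_odd_nat by blast

lemma p_pos: "p > 0" "p \<noteq> 0"
  using p_gt_2 by auto

lemma zeta_p [simp]: "\<zeta> ^ p = 1"
  using primitive by (simp add: primitive_root_of_unity_def)

lemma zeta_mod: "\<zeta> ^ (n mod p) = \<zeta> ^ n"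
proof -
  have "\<zeta> ^ n = \<zeta> ^ (p * (n div p) + n mod p)" by simp
  also have "\<dots> = \<zeta> ^ (n mod p)" by (simp only: power_add power_mult zeta_p) simp
  finally show ?thesis by simp
qed

lemma zeta_eq_1_iff: "\<zeta> ^ n = 1 \<longleftrightarrow> p dvd n"
proof
  assume "\<zeta> ^ n = 1"
  then have "\<zeta> ^ (n mod p) = 1" by (simp add: zeta_mod)
  moreover have "n mod p < p" using p_pos by simp
  ultimately have "n mod p = 0"
    using primitive unfolding primitive_root_of_unity_def by (metis neq0_conv)
  then show "p dvd n" by auto
qed (auto simp: power_mult)

lemma zeta_nz [simp]: "\<zeta> \<noteq> 0"
  using zeta_p p_pos by (metis power_0_left zero_neq_one)

lemma zeta_inj: "inj_on (\<lambda>k. \<zeta> ^ k) {..<p}"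
proof (rule linorder_inj_onI)
  fix i j assume ij: "i < j" "i \<in> {..<p}" "j \<in> {..<p}"
  show "\<zeta> ^ i \<noteq> \<zeta> ^ j"
  proof
    assume "\<zeta> ^ i = \<zeta> ^ j"
    also have "\<zeta> ^ j = \<zeta> ^ i * \<zeta> ^ (j - i)" using ij by (simp flip: power_add)
    finally have "\<zeta> ^ (j - i) = 1" by simp
    then have "p dvd j - i" by (simp add: zeta_eq_1_iff)
    then show False using ij by (auto dest: dvd_imp_le)
  qed
qed auto

lemma zeta_ne_1 [simp]: "\<zeta> \<noteq> 1"
  using zeta_eq_1_iff[of 1] p_gt_2 by auto

lemma norm_zeta [simp]: "norm \<zeta> = 1"
proof -
  have "norm \<zeta> ^ p = norm (\<zeta> ^ p)" by (simp only: norm_power)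
  then have "norm \<zeta> ^ p = 1" by simp
  then show ?thesis using p_pos power_eq_imp_eq_base[of "norm \<zeta>" p 1] by simp
qed

lemma cnj_zeta_mult [simp]: "cnj \<zeta> * \<zeta> = 1" "\<zeta> * cnj \<zeta> = 1"
  using complex_norm_square[of \<zeta>] by (simp_all add: mult.commute)

lemma cnj_zeta: "cnj \<zeta> = \<zeta> ^ (p - 1)"
proof -
  have "\<zeta> * \<zeta> ^ (p - 1) = \<zeta> ^ p" using p_pos by (simp flip: power_Suc)
  also have "\<dots> = \<zeta> * cnj \<zeta>" by simp
  finally show ?thesis using zeta_nz by (metis mult_left_cancel)
qed

lemma sum_zeta: "(\<Sum>k<p. (\<zeta> ^ k) ^ i) = (if p dvd i then of_nat p else 0)"
proof (cases "p dvd i")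
  case True
  then have "(\<zeta> ^ k) ^ i = 1" for k
    by (simp flip: power_mult add: zeta_eq_1_iff)
  then show ?thesis using True by simp
next
  case False
  then have "\<zeta> ^ i \<noteq> 1" by (simp add: zeta_eq_1_iff)
  moreover have "(\<zeta> ^ i) ^ p = 1" by (simp only: power_mult[symmetric] mult.commute[of i p]) (simp add: power_mult)
  ultimately have "(\<Sum>k<p. (\<zeta> ^ i) ^ k) = 0" by (simp add: geometric_sum)
  moreover have "(\<zeta> ^ k) ^ i = (\<zeta> ^ i) ^ k" for k
    by (simp only: power_mult[symmetric] mult.commute)
  ultimately show ?thesis using False by simp
qed

text \<open>Orthogonality of characters. Its use is that the sum of an integer polynomial over all
  p-th roots of unity, 1 included, is a rational integer divisible by \<open>p\<close>.\<close>

lemma sum_evp: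
  "(\<Sum>k<p. evp (\<zeta> ^ k) f) = of_nat p * of_int (\<Sum>i | i \<le> degree f \<and> p dvd i. coeff f i)"
proof -
  have "(\<Sum>k<p. evp (\<zeta> ^ k) f) = (\<Sum>k<p. \<Sum>i\<le>degree f. of_int (coeff f i) * (\<zeta> ^ k) ^ i)"
    by (simp add: evp_altdef[where n = "Suc (degree f)"] lessThan_Suc_atMost)
  also have "\<dots> = (\<Sum>i\<le>degree f. of_int (coeff f i) * (\<Sum>k<p. (\<zeta> ^ k) ^ i))"
    by (subst sum.swap) (simp add: sum_distrib_left)
  also have "\<dots> = (\<Sum>i\<le>degree f. if p dvd i then of_nat p * of_int (coeff f i) else 0)"
    by (intro sum.cong) (auto simp: sum_zeta)
  also have "\<dots> = (\<Sum>i | i \<le> degree f \<and> p dvd i. of_nat p * of_int (coeff f i))"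
    by (intro sum.mono_neutral_cong_right) auto
  finally show ?thesis by (simp add: sum_distrib_left)
qed

lemma residue_perm:
  assumes "j \<in> {1..<p}"
  shows "bij_betw (\<lambda>k. j * k mod p) {1..<p} {1..<p}"
proof -
  have cop: "coprime j p"
  proof -
    have "\<not> p dvd j" using assms by (auto dest: dvd_imp_le)
    then show ?thesis using prime_imp_coprime[OF prime_p] coprime_commute by blast
  qed
  have inj: "inj_on (\<lambda>k. j * k mod p) {1..<p}"
  proof (rule inj_onI)
    fix a b assume ab: "a \<in> {1..<p}" "b \<in> {1..<p}" "j * a mod p = j * b mod p"
    then have "[j * a = j * b] (mod p)" by (simp add: cong_def)
    then have "[a = b] (mod p)" using cop by (simp add: cong_mult_lcancel_nat)
    then show "a = b" using ab by (simp add: cong_def)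
  qed
  have "(\<lambda>k. j * k mod p) ` {1..<p} \<subseteq> {1..<p}"
  proof safe
    fix k assume k: "k \<in> {1..<p}"
    then have "\<not> p dvd j * k"
      using assms prime_p by (auto simp: prime_dvd_mult_iff dest: dvd_imp_le)
    then have "j * k mod p \<noteq> 0" by (simp only: mod_eq_0_iff_dvd) simp
    then show "j * k mod p \<in> {1..<p}" using p_pos by auto
  qed
  with inj show ?thesis by (simp add: bij_betw_def endo_inj_surj)
qed

text \<open>The integer \<open>f(1)\<^bsup>p-1\<^esup>\<close> is the sum of \<open>G(\<zeta>\<^sup>j)\<close> over all \<open>j\<close>, where \<open>G\<close> is the product of the
  polynomials \<open>f(X\<^sup>k)\<close>. This replaces the irreducibility of the cyclotomic polynomial.\<close>
lemma evp_zero_imp_dvd: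
  assumes "evp \<zeta> f = 0"
  shows "int p dvd poly f 1"
proof -
  define G where "G = (\<Prod>k\<in>{1..<p}. pcompose f (monom 1 k))"
  have "evp (\<zeta> ^ j) G = 0" if j: "j \<in> {1..<p}" for j
  proof -
    \<comment> \<open>The factor of \<open>G\<close> whose index is inverse to \<open>j\<close>
      modulo \<open>p\<close> takes the value \<open>f(\<zeta>) = 0\<close> at
      \<open>\<zeta>^j\<close>.\<close>
    have "1 \<in> (\<lambda>k. j * k mod p) ` {1..<p}"
      unfolding bij_betw_imp_surj_on[OF residue_perm[OF j]] using p_gt_2 by auto
    then obtain k where k: "k \<in> {1..<p}" "j * k mod p = 1" by (elim imageE) simp
    have "(\<zeta> ^ j) ^ k = \<zeta>"
      using zeta_mod[of "j * k"] k by (simp only: power_mult[symmetric]) simp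
    then have "evp ((\<zeta> ^ j) ^ k) f = 0" using assms by simp
    then show ?thesis unfolding G_def using k by auto
  qed
  then have "(\<Sum>j\<in>{1..<p}. evp (\<zeta> ^ j) G) = 0" by simp
  moreover have "{..<p} = insert 0 {1..<p}" using p_pos by auto
  ultimately have "(\<Sum>j<p. evp (\<zeta> ^ j) G) = of_int (poly G 1)" by simp
  then have "of_int (poly G 1) = (of_int (int p * (\<Sum>i | i \<le> degree G \<and> p dvd i. coeff G i)) :: complex)"
    unfolding sum_evp by simp
  then have "poly G 1 = int p * (\<Sum>i | i \<le> degree G \<and> p dvd i. coeff G i)"
    by (simp only: of_int_eq_iff)
  moreover have "poly G 1 = poly f 1 ^ (p - 1)"
    unfolding G_def poly_prod by (simp add: poly_pcompose poly_monom)
  ultimately have "int p dvd poly f 1 ^ (p - 1)" by simp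
  then show ?thesis using prime_p by (meson prime_dvd_power prime_nat_int_transfer)
qed

section \<open>The cyclotomic polynomial of index \<open>p\<close> and the factorization of
  \<open>p\<close>\<close>

definition Phi :: "int poly" where "Phi = (\<Sum>i<p. monom 1 i)"

lemma Phi_mult: "[:-1, 1:] * Phi = monom 1 p - 1"
proof -
  have "([:0, 1:] - 1) * (\<Sum>i<p. [:0, 1:] ^ i) = [:0, 1:] ^ p - (1 :: int poly)"
    by (simp add: power_diff_1_eq)
  moreover have "[:0, 1:] - 1 = ([:-1, 1:] :: int poly)" by (simp add: one_pCons)
  moreover have "[:0, 1:] ^ n = (monom 1 n :: int poly)" for n by (simp add: monom_altdef)
  ultimately show ?thesis by (simp add: Phi_def)
qed

lemma evp_Phi [simp]: "evp \<zeta> Phi = 0"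
proof -
  have "(\<zeta> - 1) * evp \<zeta> Phi = evp \<zeta> ([:-1, 1:] * Phi)" by (simp only: evp_mult) simp
  also have "\<dots> = 0" unfolding Phi_mult by simp
  finally show ?thesis by simp
qed

lemma coeff_Phi: "coeff Phi i = (if i < p then 1 else 0)"
  by (simp add: Phi_def coeff_sum)

lemma degree_Phi: "degree Phi = p - 1"
  using p_pos by (intro antisym degree_le le_degree) (auto simp: coeff_Phi)

lemma lead_coeff_Phi: "lead_coeff Phi = 1"
  using p_pos by (simp add: degree_Phi coeff_Phi)

text \<open>The polynomial form of the total ramification of \<open>p\<close>: modulo
  \<open>p\<close>, \<open>X^p - 1\<close> is \<open>(X - 1)^p\<close>, and \<open>X - 1\<close> is
  divided out.\<close>

lemma Phi_cong: obtains W where "Phi = [:-1, 1:] ^ (p - 1) + of_nat p * W"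
proof -
  obtain c where c: "([:0, 1:] + [:-1:]) ^ p = [:0, 1:] ^ p + [:-1:] ^ p + of_nat p * [:-1:] * (c :: int poly)"
    using prime_power_sum[OF prime_p] by blast
  have 1: "[:-1, 1:] ^ p = monom 1 p - 1 - of_nat p * (c :: int poly)"
  proof -
    have "[:-1:] ^ p = (-1 :: int poly)"
    proof -
      have "[:-1:] = (-1 :: int poly)" by (simp add: one_pCons)
      then show ?thesis using odd_p by simp
    qed
    then show ?thesis using c by (simp add: monom_altdef one_pCons)
  qed
  have "poly ([:-1, 1:] ^ p) 1 = poly (monom 1 p - 1 - of_nat p * c) 1" unfolding 1 ..
  then have "poly c 1 = 0" using p_pos by (simp add: poly_monom power_0_left)
  then obtain d where d: "c = [:-1, 1:] * d" using poly_div_X_minus_1[of c] by auto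
  have "[:-1, 1:] * [:-1, 1:] ^ (p - 1) = ([:-1, 1:] :: int poly) ^ p"
    using p_pos by (simp flip: power_Suc)
  also have "\<dots> = [:-1, 1:] * (Phi - of_nat p * d)"
    unfolding 1 Phi_mult[symmetric] d by (simp add: algebra_simps)
  finally have "[:-1, 1:] ^ (p - 1) = Phi - of_nat p * d"
    by (subst (asm) mult_left_cancel) auto
  then have "Phi = [:-1, 1:] ^ (p - 1) + of_nat p * d" by simp
  then show thesis by (rule that)
qed

lemma prod_X_zeta: "(\<Prod>k<p. [:- (\<zeta> ^ k), 1:]) = monom 1 p - (1 :: complex poly)"
proof -
  let ?f = "(\<Prod>k<p. [:- (\<zeta> ^ k), 1:])" and ?g = "monom 1 p - (1 :: complex poly)"
  have deg: "degree ?f = p" by (simp add: degree_prod_eq_sum_degree)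
  have deg': "degree ?g = p"
    using p_pos by (intro antisym degree_diff_le le_degree) (auto simp: degree_monom_eq)
  have card: "card ((\<lambda>k. \<zeta> ^ k) ` {..<p}) = p" using card_image[OF zeta_inj] by simp
  show ?thesis
  proof (rule poly_eqI_degree_lead_coeff[where n = p and A = "(\<lambda>k. \<zeta> ^ k) ` {..<p}"])
    show "coeff ?f p = coeff ?g p"
    proof -
      have "lead_coeff ?f = 1" by (simp add: lead_coeff_prod)
      then show ?thesis using deg p_pos by simp
    qed
    show "poly ?f x = poly ?g x" if "x \<in> (\<lambda>k. \<zeta> ^ k) ` {..<p}" for x
    proof -
      from that obtain k where k: "k < p" "x = \<zeta> ^ k" by auto
      then have "poly ?f x = 0" by (auto simp: poly_prod)
      moreover have "(\<zeta> ^ k) ^ p = (\<zeta> ^ p) ^ k"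
        by (simp only: power_mult[symmetric] mult.commute)
      then have "poly ?g x = 0" using k by (simp add: poly_monom)
      ultimately show ?thesis by simp
    qed
  qed (use deg deg' card in auto)
qed

lemma prod_add_zeta: "(\<Prod>k<p. (x + \<zeta> ^ k * y)) = x ^ p + y ^ p"
proof (cases "y = 0")
  case False
  have "poly (\<Prod>k<p. [:- (\<zeta> ^ k), 1:]) (- (x / y)) = poly (monom 1 p - 1) (- (x / y))"
    by (simp only: prod_X_zeta)
  moreover have "(\<Prod>k<p. (- (x / y) - \<zeta> ^ k)) = poly (\<Prod>k<p. [:- (\<zeta> ^ k), 1:]) (- (x / y))"
    by (auto simp: poly_prod intro!: prod.cong)
  ultimately have "(\<Prod>k<p. (- (x / y) - \<zeta> ^ k)) = (- (x / y)) ^ p - 1"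
    by (simp add: poly_monom)
  then have "(\<Prod>k<p. (- y)) * (\<Prod>k<p. (- (x / y) - \<zeta> ^ k)) = (- y) ^ p * ((- (x / y)) ^ p - 1)"
    by simp
  also have "(\<Prod>k<p. (- y)) * (\<Prod>k<p. (- (x / y) - \<zeta> ^ k)) = (\<Prod>k<p. x + \<zeta> ^ k * y)"
    unfolding prod.distrib[symmetric] using False by (intro prod.cong) (auto simp: field_simps)
  also have "(- y) ^ p * ((- (x / y)) ^ p - 1) = x ^ p + y ^ p"
    using odd_p False by (simp add: algebra_simps power_divide)
  finally show ?thesis .
qed (use p_pos in simp)

lemma prod_zeta_minus_1: "(\<Prod>k\<in>{1..<p}. (\<zeta> ^ k - 1)) = of_nat p"
proof -
  have eq: "{..<p} = insert 0 {1..<p}" using p_pos by auto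
  have "[:-1, 1:] * (\<Prod>k\<in>{1..<p}. [:- (\<zeta> ^ k), 1:]) = monom 1 p - (1 :: complex poly)"
    using prod_X_zeta unfolding eq by simp
  also have "\<dots> = [:-1, 1:] * (\<Sum>i<p. [:0, 1:] ^ i)"
  proof -
    have "([:0, 1:] - 1) * (\<Sum>i<p. [:0, 1:] ^ i) = [:0, 1:] ^ p - (1 :: complex poly)"
      by (simp add: power_diff_1_eq)
    moreover have "[:0, 1:] - 1 = ([:-1, 1:] :: complex poly)" by (simp add: one_pCons)
    ultimately show ?thesis by (simp add: monom_altdef)
  qed
  finally have "(\<Prod>k\<in>{1..<p}. [:- (\<zeta> ^ k), 1:]) = (\<Sum>i<p. [:0, 1:] ^ i)"
    by (subst (asm) mult_left_cancel) auto
  then have "poly (\<Prod>k\<in>{1..<p}. [:- (\<zeta> ^ k), 1:]) 1 = poly (\<Sum>i<p. [:0, 1:] ^ i) 1" by simp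
  then have "(\<Prod>k\<in>{1..<p}. (1 - \<zeta> ^ k)) = of_nat p"
    by (simp add: poly_prod poly_sum)
  moreover have "(\<Prod>k\<in>{1..<p}. (1 - \<zeta> ^ k)) = (\<Prod>k\<in>{1..<p}. - (\<zeta> ^ k - 1))"
    by simp
  ultimately show ?thesis
    using odd_p by (subst (asm) prod_uminus) simp
qed

text \<open>The quotient is the product of the cyclotomic units \<open>1 + \<zeta> + \<dots> + \<zeta>\<^bsup>k-1\<^esup>\<close>.\<close>
lemma p_eq_pi_power: obtains w where "of_nat p = (\<zeta> - 1) ^ (p - 1) * evp \<zeta> w"
proof -
  have "of_nat p = (\<Prod>k\<in>{1..<p}. (\<zeta> - 1) * evp \<zeta> (\<Sum>i<k. monom 1 i))"
    unfolding prod_zeta_minus_1[symmetric] by (intro prod.cong) (simp_all add: power_diff_1_eq)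
  also have "\<dots> = (\<zeta> - 1) ^ (p - 1) * evp \<zeta> (\<Prod>k\<in>{1..<p}. \<Sum>i<k. monom 1 i)"
    by (simp add: prod.distrib)
  finally show thesis by (rule that)
qed

text \<open>Divisibility by \<open>p\<close> at \<open>\<zeta>\<close> is lifted to polynomials by
  splitting off one factor \<open>X - 1\<close> at a time: after \<open>(\<zeta> - 1)^i\<close> is
  cancelled, the cofactor \<open>V\<close> takes a value that is a multiple of
  \<open>\<zeta> - 1\<close>, so \<open>V(1)\<close> is divisible by \<open>p\<close>. This last
  inference is the hypothesis \<open>dvd\<close>, so that \<open>y\<close> may be an element of
  \<open>\<int>[\<zeta>]\<close> or, as in \<open>cint_Zz\<close>, only known to be
  integral.\<close>

lemma p_dvd_evp_gen:
  assumes "evp \<zeta> f = of_nat p * y"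
    and dvd: "\<And>U V g. evp \<zeta> V = (\<zeta> - 1) * evp \<zeta> g * (y - evp \<zeta> U) \<Longrightarrow> int p dvd poly V 1"
  obtains U V where "f = of_nat p * U + [:-1, 1:] ^ (p - 1) * V"
proof -
  obtain w where w: "of_nat p = (\<zeta> - 1) ^ (p - 1) * evp \<zeta> w" by (rule p_eq_pi_power)
  have "\<exists>U V. f = of_nat p * U + [:-1, 1:] ^ i * V" if "i \<le> p - 1" for i
    using that
  proof (induction i)
    case 0
    show ?case by (rule exI[of _ 0], rule exI[of _ f]) simp
  next
    case (Suc i)
    have "i \<le> p - 1" using Suc.prems by linarith
    from Suc.IH[OF this] obtain U where "\<exists>V. f = of_nat p * U + [:-1, 1:] ^ i * V" ..
    then obtain V where UV: "f = of_nat p * U + [:-1, 1:] ^ i * V" ..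
    \<comment> \<open>As \<open>i < p - 1\<close>, cancelling \<open>(\<zeta> - 1)^i\<close> from
      \<open>p\<close> leaves at least one factor \<open>\<zeta> - 1\<close>, which is displayed
      separately because \<open>dvd\<close> asks for it.\<close>
    have e: "(\<zeta> - 1) ^ i * ((\<zeta> - 1) * (\<zeta> - 1) ^ (p - 2 - i)) = (\<zeta> - 1) ^ (p - 1)"
      unfolding power_Suc[symmetric] power_add[symmetric]
      using Suc.prems by (intro arg_cong2[where f = "(^)"]) auto
    have "evp \<zeta> f = of_nat p * evp \<zeta> U + (\<zeta> - 1) ^ i * evp \<zeta> V"
      unfolding UV by simp
    then have "(\<zeta> - 1) ^ i * evp \<zeta> V = of_nat p * (y - evp \<zeta> U)"
      using assms(1) by (simp add: ring_distribs)
    also have "\<dots> = ((\<zeta> - 1) ^ i * ((\<zeta> - 1) * (\<zeta> - 1) ^ (p - 2 - i))) * evp \<zeta> w * (y - evp \<zeta> U)"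
      unfolding e w ..
    also have "\<dots> = (\<zeta> - 1) ^ i * ((\<zeta> - 1) * ((\<zeta> - 1) ^ (p - 2 - i) * evp \<zeta> w) * (y - evp \<zeta> U))"
      by (simp only: mult_ac)
    finally have "evp \<zeta> V = (\<zeta> - 1) * ((\<zeta> - 1) ^ (p - 2 - i) * evp \<zeta> w) * (y - evp \<zeta> U)"
      by (subst (asm) mult_left_cancel) auto
    then have "evp \<zeta> V = (\<zeta> - 1) * evp \<zeta> ([:-1, 1:] ^ (p - 2 - i) * w) * (y - evp \<zeta> U)"
      by simp
    then have "int p dvd poly V 1" by (rule dvd)
    then obtain v where v: "poly V 1 = int p * v" by (auto elim: dvdE)
    obtain V' where "V = [:poly V 1:] + [:-1, 1:] * V'" by (rule poly_div_X_minus_1)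
    then have V: "V = of_nat p * [:v:] + [:-1, 1:] * V'" unfolding v by (simp add: of_nat_poly)
    have "f = of_nat p * (U + [:-1, 1:] ^ i * [:v:]) + [:-1, 1:] ^ Suc i * V'"
      unfolding UV by (subst V) (simp only: algebra_simps power_Suc)
    then show ?case by (intro exI)
  qed
  from this[OF order_refl] that show thesis by (elim exE)
qed

lemma p_dvd_evp:
  assumes "evp \<zeta> f = of_nat p * evp \<zeta> g"
  obtains U V where "f = of_nat p * U + [:-1, 1:] ^ (p - 1) * V"
proof (rule p_dvd_evp_gen[OF assms])
  fix U V h assume "evp \<zeta> V = (\<zeta> - 1) * evp \<zeta> h * (evp \<zeta> g - evp \<zeta> U)"
  then have "evp \<zeta> (V - [:-1, 1:] * h * (g - U)) = 0" by (simp only: evp_diff evp_mult) simp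
  then have "int p dvd poly (V - [:-1, 1:] * h * (g - U)) 1" by (rule evp_zero_imp_dvd)
  then show "int p dvd poly V 1" by simp
qed (rule that)

end

text \<open>Translating \<open>X\<close> to \<open>X + 1\<close> turns \<open>(X - 1)^n\<close> into
  \<open>X^n\<close>, which affects only the coefficients from index \<open>n\<close> on, where
  those of \<open>f\<close> vanish by the degree bound.\<close>

lemma const_dvd_of_cong_X_minus_1_power:
  fixes f U V :: "int poly"
  assumes "f = [:c:] * U + [:-1, 1:] ^ n * V" and "degree f < n"
  shows "[:c:] dvd f"
proof -
  define h where "h = pcompose f [:1, 1:]"
  have X: "pcompose ([:-1, 1:] ^ n) [:1, 1:] = (monom 1 n :: int poly)"
  proof (induction n)
    case (Suc n)
    have "pcompose [:-1, 1:] [:1, 1:] = ([:0, 1:] :: int poly)" by (simp add: pcompose_pCons)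
    then show ?case using Suc by (simp only: power_Suc pcompose_mult) (simp add: monom_Suc)
  qed (simp add: pcompose_1)
  have h: "h = [:c:] * pcompose U [:1, 1:] + monom 1 n * pcompose V [:1, 1:]"
    unfolding h_def by (subst assms(1)) (simp add: pcompose_add pcompose_mult pcompose_smult X)
  have deg: "degree h < n" using assms(2) by (simp add: h_def degree_pcompose)
  have "[:c:] dvd h"
    unfolding const_poly_dvd_iff
  proof
    fix i
    show "c dvd coeff h i"
    proof (cases "i < n")
      case True
      then show ?thesis unfolding h by (simp add: coeff_monom_mult)
    next
      case False
      then show ?thesis using deg by (simp add: coeff_eq_0)
    qed
  qed
  then obtain g where g: "h = [:c:] * g" by (elim dvdE)
  have "f = pcompose h [:-1, 1:]"
    unfolding h_def by (simp flip: pcompose_assoc add: pcompose_pCons pcompose_idR)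
  also have "\<dots> = [:c:] * pcompose g [:-1, 1:]" unfolding g by (simp add: pcompose_mult pcompose_smult)
  finally show ?thesis by (rule dvdI)
qed

lemma monic_division:
  fixes f g :: "'a :: idom poly"
  assumes "lead_coeff g = 1" and "degree g > 0"
  obtains q r where "f = g * q + r" and "degree r < degree g"
proof -
  obtain q r where qr: "pseudo_divmod f g = (q, r)" by (cases "pseudo_divmod f g")
  have "g \<noteq> 0" using assms by auto
  from pseudo_divmod[OF this qr] assms have "f = g * q + r" "degree r < degree g" by auto
  then show thesis by (rule that)
qed

context cyclotomic
begin

definition Zz :: "complex set" where "Zz = range (evp \<zeta>)"

lemma evp_in_Zz [simp, intro]: "evp \<zeta> f \<in> Zz"
  by (simp add: Zz_def)

lemma ZzE: assumes "x \<in> Zz" obtains f where "x = evp \<zeta> f"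
  using assms by (auto simp: Zz_def)

lemma Zz_of_int [simp, intro]: "of_int n \<in> Zz"
  using evp_in_Zz[of "[:n:]"] by simp

lemma Zz_of_nat [simp, intro]: "of_nat n \<in> Zz"
  using Zz_of_int[of "int n"] by simp

lemma Zz_0 [simp, intro]: "0 \<in> Zz" and Zz_1 [simp, intro]: "1 \<in> Zz"
  using Zz_of_int[of 0] Zz_of_int[of 1] by simp_all

lemma Zz_zeta [simp, intro]: "\<zeta> \<in> Zz"
  using evp_in_Zz[of "[:0, 1:]"] by simp

lemma Zz_add [simp, intro]: "x \<in> Zz \<Longrightarrow> y \<in> Zz \<Longrightarrow> x + y \<in> Zz"
  by (metis ZzE evp_add evp_in_Zz)

lemma Zz_mult [simp, intro]: "x \<in> Zz \<Longrightarrow> y \<in> Zz \<Longrightarrow> x * y \<in> Zz"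
  by (metis ZzE evp_mult evp_in_Zz)

lemma Zz_minus [simp, intro]: "x \<in> Zz \<Longrightarrow> - x \<in> Zz"
  by (metis ZzE evp_minus evp_in_Zz)

lemma Zz_diff [simp, intro]: "x \<in> Zz \<Longrightarrow> y \<in> Zz \<Longrightarrow> x - y \<in> Zz"
  by (metis ZzE evp_diff evp_in_Zz)

lemma Zz_power [simp, intro]: "x \<in> Zz \<Longrightarrow> x ^ n \<in> Zz"
  by (induction n) simp_all

lemma Zz_sum [intro]: "(\<And>x. x \<in> A \<Longrightarrow> f x \<in> Zz) \<Longrightarrow> sum f A \<in> Zz"
  by (induction A rule: infinite_finite_induct) simp_all

lemma Zz_prod [intro]: "(\<And>x. x \<in> A \<Longrightarrow> f x \<in> Zz) \<Longrightarrow> prod f A \<in> Zz"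
  by (induction A rule: infinite_finite_induct) simp_all

lemma Zz_evp [intro]: "z \<in> Zz \<Longrightarrow> evp z f \<in> Zz"
  by (induction f) simp_all

lemma Zz_cnj [simp, intro]: "x \<in> Zz \<Longrightarrow> cnj x \<in> Zz"
  using Zz_evp[of "cnj \<zeta>"] by (auto elim!: ZzE simp: evp_cnj cnj_zeta)

text \<open>Together with \<open>p_eq_pi_power\<close> this makes \<open>p\<close> and
  \<open>(\<zeta> - 1)^(p-1)\<close> associates.\<close>

lemma pi_power_p: obtains c where "c \<in> Zz" "(\<zeta> - 1) ^ (p - 1) = of_nat p * c"
proof -
  obtain W where W: "Phi = [:-1, 1:] ^ (p - 1) + of_nat p * W" by (rule Phi_cong)
  have "evp \<zeta> Phi = (\<zeta> - 1) ^ (p - 1) + of_nat p * evp \<zeta> W" unfolding W by simp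
  then have "(\<zeta> - 1) ^ (p - 1) = of_nat p * (- evp \<zeta> W)" by (simp add: eq_neg_iff_add_eq_0)
  moreover have "- evp \<zeta> W \<in> Zz" by (intro Zz_minus evp_in_Zz)
  ultimately show thesis using that by blast
qed

text \<open>Infinite descent: the value 0 is divisible by \<open>p\<close>, so the polynomial
  \<open>f\<close> is divisible by \<open>p\<close>, and \<open>f / p\<close> is a smaller
  counterexample. This is the linear independence of
  \<open>1, \<zeta>, ..., \<zeta>^(p-2)\<close>.\<close>

lemma evp_zero_degree:
  assumes "evp \<zeta> f = 0" and "degree f < p - 1"
  shows "f = 0"
  using assms
proof (induction "nat \<bar>lead_coeff f\<bar>" arbitrary: f rule: less_induct)
  case less
  show ?case
  proof (rule ccontr)
    assume nz: "f \<noteq> 0"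
    have "evp \<zeta> f = of_nat p * evp \<zeta> 0" using less.prems by simp
    then obtain U V where "f = of_nat p * U + [:-1, 1:] ^ (p - 1) * V" by (rule p_dvd_evp)
    then have "f = [:int p:] * U + [:-1, 1:] ^ (p - 1) * V" by (simp add: of_nat_poly)
    then have "[:int p:] dvd f"
      using less.prems(2) by (rule const_dvd_of_cong_X_minus_1_power)
    then obtain g where g: "f = [:int p:] * g" by (elim dvdE)
    have g0: "g \<noteq> 0" using nz g by auto
    have lc: "lead_coeff f = int p * lead_coeff g" unfolding g using p_pos by simp
    have "\<bar>lead_coeff g\<bar> < \<bar>lead_coeff f\<bar>"
      unfolding lc abs_mult using g0 p_gt_2 by simp
    then have "nat \<bar>lead_coeff g\<bar> < nat \<bar>lead_coeff f\<bar>" by linarith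
    moreover have "evp \<zeta> g = 0" using less.prems p_pos unfolding g by simp
    moreover have "degree g < p - 1" using less.prems p_pos unfolding g by simp
    ultimately have "g = 0" by (rule less.hyps)
    with g0 show False ..
  qed
qed

section \<open>Conjugates, traces and rational elements\<close>

lemma evp_Phi_conj: assumes "k \<in> {1..<p}" shows "evp (\<zeta> ^ k) Phi = 0"
proof -
  have "(\<zeta> ^ k) ^ p = 1" by (simp only: power_mult[symmetric] mult.commute[of k]) (simp add: power_mult)
  then have "evp (\<zeta> ^ k) ([:-1, 1:] * Phi) = 0" unfolding Phi_mult by simp
  moreover have "\<zeta> ^ k \<noteq> 1" using assms by (auto simp: zeta_eq_1_iff dest: dvd_imp_le)
  ultimately show ?thesis by (simp only: evp_mult) simp
qed

lemma evp_reduce: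
  obtains r where "degree r < p - 1" "\<And>k. k \<in> {1..<p} \<Longrightarrow> evp (\<zeta> ^ k) r = evp (\<zeta> ^ k) f"
proof -
  have "degree Phi > 0" using p_gt_2 by (simp add: degree_Phi)
  then obtain q r where r: "f = Phi * q + r" "degree r < degree Phi"
    by (rule monic_division[OF lead_coeff_Phi])
  show thesis
  proof (rule that[of r])
    show "degree r < p - 1" using r(2) by (simp add: degree_Phi)
    show "evp (\<zeta> ^ k) r = evp (\<zeta> ^ k) f" if "k \<in> {1..<p}" for k
      using evp_Phi_conj[OF that] unfolding r(1) by simp
  qed
qed

text \<open>The remainder modulo \<open>Phi\<close> agrees with \<open>f\<close> at all conjugates
  of \<open>\<zeta>\<close>, and it is the zero polynomial by \<open>evp_zero_degree\<close>. Hence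
  conjugation is well defined on values.\<close>

lemma evp_zero_conj:
  assumes "evp \<zeta> f = 0" "k \<in> {1..<p}"
  shows "evp (\<zeta> ^ k) f = 0"
proof -
  obtain r where r: "degree r < p - 1" "\<And>k. k \<in> {1..<p} \<Longrightarrow> evp (\<zeta> ^ k) r = evp (\<zeta> ^ k) f"
    by (rule evp_reduce[of f]) blast
  have "evp \<zeta> r = 0" using r(2)[of 1] assms p_gt_2 by simp
  then have "r = 0" using r(1) by (rule evp_zero_degree)
  then show ?thesis using r(2)[OF assms(2)] by simp
qed

lemma evp_eq_conj:
  assumes "evp \<zeta> f = evp \<zeta> g" "k \<in> {1..<p}"
  shows "evp (\<zeta> ^ k) f = evp (\<zeta> ^ k) g"
  using evp_zero_conj[of "f - g" k] assms by simp

text \<open>For \<open>0 < k < p\<close> this is the automorphism of \<open>\<int>[\<zeta>]\<close>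
  sending \<open>\<zeta>\<close> to \<open>\<zeta>^k\<close>; by \<open>evp_eq_conj\<close> the
  chosen polynomial does not matter.\<close>

definition sigma :: "nat \<Rightarrow> complex \<Rightarrow> complex"
  where "sigma k x = evp (\<zeta> ^ k) (SOME f. evp \<zeta> f = x)"

lemma sigma_evp: assumes "k \<in> {1..<p}" shows "sigma k (evp \<zeta> f) = evp (\<zeta> ^ k) f"
proof -
  have "evp \<zeta> (SOME g. evp \<zeta> g = evp \<zeta> f) = evp \<zeta> f" by (rule someI) (rule refl)
  then show ?thesis unfolding sigma_def by (rule evp_eq_conj) (rule assms)
qed

lemma sigma_mult: "k \<in> {1..<p} \<Longrightarrow> x \<in> Zz \<Longrightarrow> y \<in> Zz \<Longrightarrow> sigma k (x * y) = sigma k x * sigma k y"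
  by (auto elim!: ZzE simp: sigma_evp simp flip: evp_mult)

lemma sigma_of_int: "k \<in> {1..<p} \<Longrightarrow> sigma k (of_int n) = of_int n"
  using sigma_evp[of k "[:n:]"] by simp

text \<open>On p-th roots of unity conjugation is the power map with exponent \<open>p - 1\<close>,
  thus one polynomial substitution serves for \<open>\<zeta>\<close> and \<open>\<zeta>^k\<close>
  alike.\<close>

lemma sigma_cnj: assumes "k \<in> {1..<p}" "x \<in> Zz" shows "sigma k (cnj x) = cnj (sigma k x)"
proof -
  from assms(2) obtain f where x: "x = evp \<zeta> f" by (rule ZzE)
  have e: "cnj (evp z f) = evp z (pcompose f (monom 1 (p - 1)))" if "z ^ p = 1" for z
  proof -
    have "z * z ^ (p - 1) = 1" using that p_pos by (simp flip: power_Suc)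
    moreover have "norm z = 1"
    proof -
      have "norm z ^ p = norm (z ^ p)" by (simp only: norm_power)
      then have "norm z ^ p = 1" using that by simp
      then show ?thesis using p_pos power_eq_imp_eq_base[of "norm z" p 1] by simp
    qed
    then have "z * cnj z = 1" "z \<noteq> 0" using complex_norm_square[of z] by auto
    ultimately have "cnj z = z ^ (p - 1)" by (metis mult_left_cancel)
    then show ?thesis by (simp add: evp_cnj)
  qed
  have "(\<zeta> ^ k) ^ p = 1" by (simp only: power_mult[symmetric] mult.commute[of k]) (simp add: power_mult)
  then show ?thesis unfolding x by (simp only: e zeta_p sigma_evp[OF assms(1)])
qed

lemma trace_int: obtains a where "(\<Sum>k\<in>{1..<p}. evp (\<zeta> ^ k) f) = of_int a"
proof -
  have "{..<p} = insert 0 {1..<p}" using p_pos by auto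
  then have "(\<Sum>k<p. evp (\<zeta> ^ k) f) = of_int (poly f 1) + (\<Sum>k\<in>{1..<p}. evp (\<zeta> ^ k) f)" by simp
  then have "(\<Sum>k\<in>{1..<p}. evp (\<zeta> ^ k) f) =
      of_int (int p * (\<Sum>i | i \<le> degree f \<and> p dvd i. coeff f i) - poly f 1)"
    unfolding sum_evp by simp
  then show thesis by (rule that)
qed

text \<open>The sum of the conjugates is a rational integer and here equals
  \<open>(p - 1) f(\<zeta>)\<close>; uniqueness of reduced representatives then forces that of
  \<open>f(\<zeta>)\<close> to be constant.\<close>

lemma invariant_int:
  assumes "\<And>k. k \<in> {1..<p} \<Longrightarrow> evp (\<zeta> ^ k) f = evp \<zeta> f"
  obtains a where "evp \<zeta> f = of_int a"
proof -
  obtain r where r: "degree r < p - 1" "\<And>k. k \<in> {1..<p} \<Longrightarrow> evp (\<zeta> ^ k) r = evp (\<zeta> ^ k) f"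
    by (rule evp_reduce[of f]) blast
  have e: "evp \<zeta> r = evp \<zeta> f" using r(2)[of 1] p_gt_2 by simp
  obtain a where a: "(\<Sum>k\<in>{1..<p}. evp (\<zeta> ^ k) f) = of_int a" by (rule trace_int)
  have "(\<Sum>k\<in>{1..<p}. evp (\<zeta> ^ k) f) = (\<Sum>k\<in>{1..<p}. evp \<zeta> f)"
    by (intro sum.cong refl assms)
  then have "of_int (int (p - 1)) * evp \<zeta> r = of_int a" using a e by simp
  then have "evp \<zeta> (Polynomial.smult (int (p - 1)) r - [:a:]) = 0" by simp
  moreover have "degree (Polynomial.smult (int (p - 1)) r - [:a:]) < p - 1"
    using r(1) p_gt_2 by (intro le_less_trans[OF degree_diff_le_max]) simp
  ultimately have z: "Polynomial.smult (int (p - 1)) r - [:a:] = 0" by (rule evp_zero_degree)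
  have "coeff r i = 0" if "i > 0" for i
  proof -
    have "coeff (Polynomial.smult (int (p - 1)) r - [:a:]) i = 0" unfolding z by simp
    then show ?thesis using that p_gt_2 by (simp add: coeff_pCons split: nat.splits)
  qed
  then have "degree r = 0" by (metis gr0I leading_coeff_0_iff degree_0)
  then obtain b where "r = [:b:]" by (rule degree_eq_zeroE)
  then have "evp \<zeta> f = of_int b" using e by simp
  then show thesis by (rule that)
qed

lemma Zz_rational:
  assumes "x \<in> Zz" "of_int b * x = of_int a"
  shows "b dvd a"
proof -
  obtain f where f: "x = evp \<zeta> f" using assms(1) by (rule ZzE)
  obtain r where r: "degree r < p - 1" "\<And>k. k \<in> {1..<p} \<Longrightarrow> evp (\<zeta> ^ k) r = evp (\<zeta> ^ k) f"
    by (rule evp_reduce[of f]) blast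
  have e: "evp \<zeta> r = x" using r(2)[of 1] p_gt_2 f by simp
  have "evp \<zeta> (Polynomial.smult b r - [:a:]) = 0" using assms e by simp
  moreover have "degree (Polynomial.smult b r - [:a:]) < p - 1"
    using r(1) p_gt_2 by (intro le_less_trans[OF degree_diff_le_max]) auto
  ultimately have z: "Polynomial.smult b r - [:a:] = 0" by (rule evp_zero_degree)
  have "coeff (Polynomial.smult b r - [:a:]) 0 = 0" unfolding z by simp
  then have "a = b * coeff r 0" by simp
  then show ?thesis by (rule dvdI)
qed

text \<open>The elements with power-bounded denominators: completely integral over \<open>\<int>[\<zeta>]\<close>. They
  form a ring for trivial reasons, and serve as a substitute for the ring of algebraic
  integers.\<close>
definition cint :: "complex set"
  where "cint = {y. \<exists>n::int. n \<noteq> 0 \<and> (\<forall>k. of_int n * y ^ k \<in> Zz)}"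

lemma cintI: "n \<noteq> 0 \<Longrightarrow> (\<And>k. of_int n * y ^ k \<in> Zz) \<Longrightarrow> y \<in> cint"
  by (auto simp: cint_def)

lemma cintE: assumes "y \<in> cint" obtains n :: int where "n \<noteq> 0" "\<And>k. of_int n * y ^ k \<in> Zz"
  using assms by (auto simp: cint_def)

lemma Zz_cint: "x \<in> Zz \<Longrightarrow> x \<in> cint"
  by (rule cintI[of 1]) auto

lemma cint_mult: assumes "x \<in> cint" "y \<in> cint" shows "x * y \<in> cint"
proof -
  obtain m where m: "m \<noteq> 0" "\<And>k. of_int m * x ^ k \<in> Zz" using assms(1) by (rule cintE) blast
  obtain n where n: "n \<noteq> 0" "\<And>k. of_int n * y ^ k \<in> Zz" using assms(2) by (rule cintE) blast
  show ?thesis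
  proof (rule cintI[of "m * n"])
    show "of_int (m * n) * (x * y) ^ k \<in> Zz" for k
      using Zz_mult[OF m(2) n(2), of k k] by (simp add: power_mult_distrib mult_ac)
  qed (use m n in simp)
qed

lemma cint_add: assumes "x \<in> cint" "y \<in> cint" shows "x + y \<in> cint"
proof -
  obtain m where m: "m \<noteq> 0" "\<And>k. of_int m * x ^ k \<in> Zz" using assms(1) by (rule cintE) blast
  obtain n where n: "n \<noteq> 0" "\<And>k. of_int n * y ^ k \<in> Zz" using assms(2) by (rule cintE) blast
  show ?thesis
  proof (rule cintI[of "m * n"])
    fix k
    have "of_int (m * n) * (x + y) ^ k =
      (\<Sum>i\<le>k. of_nat (k choose i) * ((of_int m * x ^ i) * (of_int n * y ^ (k - i))))"
      unfolding binomial_ring sum_distrib_left by (intro sum.cong) (auto simp: mult_ac)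
    also have "\<dots> \<in> Zz" by (intro Zz_sum Zz_mult Zz_of_nat m n)
    finally show "of_int (m * n) * (x + y) ^ k \<in> Zz" .
  qed (use m n in simp)
qed

lemma cint_diff: "x \<in> cint \<Longrightarrow> y \<in> cint \<Longrightarrow> x - y \<in> cint"
  using cint_add[of x "(-1) * y"] cint_mult[of "-1" y] Zz_cint[of "-1"] by simp

lemma cint_power: "x \<in> cint \<Longrightarrow> x ^ k \<in> cint"
  by (induction k) (auto intro: cint_mult Zz_cint)

lemma cint_sum: "(\<And>x. x \<in> A \<Longrightarrow> f x \<in> cint) \<Longrightarrow> sum f A \<in> cint"
  by (induction A rule: infinite_finite_induct) (auto intro: cint_add Zz_cint)

text \<open>In lowest terms \<open>a' / b'\<close>, the bounded denominators make every power of
  \<open>b'\<close> divide one fixed nonzero integer \<open>n\<close>, so \<open>b'\<close> is a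
  unit.\<close>

lemma cint_rational:
  assumes "y \<in> cint" "of_int b * y = of_int a" "b \<noteq> 0"
  shows "b dvd a"
proof -
  obtain n where n: "n \<noteq> 0" "\<And>k. of_int n * y ^ k \<in> Zz" using assms(1) by (rule cintE) blast
  define g where "g = gcd a b"
  have "g \<noteq> 0" using assms(3) by (simp add: g_def)
  obtain a' b' where ab: "a = a' * g" "b = b' * g" "coprime a' b'"
    unfolding g_def using gcd_coprime_exists[of a b] assms(3) by auto
  have "of_int g * (of_int b' * y) = of_int g * of_int a'"
    using assms(2) unfolding ab by (simp add: mult_ac)
  then have y: "of_int b' * y = of_int a'" using \<open>g \<noteq> 0\<close> by simp
  have dvd: "b' ^ k dvd n" for k
  proof -
    have "of_int (b' ^ k) * (of_int n * y ^ k) = of_int n * (of_int b' * y) ^ k"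
      by (simp add: power_mult_distrib mult_ac)
    also have "\<dots> = of_int (n * a' ^ k)" unfolding y by simp
    finally have "b' ^ k dvd n * a' ^ k" using n(2) by (intro Zz_rational)
    moreover have "coprime (b' ^ k) (a' ^ k)" using ab(3) by (simp add: coprime_commute)
    ultimately show ?thesis by (simp add: coprime_dvd_mult_left_iff)
  qed
  have "\<bar>b'\<bar> = 1"
  proof (rule ccontr)
    assume "\<bar>b'\<bar> \<noteq> 1"
    moreover have "b' \<noteq> 0" using assms(3) ab by auto
    ultimately have "\<bar>b'\<bar> \<ge> 2" by linarith
    \<comment> \<open>The exponent \<open>\<bar>n\<bar>\<close> is already large enough, because
      \<open>2^m > m\<close>.\<close>
    then have "(2 :: int) ^ nat \<bar>n\<bar> \<le> \<bar>b'\<bar> ^ nat \<bar>n\<bar>" by (intro power_mono) auto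
    also have "\<dots> \<le> \<bar>n\<bar>" using dvd_imp_le_int[OF n(1) dvd] by (simp add: power_abs)
    finally have "(2 :: int) ^ nat \<bar>n\<bar> \<le> int (nat \<bar>n\<bar>)" by simp
    moreover have "int (nat \<bar>n\<bar>) < int (2 ^ nat \<bar>n\<bar>)" by (simp only: of_nat_less_iff less_exp)
    ultimately show False by simp
  qed
  then show ?thesis unfolding ab by (simp add: abs_eq_iff' dvd_mult2) (metis abs_dvd_iff one_dvd \<open>\<bar>b'\<bar> = 1\<close> mult_dvd_mono dvd_refl)
qed

section \<open>Integral closedness of \<open>\<int>[\<zeta>]\<close>\<close>

definition Qz :: "complex set" where "Qz = {x / of_int n | x n. x \<in> Zz \<and> n \<noteq> (0::int)}"

lemma QzE: assumes "y \<in> Qz" obtains x and n :: int where "x \<in> Zz" "n \<noteq> 0" "y = x / of_int n"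
  using assms by (auto simp: Qz_def)

lemma QzI: "x \<in> Zz \<Longrightarrow> n \<noteq> 0 \<Longrightarrow> of_int n * y = x \<Longrightarrow> y \<in> Qz"
  unfolding Qz_def by (auto simp: field_simps intro!: exI[of _ x] exI[of _ n])

lemma cint_conj:
  assumes "evp \<zeta> f / of_int n \<in> cint" "n \<noteq> 0" "k \<in> {1..<p}"
  shows "evp (\<zeta> ^ k) f / of_int n \<in> cint"
proof -
  obtain m where m: "m \<noteq> 0" "\<And>k. of_int m * (evp \<zeta> f / of_int n) ^ k \<in> Zz"
    using assms(1) by (rule cintE) blast
  show ?thesis
  proof (rule cintI[OF m(1)])
    fix j
    obtain g where g: "of_int m * (evp \<zeta> f / of_int n) ^ j = evp \<zeta> g" using m(2)[of j] by (rule ZzE)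
    then have "evp \<zeta> (of_int m * f ^ j) = evp \<zeta> (of_int (n ^ j) * g)"
      using assms(2) by (simp add: power_divide field_simps)
    then have "evp (\<zeta> ^ k) (of_int m * f ^ j) = evp (\<zeta> ^ k) (of_int (n ^ j) * g)"
      using assms(3) by (rule evp_eq_conj)
    then have "of_int m * (evp (\<zeta> ^ k) f / of_int n) ^ j = evp (\<zeta> ^ k) g"
      using assms(2) by (simp add: power_divide field_simps)
    also have "\<dots> \<in> Zz" by (intro Zz_evp Zz_power Zz_zeta)
    finally show "of_int m * (evp (\<zeta> ^ k) f / of_int n) ^ j \<in> Zz" .
  qed
qed

text \<open>Up to the factor \<open>p\<close>, the multipliers form the basis dual to the powers of
  \<open>\<zeta>\<close> under the trace. Subtracting \<open>\<zeta>^k\<close> makes the term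
  \<open>k = 0\<close> vanish, so that the sum is a trace; it leaves the value unchanged because
  \<open>i + 1\<close> is not divisible by \<open>p\<close> for \<open>i < p - 1\<close>.\<close>

lemma coeff_trace:
  assumes "degree f < p - 1" "j < p - 1"
  shows "(\<Sum>k<p. evp (\<zeta> ^ k) f * ((\<zeta> ^ k) ^ (p - j) - \<zeta> ^ k)) = of_nat p * of_int (coeff f j)"
proof -
  have "(\<Sum>k<p. evp (\<zeta> ^ k) f * ((\<zeta> ^ k) ^ (p - j) - \<zeta> ^ k)) =
    (\<Sum>k<p. \<Sum>i<p - 1. of_int (coeff f i) * ((\<zeta> ^ k) ^ (i + (p - j)) - (\<zeta> ^ k) ^ Suc i))"
    unfolding evp_altdef[OF assms(1)] sum_distrib_right
    by (intro sum.cong refl) (simp add: power_add algebra_simps)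
  also have "\<dots> = (\<Sum>i<p - 1. of_int (coeff f i) *
      ((\<Sum>k<p. (\<zeta> ^ k) ^ (i + (p - j))) - (\<Sum>k<p. (\<zeta> ^ k) ^ Suc i)))"
    by (subst sum.swap) (simp only: sum_distrib_left sum_subtractf[symmetric])
  also have "\<dots> = (\<Sum>i<p - 1. if i = j then of_nat p * of_int (coeff f j) else 0)"
  proof (intro sum.cong refl)
    fix i assume i: "i \<in> {..<p - 1}"
    have "\<not> p dvd Suc i" using i by (auto dest: dvd_imp_le)
    moreover have "p dvd i + (p - j) \<longleftrightarrow> i = j"
    proof
      assume "p dvd i + (p - j)"
      then obtain c where c: "i + (p - j) = p * c" by (elim dvdE)
      have "i + (p - j) < p * 2" "0 < i + (p - j)" using i assms(2) by auto
      then have "0 < p * c" "p * c < p * 2" by (simp_all only: c)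
      then have "c = 1" by simp
      then show "i = j" using c assms(2) by simp
    qed (use assms(2) in auto)
    ultimately show "of_int (coeff f i) * ((\<Sum>k<p. (\<zeta> ^ k) ^ (i + (p - j))) - (\<Sum>k<p. (\<zeta> ^ k) ^ Suc i)) =
      (if i = j then of_nat p * of_int (coeff f j) else (0::complex))"
      unfolding sum_zeta by simp
  qed
  also have "\<dots> = of_nat p * of_int (coeff f j)" using assms(2) by simp
  finally show ?thesis .
qed

text \<open>By \<open>coeff_trace\<close> the coefficients, multiplied by \<open>p\<close>, are
  traces of integral elements; being rational, these are rational integers.\<close>

lemma cint_p_mult_Zz:
  assumes "y \<in> cint" "y \<in> Qz"
  shows "of_nat p * y \<in> Zz"
proof -
  obtain x n where xn: "x \<in> Zz" "n \<noteq> (0::int)" "y = x / of_int n" using assms(2) by (rule QzE)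
  obtain f where f: "x = evp \<zeta> f" using xn(1) by (rule ZzE)
  obtain r where r: "degree r < p - 1" "\<And>k. k \<in> {1..<p} \<Longrightarrow> evp (\<zeta> ^ k) r = evp (\<zeta> ^ k) f"
    by (rule evp_reduce[of f]) blast
  have y: "y = evp \<zeta> r / of_int n" using xn f r(2)[of 1] p_gt_2 by simp
  have "[:n:] dvd Polynomial.smult (int p) r"
    unfolding const_poly_dvd_iff
  proof
    fix j
    show "n dvd coeff (Polynomial.smult (int p) r) j"
    proof (cases "j < p - 1")
      case True
      let ?s = "(\<Sum>k\<in>{1..<p}. evp (\<zeta> ^ k) r / of_int n * ((\<zeta> ^ k) ^ (p - j) - \<zeta> ^ k))"
      have "?s \<in> cint"
      proof (rule cint_sum)
        fix k assume "k \<in> {1..<p}"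
        then have "evp (\<zeta> ^ k) r / of_int n \<in> cint"
          using assms(1) xn(2) unfolding y by (intro cint_conj)
        moreover have "(\<zeta> ^ k) ^ (p - j) - \<zeta> ^ k \<in> cint" by (intro Zz_cint) auto
        ultimately show "evp (\<zeta> ^ k) r / of_int n * ((\<zeta> ^ k) ^ (p - j) - \<zeta> ^ k) \<in> cint"
          by (rule cint_mult)
      qed
      moreover have "of_int n * ?s = of_int (int p * coeff r j)"
      proof -
        have "of_int n * ?s = (\<Sum>k\<in>{1..<p}. evp (\<zeta> ^ k) r * ((\<zeta> ^ k) ^ (p - j) - \<zeta> ^ k))"
          using xn(2) by (simp add: sum_distrib_left)
        also have "\<dots> = (\<Sum>k<p. evp (\<zeta> ^ k) r * ((\<zeta> ^ k) ^ (p - j) - \<zeta> ^ k))"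
        proof -
          have "{..<p} = insert 0 {1..<p}" using p_pos by auto
          then show ?thesis by simp
        qed
        finally show ?thesis using coeff_trace[OF r(1) True] by simp
      qed
      ultimately have "n dvd int p * coeff r j" using xn(2) by (rule cint_rational)
      then show ?thesis by simp
    next
      case False
      then show ?thesis using r(1) by (simp add: coeff_eq_0)
    qed
  qed
  then obtain h where h: "Polynomial.smult (int p) r = [:n:] * h" by (elim dvdE)
  have "of_nat p * evp \<zeta> r = evp \<zeta> (Polynomial.smult (int p) r)" by simp
  also have "\<dots> = of_int n * evp \<zeta> h" unfolding h by simp
  finally have "of_nat p * y = evp \<zeta> h" unfolding y using xn(2) by simp
  then show ?thesis by simp
qed

text \<open>The last possible denominator \<open>p\<close> disappears by lifting:
  \<open>p * y\<close> is a value \<open>f(\<zeta>)\<close>, and \<open>p_dvd_evp_gen\<close> writes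
  \<open>f\<close> in terms of \<open>p\<close> and \<open>(X - 1)^(p-1)\<close>, both of which
  become multiples of \<open>p\<close> at \<open>\<zeta>\<close>.\<close>

lemma cint_Zz:
  assumes "y \<in> cint" "y \<in> Qz"
  shows "y \<in> Zz"
proof -
  obtain f where f: "of_nat p * y = evp \<zeta> f" using cint_p_mult_Zz[OF assms] by (rule ZzE)
  obtain c where c: "c \<in> Zz" "(\<zeta> - 1) ^ (p - 1) = of_nat p * c" by (rule pi_power_p)
  obtain U V where UV: "f = of_nat p * U + [:-1, 1:] ^ (p - 1) * V"
  proof (rule p_dvd_evp_gen[OF f[symmetric]])
    fix U V g assume *: "evp \<zeta> V = (\<zeta> - 1) * evp \<zeta> g * (y - evp \<zeta> U)"
    obtain V' where V': "V = [:poly V 1:] + [:-1, 1:] * V'" by (rule poly_div_X_minus_1)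
    define u where "u = evp \<zeta> g * (y - evp \<zeta> U) - evp \<zeta> V'"
    have u: "u \<in> cint"
      unfolding u_def by (intro cint_diff cint_mult assms Zz_cint evp_in_Zz)
    have "evp \<zeta> V = of_int (poly V 1) + (\<zeta> - 1) * evp \<zeta> V'" by (subst V') (simp add: ring_distribs)
    then have "of_int (poly V 1) = (\<zeta> - 1) * u"
      unfolding u_def * by (simp add: ring_distribs mult.assoc)
    \<comment> \<open>The power \<open>p - 1\<close> converts the factor \<open>\<zeta> - 1\<close>
      into a multiple of \<open>p\<close>, and the divisibility becomes one between rational
      integers, to which \<open>cint_rational\<close> applies.\<close>
    then have "of_int (poly V 1) ^ (p - 1) = of_nat p * c * u ^ (p - 1)"
      by (simp only: power_mult_distrib c)
    then have "of_int (int p) * (c * u ^ (p - 1)) = of_int (poly V 1 ^ (p - 1))" by simp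
    then have "int p dvd poly V 1 ^ (p - 1)"
      using p_pos by (intro cint_rational[of "c * u ^ (p - 1)"] cint_mult Zz_cint c cint_power u) auto
    then show "int p dvd poly V 1" using prime_p by (meson prime_dvd_power prime_nat_int_transfer)
  qed
  have "of_nat p * y = of_nat p * (evp \<zeta> U + c * evp \<zeta> V)"
    unfolding f UV evp_add evp_mult evp_power evp_pCons using c(2) by (simp add: ring_distribs)
  then have "y = evp \<zeta> U + c * evp \<zeta> V" using p_pos by simp
  then show ?thesis using c by auto
qed

text \<open>Every power of \<open>y\<close> is an integral combination of the powers below the
  degree of its monic equation, so one power of the denominator clears them all.\<close>

lemma algebraic_int_cint:
  assumes "algebraic_int y" "y \<in> Qz"
  shows "y \<in> cint"
proof -
  obtain x n where xn: "x \<in> Zz" "n \<noteq> (0::int)" "y = x / of_int n" using assms(2) by (rule QzE)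
  obtain q where q: "evp y q = 0" "lead_coeff q = 1"
    using assms(1) unfolding algebraic_int_altdef_ipoly evp_def by auto
  have deg: "degree q > 0"
  proof (rule ccontr)
    assume "\<not> degree q > 0"
    then have "q = 1" using q(2) by (metis degree_eq_zeroE gr0I lead_coeff_pCons(2) one_pCons pCons_0_0 degree_pCons_0 coeff_pCons_0)
    then show False using q(1) by simp
  qed
  show ?thesis
  proof (rule cintI[of "n ^ degree q"])
    fix k
    obtain s r where r: "monom 1 k = q * s + r" "degree r < degree q"
      by (rule monic_division[OF q(2) deg])
    have "y ^ k = evp y (monom 1 k)" by simp
    also have "\<dots> = evp y r" unfolding r(1) using q(1) by simp
    also have "\<dots> = (\<Sum>i<degree q. of_int (coeff r i) * y ^ i)" by (rule evp_altdef[OF r(2)])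
    finally have "of_int (n ^ degree q) * y ^ k = (\<Sum>i<degree q. of_int (coeff r i) * (of_int n ^ degree q * y ^ i))"
      by (simp add: sum_distrib_left mult_ac)
    also have "\<dots> \<in> Zz"
    proof (intro Zz_sum Zz_mult[OF Zz_of_int])
      fix i assume "i \<in> {..<degree q}"
      then have "of_int n ^ degree q = of_int n ^ (degree q - i) * (of_int n :: complex) ^ i"
        by (simp flip: power_add)
      then have "of_int n ^ degree q * y ^ i = of_int (n ^ (degree q - i)) * x ^ i"
        using xn by (simp add: power_divide)
      also have "\<dots> \<in> Zz" using xn by auto
      finally show "of_int n ^ degree q * y ^ i \<in> Zz" .
    qed
    finally show "of_int (n ^ degree q) * y ^ k \<in> Zz" .
  qed (use xn in simp)
qed

text \<open>The point is that one \<open>g\<close> serves for all \<open>z\<close>: the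
  characteristic polynomials formed at \<open>\<zeta>\<close> and at \<open>\<zeta>^j\<close> are to
  be compared coefficientwise.\<close>

lemma charpoly_coeff:
  assumes "finite A"
  shows "\<exists>g. \<forall>z. coeff (\<Prod>k\<in>A. [:- evp (z ^ k) f, 1:]) i = evp z g"
  using assms
proof (induction A arbitrary: i rule: finite_induct)
  case empty
  have "\<forall>z. coeff (\<Prod>k\<in>{}. [:- evp (z ^ k) f, 1:]) i = evp z (if i = 0 then 1 else 0)" by auto
  then show ?case by blast
next
  case (insert k A)
  obtain g where g: "\<And>z. coeff (\<Prod>k\<in>A. [:- evp (z ^ k) f, 1:]) i = evp z g"
    using insert.IH by blast
  show ?case
  proof (cases i)
    case 0
    have "coeff (\<Prod>k\<in>insert k A. [:- evp (z ^ k) f, 1:]) i = evp z (- (pcompose f (monom 1 k)) * g)" for z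
      using g[of z] insert.hyps 0 by simp
    then show ?thesis by blast
  next
    case (Suc j)
    obtain h where h: "\<And>z. coeff (\<Prod>k\<in>A. [:- evp (z ^ k) f, 1:]) j = evp z h"
      using insert.IH by blast
    have "coeff (\<Prod>k\<in>insert k A. [:- evp (z ^ k) f, 1:]) i = evp z (- (pcompose f (monom 1 k)) * g + h)" for z
      using g[of z] h[of z] insert.hyps Suc by simp
    then show ?thesis by blast
  qed
qed

lemma Zz_algebraic_int: assumes "x \<in> Zz" shows "algebraic_int x"
proof -
  obtain f where x: "x = evp \<zeta> f" using assms by (rule ZzE)
  define C where "C z = (\<Prod>k\<in>{1..<p}. [:- evp (z ^ k) f, 1:])" for z
  show ?thesis
  proof (rule algebraic_int.intros[of "C \<zeta>"])
    show "lead_coeff (C \<zeta>) = 1" unfolding C_def by (simp add: lead_coeff_prod)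
    have "\<exists>k\<in>{1..<p}. poly [:- evp (\<zeta> ^ k) f, 1:] x = 0"
      using p_gt_2 x by (intro bexI[of _ 1]) auto
    then show "poly (C \<zeta>) x = 0" unfolding C_def poly_prod by (intro prod_zero) auto
    show "\<forall>i. coeff (C \<zeta>) i \<in> \<int>"
    proof
      fix i
      obtain g where g: "\<And>z. coeff (C z) i = evp z g"
        using charpoly_coeff[of "{1..<p}" f i] unfolding C_def by blast
      have "evp (\<zeta> ^ j) g = evp \<zeta> g" if j: "j \<in> {1..<p}" for j
      proof -
        \<comment> \<open>Replacing \<open>\<zeta>\<close> by a conjugate only permutes the factors,
          so the coefficients are invariant and therefore rational integers.\<close>
        have "C (\<zeta> ^ j) = (\<Prod>k\<in>{1..<p}. [:- evp (\<zeta> ^ (j * k mod p)) f, 1:])"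
          unfolding C_def by (simp add: zeta_mod power_mult)
        also have "\<dots> = C \<zeta>"
          unfolding C_def by (rule prod.reindex_bij_betw[OF residue_perm[OF j]])
        finally show ?thesis by (simp flip: g)
      qed
      then obtain a where "evp \<zeta> g = of_int a" by (rule invariant_int)
      then show "coeff (C \<zeta>) i \<in> \<int>" by (simp add: g)
    qed
  qed
qed

lemma Zz_Qz: "x \<in> Zz \<Longrightarrow> x \<in> Qz"
  by (rule QzI[of x 1]) auto

lemma integers_of_Qz: "integers_of Qz = Zz"
  unfolding integers_of_def
  by (auto intro: cint_Zz algebraic_int_cint Zz_algebraic_int Zz_Qz)

end

subsection \<open>Products of sets of complex numbers\<close>

abbreviation ip :: "complex set \<Rightarrow> complex set \<Rightarrow> complex set"
  where "ip \<equiv> ideal_prod complex_ring"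

lemma complex_ring_simps [simp]:
  "carrier complex_ring = UNIV" "monoid.mult complex_ring = (*)" "one complex_ring = 1"
  "ring.zero complex_ring = 0" "ring.add complex_ring = (+)"
  by (simp_all add: ring_of_type_algebra_def)

lemma ip_mult: "i \<in> I \<Longrightarrow> j \<in> J \<Longrightarrow> i * j \<in> ip I J"
  using ideal_prod.prod[of i I j J complex_ring] by simp

lemma ip_add: "x \<in> ip I J \<Longrightarrow> y \<in> ip I J \<Longrightarrow> x + y \<in> ip I J"
  using ideal_prod.sum[of x complex_ring I J y] by simp

lemma ip_induct [consumes 1, case_names mult add]:
  assumes "x \<in> ip I J" "\<And>i j. i \<in> I \<Longrightarrow> j \<in> J \<Longrightarrow> P (i * j)"
    "\<And>x y. x \<in> ip I J \<Longrightarrow> y \<in> ip I J \<Longrightarrow> P x \<Longrightarrow> P y \<Longrightarrow> P (x + y)"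
  shows "P x"
  using assms(1) by (induction rule: ideal_prod.induct) (use assms in auto)

lemma ip_subset:
  assumes "\<And>i j. i \<in> I \<Longrightarrow> j \<in> J \<Longrightarrow> i * j \<in> T" "\<And>x y. x \<in> T \<Longrightarrow> y \<in> T \<Longrightarrow> x + y \<in> T"
  shows "ip I J \<subseteq> T"
proof
  fix x assume "x \<in> ip I J"
  then show "x \<in> T" by (induction rule: ip_induct) (use assms in auto)
qed

lemma ip_mono: "I \<subseteq> I' \<Longrightarrow> J \<subseteq> J' \<Longrightarrow> ip I J \<subseteq> ip I' J'"
  by (rule ip_subset) (auto intro: ip_mult ip_add)

lemma ip_comm: "ip I J = ip J I"
proof -
  have "ip I J \<subseteq> ip J I" for I J
  proof (rule ip_subset)
    fix i j assume "i \<in> I" "j \<in> J"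
    then have "j * i \<in> ip J I" by (intro ip_mult)
    then show "i * j \<in> ip J I" by (simp only: mult.commute)
  qed (rule ip_add)
  then show ?thesis by blast
qed

lemma ip_assoc_subset: "ip (ip I J) L \<subseteq> ip I (ip J L)"
proof (intro ip_subset ip_add)
  fix z l assume "z \<in> ip I J" "l \<in> L"
  then show "z * l \<in> ip I (ip J L)"
    by (induction rule: ip_induct) (auto simp: mult.assoc distrib_right intro: ip_mult ip_add)
qed

lemma ip_assoc: "ip (ip I J) L = ip I (ip J L)"
proof
  have "ip I (ip J L) = ip (ip L J) I" using ip_comm by metis
  also have "\<dots> \<subseteq> ip L (ip J I)" by (rule ip_assoc_subset)
  also have "\<dots> = ip (ip I J) L" using ip_comm by metis
  finally show "ip I (ip J L) \<subseteq> ip (ip I J) L" .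
qed (rule ip_assoc_subset)

lemma ip_scale: "ip ((*) a ` I) J = (*) a ` ip I J"
proof
  show "ip ((*) a ` I) J \<subseteq> (*) a ` ip I J"
  proof (rule ip_subset)
    fix x y assume "x \<in> (*) a ` ip I J" "y \<in> (*) a ` ip I J"
    then show "x + y \<in> (*) a ` ip I J"
      by (auto simp: distrib_left[symmetric] intro!: imageI ip_add)
  qed (auto simp: mult.assoc intro!: imageI ip_mult)
  have "a * x \<in> ip ((*) a ` I) J" if "x \<in> ip I J" for x
    using that
  proof (induction rule: ip_induct)
    case (mult i j)
    have "(a * i) * j \<in> ip ((*) a ` I) J" using mult by (intro ip_mult) auto
    then show ?case by (simp add: mult.assoc)
  qed (auto simp: distrib_left intro: ip_add)
  then show "(*) a ` ip I J \<subseteq> ip ((*) a ` I) J" by auto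
qed

lemma ip_scale_right: "ip I ((*) a ` J) = (*) a ` ip I J"
  using ip_scale[of a J I] ip_comm by metis

lemma scale_scale: "(*) a ` ((*) b ` I) = (*) (a * b) ` (I :: complex set)"
  by (simp add: image_image mult.assoc)

lemma scale_one [simp]: "(*) 1 ` I = (I :: complex set)"
  by simp

lemma scale_inj: "a \<noteq> 0 \<Longrightarrow> (*) a ` I = (*) a ` J \<Longrightarrow> I = (J :: complex set)"
  by (rule inj_image_eq_iff[THEN iffD1]) (auto intro: injI)

context cyclotomic
begin

subsection \<open>Norms\<close>

lemma Zz_repr:
  assumes "x \<in> Zz"
  obtains c :: "nat \<Rightarrow> int" where "x = (\<Sum>i<p - 1. of_int (c i) * \<zeta> ^ i)"
proof -
  obtain f where f: "x = evp \<zeta> f" using assms by (rule ZzE)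
  obtain r where r: "degree r < p - 1" "\<And>k. k \<in> {1..<p} \<Longrightarrow> evp (\<zeta> ^ k) r = evp (\<zeta> ^ k) f"
    by (rule evp_reduce[of f]) blast
  have "x = evp \<zeta> r" using r(2)[of 1] p_gt_2 f by simp
  then show thesis using evp_altdef[OF r(1), of \<zeta>] that by blast
qed

lemma Zz_sum_zeta: "(\<Sum>i\<in>A. of_int (c i) * \<zeta> ^ i) \<in> Zz"
  by (intro Zz_sum) auto

lemma sigma_sum_zeta:
  assumes "k \<in> {1..<p}"
  shows "sigma k (\<Sum>i\<in>A. of_int (c i) * \<zeta> ^ i) = (\<Sum>i\<in>A. of_int (c i) * (\<zeta> ^ k) ^ i)"
  using sigma_evp[OF assms, of "\<Sum>i\<in>A. monom (c i) i"] by simp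

lemma sigma_Zz: assumes "k \<in> {1..<p}" "x \<in> Zz" shows "sigma k x \<in> Zz"
  using assms(2) by (rule ZzE) (auto simp: sigma_evp[OF assms(1)] intro!: Zz_evp)

text \<open>If \<open>k * j\<close> is 1 modulo \<open>p\<close>, conjugation with index
  \<open>j\<close> undoes conjugation with index \<open>k\<close>.\<close>

lemma sigma_nz: assumes "k \<in> {1..<p}" "x \<in> Zz" "x \<noteq> 0" shows "sigma k x \<noteq> 0"
proof
  assume 0: "sigma k x = 0"
  obtain f where f: "x = evp \<zeta> f" using assms(2) by (rule ZzE)
  have "1 \<in> (\<lambda>j. k * j mod p) ` {1..<p}"
    unfolding bij_betw_imp_surj_on[OF residue_perm[OF assms(1)]] using p_gt_2 by auto
  then obtain j where j: "j \<in> {1..<p}" "k * j mod p = 1" by (elim imageE) simp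
  have "(\<zeta> ^ j) ^ k = \<zeta> ^ (k * j)" by (simp only: power_mult[symmetric] mult.commute)
  also have "\<dots> = \<zeta>" using zeta_mod[of "k * j"] j by simp
  finally have e: "(\<zeta> ^ j) ^ k = \<zeta>" .
  have "evp \<zeta> (pcompose f (monom 1 k)) = 0"
    using 0 by (simp add: f sigma_evp[OF assms(1)])
  then have "evp (\<zeta> ^ j) (pcompose f (monom 1 k)) = 0" using j(1) by (rule evp_zero_conj)
  then show False using e f assms(3) by simp
qed

definition Nm :: "complex \<Rightarrow> complex" where "Nm x = (\<Prod>k\<in>{1..<p}. sigma k x)"

lemma sigma_1: "x \<in> Zz \<Longrightarrow> sigma 1 x = x"
  using sigma_evp[of 1] p_gt_2 by (auto elim!: ZzE)

lemma Nm_int: assumes "x \<in> Zz" obtains a where "Nm x = of_int a"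
proof -
  obtain f where f: "x = evp \<zeta> f" using assms by (rule ZzE)
  define g where "g = (\<Prod>k\<in>{1..<p}. pcompose f (monom 1 k))"
  have Nm: "Nm x = evp \<zeta> g" by (simp add: Nm_def f g_def sigma_evp)
  have "evp (\<zeta> ^ j) g = evp \<zeta> g" if j: "j \<in> {1..<p}" for j
  proof -
    have "evp (\<zeta> ^ j) g = (\<Prod>k\<in>{1..<p}. evp (\<zeta> ^ (j * k mod p)) f)"
      by (simp add: g_def zeta_mod power_mult)
    also have "\<dots> = (\<Prod>k\<in>{1..<p}. evp (\<zeta> ^ k) f)"
      by (rule prod.reindex_bij_betw[OF residue_perm[OF j]])
    finally show ?thesis by (simp add: g_def)
  qed
  then obtain a where "evp \<zeta> g = of_int a" by (rule invariant_int)
  with Nm that show thesis by simp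
qed

lemma Nm_mult: "x \<in> Zz \<Longrightarrow> y \<in> Zz \<Longrightarrow> Nm (x * y) = Nm x * Nm y"
  by (simp add: Nm_def sigma_mult prod.distrib)

lemma Nm_nz: "x \<in> Zz \<Longrightarrow> x \<noteq> 0 \<Longrightarrow> Nm x \<noteq> 0"
  by (simp add: Nm_def sigma_nz)

lemma Nm_of_int: "Nm (of_int n) = of_int n ^ (p - 1)"
  by (simp add: Nm_def sigma_of_int)

text \<open>The multiple is the norm up to sign, and the cofactor is the product of the other
  conjugates. Division in \<open>Qz\<close> thereby reduces to division by rational
  integers.\<close>

lemma ex_int_multiple:
  assumes "x \<in> Zz" "x \<noteq> 0"
  obtains y and n :: int where "y \<in> Zz" "n > 0" "x * y = of_int n"
proof -
  obtain a where a: "Nm x = of_int a" using assms(1) by (rule Nm_int)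
  have "a \<noteq> 0" using Nm_nz[OF assms] a by auto
  define y where "y = (\<Prod>k\<in>{1..<p} - {1}. sigma k x)"
  have y: "y \<in> Zz" unfolding y_def by (intro Zz_prod sigma_Zz assms) auto
  have "Nm x = sigma 1 x * y"
    unfolding Nm_def y_def using p_gt_2 by (intro prod.remove) auto
  then have xy: "x * y = of_int a" using a sigma_1 assms by simp
  show thesis
  proof (cases "a > 0")
    case True
    then show ?thesis using that y xy by blast
  next
    case False
    then show ?thesis using that[of "- y" "- a"] y xy \<open>a \<noteq> 0\<close> by simp
  qed
qed

lemma Qz_mult [simp, intro]: assumes "x \<in> Qz" "y \<in> Qz" shows "x * y \<in> Qz"
proof -
  obtain a m where a: "a \<in> Zz" "m \<noteq> (0::int)" "x = a / of_int m" using assms(1) by (rule QzE)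
  obtain b n where b: "b \<in> Zz" "n \<noteq> (0::int)" "y = b / of_int n" using assms(2) by (rule QzE)
  show ?thesis by (rule QzI[of "a * b" "m * n"]) (use a b in auto)
qed

lemma Qz_add [simp, intro]: assumes "x \<in> Qz" "y \<in> Qz" shows "x + y \<in> Qz"
proof -
  obtain a m where a: "a \<in> Zz" "m \<noteq> (0::int)" "x = a / of_int m" using assms(1) by (rule QzE)
  obtain b n where b: "b \<in> Zz" "n \<noteq> (0::int)" "y = b / of_int n" using assms(2) by (rule QzE)
  show ?thesis
    by (rule QzI[of "a * of_int n + b * of_int m" "m * n"]) (use a b in \<open>auto simp: field_simps\<close>)
qed

lemma Qz_inverse [simp, intro]: assumes "x \<in> Qz" shows "inverse x \<in> Qz"
proof (cases "x = 0")
  case False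
  obtain a m where a: "a \<in> Zz" "m \<noteq> (0::int)" "x = a / of_int m" using assms by (rule QzE)
  then have "a \<noteq> 0" using False by auto
  then obtain b n where b: "b \<in> Zz" "n > (0::int)" "a * b = of_int n"
    using ex_int_multiple a(1) by blast
  show ?thesis
  proof (rule QzI[of "b * of_int m" n])
    show "of_int n * inverse x = b * of_int m"
      using a b(3) \<open>a \<noteq> 0\<close> by (simp flip: b(3))
  qed (use a b in auto)
qed (use Zz_Qz[of 0] in simp)

lemma Qz_divide [simp, intro]: "x \<in> Qz \<Longrightarrow> y \<in> Qz \<Longrightarrow> x / y \<in> Qz"
  by (simp add: divide_inverse)

lemma Qz_minus [simp, intro]: "x \<in> Qz \<Longrightarrow> - x \<in> Qz"
  using Qz_mult[of "-1" x] Zz_Qz[of "-1"] by simp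

lemma Qz_diff [simp, intro]: "x \<in> Qz \<Longrightarrow> y \<in> Qz \<Longrightarrow> x - y \<in> Qz"
  using Qz_add[of x "- y"] by simp

lemma floor_bucket:
  fixes a b m n :: int
  assumes "n > 0" "m * a div n = m * b div n"
  shows "m * \<bar>a - b\<bar> < n \<or> m < 0"
proof -
  define q where "q = m * a div n"
  have "m * a = n * q + m * a mod n" unfolding q_def by simp
  moreover have "m * b = n * q + m * b mod n" unfolding q_def assms(2) by simp
  moreover have "0 \<le> m * a mod n" "m * a mod n < n" "0 \<le> m * b mod n" "m * b mod n < n"
    using assms(1) by simp_all
  ultimately have "\<bar>m * a - m * b\<bar> < n" by linarith
  then show ?thesis by (cases "m < 0") (simp_all add: abs_mult flip: right_diff_distrib)
qed

text \<open>By Dirichlet's box principle, applied to the multiples of \<open>\<alpha> / \<beta>\<close> modulo \<open>\<int>[\<zeta>]\<close>.\<close>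
lemma hurwitz:
  assumes "\<alpha> \<in> Zz" "\<beta> \<in> Zz" "\<beta> \<noteq> 0"
  obtains t w where "t \<in> {1..(p - 1) ^ (p - 1)}" "w \<in> Zz"
    "norm (Nm (of_nat t * \<alpha> - w * \<beta>)) < norm (Nm \<beta>)"
proof -
  define n where "n = p - 1"
  have n: "n > 0" using p_gt_2 by (simp add: n_def)
  obtain \<beta>' N where \<beta>': "\<beta>' \<in> Zz" "N > (0::int)" "\<beta> * \<beta>' = of_int N"
    using ex_int_multiple assms(2,3) by blast
  have "\<alpha> * \<beta>' \<in> Zz" using assms \<beta>' by simp
  then obtain c :: "nat \<Rightarrow> int" where c: "\<alpha> * \<beta>' = (\<Sum>i<n. of_int (c i) * \<zeta> ^ i)"
    unfolding n_def by (rule Zz_repr)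
  \<comment> \<open>\<open>\<phi> t\<close> records in which of \<open>n\<close> equal parts of the
    unit interval the fractional part of each coordinate of \<open>t * \<alpha> / \<beta>\<close>
    lies; \<open>N\<close> is the common denominator. There are \<open>n^n\<close> boxes for the
    \<open>n^n + 1\<close> values of \<open>t\<close>.\<close>
  define \<phi> where "\<phi> t = (\<lambda>i\<in>{..<n}. int n * ((int t * c i) mod N) div N)" for t
  have "\<phi> t \<in> {..<n} \<rightarrow>\<^sub>E {0..<int n}" for t
  proof -
    have "0 \<le> int n * ((int t * c i) mod N) div N \<and> int n * ((int t * c i) mod N) div N < int n" for i
    proof
      show "0 \<le> int n * ((int t * c i) mod N) div N"
        using \<beta>'(2) by (intro div_int_pos_iff[THEN iffD2]) auto
      have "int n * ((int t * c i) mod N) < int n * N"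
        using \<beta>'(2) n by simp
      then show "int n * ((int t * c i) mod N) div N < int n"
      proof -
        assume less: "int n * ((int t * c i) mod N) < int n * N"
        have "N * (int n * ((int t * c i) mod N) div N) \<le> int n * ((int t * c i) mod N)"
          using \<beta>'(2) by (simp add: minus_mod_eq_mult_div[symmetric])
        with less have "N * (int n * ((int t * c i) mod N) div N) < N * int n" by (simp add: mult.commute)
        then show ?thesis using \<beta>'(2) by simp
      qed
    qed
    then show ?thesis unfolding \<phi>_def by auto
  qed
  then have "\<phi> ` {0..n ^ n} \<subseteq> {..<n} \<rightarrow>\<^sub>E {0..<int n}" by blast
  then have "card (\<phi> ` {0..n ^ n}) \<le> card ({..<n} \<rightarrow>\<^sub>E {0..<int n})"
    by (intro card_mono finite_PiE) auto
  also have "\<dots> = n ^ n" by (simp add: card_PiE)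
  finally have "card (\<phi> ` {0..n ^ n}) < card {0..n ^ n}" by simp
  then have "\<not> inj_on \<phi> {0..n ^ n}" by (rule pigeonhole)
  then obtain t1 t2 where t: "t1 < t2" "t2 \<le> n ^ n" "\<phi> t1 = \<phi> t2"
    unfolding inj_on_def by (metis atLeastAtMost_iff linorder_neqE_nat)
  define r where "r i = (int t2 * c i) mod N - (int t1 * c i) mod N" for i
  define v where "v i = (int t2 * c i) div N - (int t1 * c i) div N" for i
  define w where "w = (\<Sum>i<n. of_int (v i) * \<zeta> ^ i)"
  define \<rho> where "\<rho> = (\<Sum>i<n. of_int (r i) * \<zeta> ^ i)"
  have rv: "int (t2 - t1) * c i = N * v i + r i" for i
  proof -
    have "int (t2 - t1) * c i = int t2 * c i - int t1 * c i"
      using t(1) by (simp add: of_nat_diff left_diff_distrib)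
    also have "\<dots> = N * ((int t2 * c i) div N) + (int t2 * c i) mod N
        - (N * ((int t1 * c i) div N) + (int t1 * c i) mod N)" by simp
    also have "\<dots> = N * v i + r i" unfolding v_def r_def by (simp only: algebra_simps)
    finally show ?thesis .
  qed
  have bound: "int n * \<bar>r i\<bar> < N" if "i < n" for i
  proof -
    have "int n * ((int t2 * c i) mod N) div N = int n * ((int t1 * c i) mod N) div N"
      using fun_cong[OF t(3), of i] that by (simp add: \<phi>_def)
    from floor_bucket[OF \<beta>'(2) this] show ?thesis by (simp add: r_def)
  qed
  have "of_nat (t2 - t1) * (\<alpha> * \<beta>') = (\<Sum>i<n. of_int (int (t2 - t1) * c i) * \<zeta> ^ i)"
    unfolding c sum_distrib_left by (simp add: mult.assoc)
  also have "\<dots> = of_int N * w + \<rho>"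
    unfolding rv w_def \<rho>_def sum_distrib_left by (simp add: sum.distrib distrib_right mult.assoc)
  finally have e1: "of_nat (t2 - t1) * (\<alpha> * \<beta>') = of_int N * w + \<rho>" .
  have "of_int N * (of_nat (t2 - t1) * \<alpha> - w * \<beta>) = of_nat (t2 - t1) * (\<alpha> * \<beta>') * \<beta> - of_int N * w * \<beta>"
    unfolding \<beta>'(3)[symmetric] by (simp only: algebra_simps)
  also have "\<dots> = \<rho> * \<beta>" unfolding e1 by (simp add: ring_distribs)
  finally have e2: "of_int N * (of_nat (t2 - t1) * \<alpha> - w * \<beta>) = \<rho> * \<beta>" .
  have wZ: "w \<in> Zz" and \<rho>Z: "\<rho> \<in> Zz" unfolding w_def \<rho>_def by (rule Zz_sum_zeta)+
  \<comment> \<open>With \<open>n\<close> coordinates, each smaller than \<open>N / n\<close>, every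
    conjugate of \<open>\<rho>\<close> is smaller than \<open>N\<close>; hence the choice of
    \<open>n\<close> parts.\<close>
  have sig: "norm (sigma k \<rho>) < of_int N" if k: "k \<in> {1..<p}" for k
  proof -
    have "norm (sigma k \<rho>) \<le> (\<Sum>i<n. norm (of_int (r i) * (\<zeta> ^ k) ^ i))"
      unfolding \<rho>_def sigma_sum_zeta[OF k] by (rule norm_sum)
    also have "\<dots> = of_int (\<Sum>i<n. \<bar>r i\<bar>)" by (simp add: norm_mult norm_power)
    finally have 1: "norm (sigma k \<rho>) \<le> of_int (\<Sum>i<n. \<bar>r i\<bar>)" .
    have "int n * (\<Sum>i<n. \<bar>r i\<bar>) < (\<Sum>i<n. N)"
      unfolding sum_distrib_left using n bound by (intro sum_strict_mono) auto
    then have "(\<Sum>i<n. \<bar>r i\<bar>) < N" using n by simp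
    with 1 show ?thesis by (meson of_int_less_iff le_less_trans)
  qed
  have "norm (Nm \<rho>) = (\<Prod>k\<in>{1..<p}. norm (sigma k \<rho>))" unfolding Nm_def by (rule prod_norm[symmetric])
  also have "\<dots> < (\<Prod>k\<in>{1..<p}. of_int N)"
    using sig p_gt_2 \<beta>'(2) by (intro prod_mono_strict[where i = 1]) (auto intro: less_imp_le)
  also have "\<dots> = of_int N ^ n" by (simp add: n_def)
  finally have N\<rho>: "norm (Nm \<rho>) < of_int N ^ n" .
  have xZ: "of_nat (t2 - t1) * \<alpha> - w * \<beta> \<in> Zz" using assms wZ by simp
  have "of_int N ^ n * norm (Nm (of_nat (t2 - t1) * \<alpha> - w * \<beta>)) = norm (Nm \<rho>) * norm (Nm \<beta>)"
    using arg_cong[OF e2, of "\<lambda>x. norm (Nm x)"] \<beta>'(2)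
    unfolding Nm_mult[OF Zz_of_int xZ] Nm_mult[OF \<rho>Z assms(2)] Nm_of_int
    by (simp add: norm_mult norm_power n_def)
  also have "\<dots> < of_int N ^ n * norm (Nm \<beta>)"
    using N\<rho> Nm_nz[OF assms(2,3)] by simp
  finally have "norm (Nm (of_nat (t2 - t1) * \<alpha> - w * \<beta>)) < norm (Nm \<beta>)"
    using \<beta>'(2) by (simp add: mult_less_cancel_left)
  moreover have "t2 - t1 \<in> {1..(p - 1) ^ (p - 1)}" using t by (auto simp: n_def)
  ultimately show thesis using wZ that by blast
qed

subsection \<open>Fractional ideals\<close>

text \<open>The elementwise form of \<open>fractional_ideal Qz\<close>, to which
  \<open>fractional_ideal_iff\<close> connects it.\<close>

definition frac_ideal :: "complex set \<Rightarrow> bool" where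
  "frac_ideal I \<longleftrightarrow> I \<subseteq> Qz \<and> 0 \<in> I \<and> (\<forall>x\<in>I. \<forall>y\<in>I. x + y \<in> I) \<and> (\<forall>a\<in>Zz. \<forall>x\<in>I. a * x \<in> I) \<and>
     (\<exists>x\<in>I. x \<noteq> 0) \<and> (\<exists>d\<in>Zz. d \<noteq> 0 \<and> (\<forall>x\<in>I. d * x \<in> Zz))"

lemma frac_Qz: "frac_ideal I \<Longrightarrow> x \<in> I \<Longrightarrow> x \<in> Qz"
  and frac_0: "frac_ideal I \<Longrightarrow> 0 \<in> I"
  and frac_add: "frac_ideal I \<Longrightarrow> x \<in> I \<Longrightarrow> y \<in> I \<Longrightarrow> x + y \<in> I"
  and frac_mult: "frac_ideal I \<Longrightarrow> a \<in> Zz \<Longrightarrow> x \<in> I \<Longrightarrow> a * x \<in> I"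
  by (auto simp: frac_ideal_def)

lemma frac_diff: "frac_ideal I \<Longrightarrow> x \<in> I \<Longrightarrow> y \<in> I \<Longrightarrow> x - y \<in> I"
  using frac_add[of I x "(-1) * y"] frac_mult[of I "-1" y] by simp

lemma frac_denominator: assumes "frac_ideal I" obtains d where "d \<in> Zz" "d \<noteq> 0" "\<And>x. x \<in> I \<Longrightarrow> d * x \<in> Zz"
  using assms unfolding frac_ideal_def by blast

lemma frac_nonzero: assumes "frac_ideal I" obtains x where "x \<in> I" "x \<noteq> 0"
  using assms unfolding frac_ideal_def by blast

lemma frac_Zz: "frac_ideal Zz"
  unfolding frac_ideal_def by (auto intro: Zz_Qz bexI[of _ 1])

lemma ring_Zz: "ring (complex_ring\<lparr>carrier := Zz\<rparr>)"
proof (rule ringI)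
  show "abelian_group (complex_ring\<lparr>carrier := Zz\<rparr>)"
  proof (rule abelian_groupI)
    fix x assume "x \<in> carrier (complex_ring\<lparr>carrier := Zz\<rparr>)"
    then show "\<exists>y\<in>carrier (complex_ring\<lparr>carrier := Zz\<rparr>).
        y \<oplus>\<^bsub>complex_ring\<lparr>carrier := Zz\<rparr>\<^esub> x = \<zero>\<^bsub>complex_ring\<lparr>carrier := Zz\<rparr>\<^esub>"
      by (intro bexI[of _ "- x"]) auto
  qed auto
  show "monoid (complex_ring\<lparr>carrier := Zz\<rparr>)" by (rule monoidI) auto
qed (auto simp: algebra_simps)

lemma ideal_Zz_iff:
  "ideal I (complex_ring\<lparr>carrier := Zz\<rparr>) \<longleftrightarrow>
    I \<subseteq> Zz \<and> 0 \<in> I \<and> (\<forall>x\<in>I. \<forall>y\<in>I. x + y \<in> I) \<and> (\<forall>a\<in>Zz. \<forall>x\<in>I. a * x \<in> I)"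
proof
  assume "ideal I (complex_ring\<lparr>carrier := Zz\<rparr>)"
  then interpret ideal I "complex_ring\<lparr>carrier := Zz\<rparr>" .
  show "I \<subseteq> Zz \<and> 0 \<in> I \<and> (\<forall>x\<in>I. \<forall>y\<in>I. x + y \<in> I) \<and> (\<forall>a\<in>Zz. \<forall>x\<in>I. a * x \<in> I)"
  proof (intro conjI ballI)
    show "I \<subseteq> Zz" using a_subset by simp
    show "0 \<in> I" using additive_subgroup.zero_closed[OF additive_subgroup_axioms] by simp
    show "x + y \<in> I" if "x \<in> I" "y \<in> I" for x y
      using additive_subgroup.a_closed[OF additive_subgroup_axioms that] by simp
    show "a * x \<in> I" if "a \<in> Zz" "x \<in> I" for a x
      using I_l_closed[OF that(2), of a] that(1) by simp
  qed
next
  assume I: "I \<subseteq> Zz \<and> 0 \<in> I \<and> (\<forall>x\<in>I. \<forall>y\<in>I. x + y \<in> I) \<and> (\<forall>a\<in>Zz. \<forall>x\<in>I. a * x \<in> I)"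
  interpret R: ring "complex_ring\<lparr>carrier := Zz\<rparr>" by (rule ring_Zz)
  show "ideal I (complex_ring\<lparr>carrier := Zz\<rparr>)"
  proof (rule idealI)
    show "subgroup I (add_monoid (complex_ring\<lparr>carrier := Zz\<rparr>))"
    proof (rule R.add.subgroupI)
      fix a assume a: "a \<in> I"
      then have "\<ominus>\<^bsub>complex_ring\<lparr>carrier := Zz\<rparr>\<^esub> a = - a"
        using I by (intro R.minus_equality[symmetric, THEN sym]) auto
      moreover have "(-1) * a \<in> I" using I a Zz_minus[OF Zz_1] by blast
      ultimately show "\<ominus>\<^bsub>complex_ring\<lparr>carrier := Zz\<rparr>\<^esub> a \<in> I" by simp
    qed (use I in auto)
  next
    fix a x assume ax: "a \<in> I" "x \<in> carrier (complex_ring\<lparr>carrier := Zz\<rparr>)"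
    then have "x * a \<in> I" using I by simp
    then show "x \<otimes>\<^bsub>complex_ring\<lparr>carrier := Zz\<rparr>\<^esub> a \<in> I"
      "a \<otimes>\<^bsub>complex_ring\<lparr>carrier := Zz\<rparr>\<^esub> x \<in> I" by (simp_all add: mult.commute)
  qed (rule ring_Zz)
qed

lemma fractional_ideal_iff: "fractional_ideal Qz I \<longleftrightarrow> frac_ideal I"
proof
  assume "fractional_ideal Qz I"
  then obtain d where d: "I \<subseteq> Qz" "I \<noteq> {0}" "d \<in> Zz" "d \<noteq> 0"
    and id: "ideal ((*) d ` I) (complex_ring\<lparr>carrier := Zz\<rparr>)"
    unfolding fractional_ideal_def integers_of_Qz by blast
  have I: "(*) d ` I \<subseteq> Zz" "0 \<in> (*) d ` I" "\<And>x y. x \<in> I \<Longrightarrow> y \<in> I \<Longrightarrow> d * x + d * y \<in> (*) d ` I"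
    "\<And>a x. a \<in> Zz \<Longrightarrow> x \<in> I \<Longrightarrow> a * (d * x) \<in> (*) d ` I"
    using id unfolding ideal_Zz_iff by auto
  have mem: "d * x \<in> (*) d ` I \<longleftrightarrow> x \<in> I" for x using d(4) by auto
  have z: "0 \<in> I" using I(2) d(4) by auto
  show "frac_ideal I"
    unfolding frac_ideal_def
  proof (intro conjI ballI)
    show "x + y \<in> I" if "x \<in> I" "y \<in> I" for x y
      using I(3)[OF that] mem by (simp flip: distrib_left)
    show "a * x \<in> I" if "a \<in> Zz" "x \<in> I" for a x
      using I(4)[OF that] mem[of "a * x"] by (simp add: mult_ac)
    show "\<exists>x\<in>I. x \<noteq> 0" using d(2) z by blast
    show "\<exists>d\<in>Zz. d \<noteq> 0 \<and> (\<forall>x\<in>I. d * x \<in> Zz)" using d I(1) by blast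
  qed (use d z in auto)
next
  assume I: "frac_ideal I"
  then obtain d where d: "d \<in> Zz" "d \<noteq> 0" "\<And>x. x \<in> I \<Longrightarrow> d * x \<in> Zz" by (rule frac_denominator) blast
  have "ideal ((*) d ` I) (complex_ring\<lparr>carrier := Zz\<rparr>)"
    unfolding ideal_Zz_iff
  proof (intro conjI ballI)
    show "0 \<in> (*) d ` I" using frac_0[OF I] by force
    show "x + y \<in> (*) d ` I" if "x \<in> (*) d ` I" "y \<in> (*) d ` I" for x y
      using that frac_add[OF I] by (auto simp flip: distrib_left)
    show "a * x \<in> (*) d ` I" if "a \<in> Zz" "x \<in> (*) d ` I" for a x
    proof -
      obtain y where y: "y \<in> I" "x = d * y" using \<open>x \<in> _\<close> by auto
      then have "a * x = d * (a * y)" by simp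
      then show ?thesis using frac_mult[OF I that(1) y(1)] by blast
    qed
  qed (use d in auto)
  moreover have "I \<noteq> {0}" using frac_nonzero[OF I] by blast
  ultimately show "fractional_ideal Qz I"
    unfolding fractional_ideal_def integers_of_Qz using d frac_Qz[OF I] by blast
qed

lemma frac_scale: assumes "frac_ideal I" "a \<in> Qz" "a \<noteq> 0" shows "frac_ideal ((*) a ` I)"
proof -
  obtain d where d: "d \<in> Zz" "d \<noteq> 0" "\<And>x. x \<in> I \<Longrightarrow> d * x \<in> Zz"
    using assms(1) by (rule frac_denominator) blast
  obtain b n where b: "b \<in> Zz" "n \<noteq> (0::int)" "a = b / of_int n" using assms(2) by (rule QzE)
  show ?thesis
    unfolding frac_ideal_def
  proof (intro conjI ballI)
    show "(*) a ` I \<subseteq> Qz" using frac_Qz[OF assms(1)] assms(2) by auto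
    show "0 \<in> (*) a ` I" using frac_0[OF assms(1)] by force
    show "x + y \<in> (*) a ` I" if "x \<in> (*) a ` I" "y \<in> (*) a ` I" for x y
      using that frac_add[OF assms(1)] by (auto simp flip: distrib_left)
    show "c * x \<in> (*) a ` I" if "c \<in> Zz" "x \<in> (*) a ` I" for c x
    proof -
      obtain y where y: "y \<in> I" "x = a * y" using \<open>x \<in> _\<close> by auto
      then have "c * x = a * (c * y)" by simp
      then show ?thesis using frac_mult[OF assms(1) that(1) y(1)] by blast
    qed
    obtain x where "x \<in> I" "x \<noteq> 0" using assms(1) by (rule frac_nonzero)
    then show "\<exists>x\<in>(*) a ` I. x \<noteq> 0" using assms(3) by (intro bexI[of _ "a * x"]) auto
    have "of_int n * d * (a * x) \<in> Zz" if "x \<in> I" for x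
    proof -
      have "of_int n * d * (a * x) = b * (d * x)" using b by simp
      also have "\<dots> \<in> Zz" using b(1) d(3)[OF that] by (rule Zz_mult)
      finally show ?thesis .
    qed
    then show "\<exists>d\<in>Zz. d \<noteq> 0 \<and> (\<forall>x\<in>(*) a ` I. d * x \<in> Zz)"
      using b d by (intro bexI[of _ "of_int n * d"]) auto
  qed
qed

lemma frac_ip: assumes I: "frac_ideal I" and J: "frac_ideal J" shows "frac_ideal (ip I J)"
proof -
  obtain d where d: "d \<in> Zz" "d \<noteq> 0" "\<And>x. x \<in> I \<Longrightarrow> d * x \<in> Zz" using I by (rule frac_denominator) blast
  obtain e where e: "e \<in> Zz" "e \<noteq> 0" "\<And>x. x \<in> J \<Longrightarrow> e * x \<in> Zz" using J by (rule frac_denominator) blast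
  show ?thesis
    unfolding frac_ideal_def
  proof (intro conjI ballI ip_add)
    show "ip I J \<subseteq> Qz" by (intro ip_subset) (use frac_Qz I J in auto)
    show "0 \<in> ip I J" using ip_mult[OF frac_0[OF I] frac_0[OF J]] by simp
    show "a * x \<in> ip I J" if "a \<in> Zz" "x \<in> ip I J" for a x
      using that(2)
    proof (induction rule: ip_induct)
      case (mult i j)
      have "(a * i) * j \<in> ip I J" using frac_mult[OF I that(1)] mult by (intro ip_mult)
      then show ?case by (simp add: mult.assoc)
    qed (auto simp: distrib_left intro: ip_add)
    obtain x where x: "x \<in> I" "x \<noteq> 0" using I by (rule frac_nonzero)
    obtain y where y: "y \<in> J" "y \<noteq> 0" using J by (rule frac_nonzero)
    show "\<exists>x\<in>ip I J. x \<noteq> 0" using x y by (intro bexI[of _ "x * y"] ip_mult) auto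
    have "d * e * x \<in> Zz" if "x \<in> ip I J" for x
      using that
    proof (induction rule: ip_induct)
      case (mult i j)
      have "d * e * (i * j) = (d * i) * (e * j)" by simp
      also have "\<dots> \<in> Zz" using d(3)[OF mult(1)] e(3)[OF mult(2)] by (rule Zz_mult)
      finally show ?case .
    qed (auto simp: distrib_left)
    then show "\<exists>d\<in>Zz. d \<noteq> 0 \<and> (\<forall>x\<in>ip I J. d * x \<in> Zz)"
      using d e by (intro bexI[of _ "d * e"]) auto
  qed
qed

lemma ip_Zz: assumes "frac_ideal I" shows "ip Zz I = I"
proof
  show "ip Zz I \<subseteq> I" by (intro ip_subset) (auto intro: frac_mult frac_add assms)
  show "I \<subseteq> ip Zz I" using ip_mult[OF Zz_1, of _ I] by auto
qed

definition prin :: "complex \<Rightarrow> complex set" where "prin a = (*) a ` Zz"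

lemma ip_prin: "frac_ideal I \<Longrightarrow> ip (prin a) I = (*) a ` I"
  unfolding prin_def by (simp add: ip_scale ip_Zz)

lemma frac_prin: "a \<in> Qz \<Longrightarrow> a \<noteq> 0 \<Longrightarrow> frac_ideal (prin a)"
  unfolding prin_def by (intro frac_scale frac_Zz)

lemma ip_prin_prin: "ip (prin a) (prin b) = prin (a * b)"
  unfolding prin_def[of a] ip_scale by (simp add: prin_def ip_scale_right ip_Zz frac_Zz scale_scale)

lemma prin_mem: "a \<in> prin a"
  unfolding prin_def using Zz_1 by force

lemma prin_1: "prin 1 = Zz"
  by (simp add: prin_def)

section \<open>Finiteness of the number of ideal classes\<close>

lemma finite_residues:
  assumes "n > (0::int)"
  obtains S where "finite S" "S \<subseteq> Zz" "\<And>x. x \<in> Zz \<Longrightarrow> \<exists>s\<in>S. \<exists>y\<in>Zz. x = s + of_int n * y"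
proof -
  define S where "S = (\<lambda>c. \<Sum>i<p - 1. of_int (c i) * \<zeta> ^ i) ` ({..<p - 1} \<rightarrow>\<^sub>E {0..<n})"
  show thesis
  proof (rule that[of S])
    show "finite S" unfolding S_def by (intro finite_imageI finite_PiE) auto
    show "S \<subseteq> Zz" unfolding S_def using Zz_sum_zeta by blast
    fix x assume "x \<in> Zz"
    then obtain c :: "nat \<Rightarrow> int" where c: "x = (\<Sum>i<p - 1. of_int (c i) * \<zeta> ^ i)" by (rule Zz_repr)
    define r where "r = (\<lambda>i\<in>{..<p - 1}. c i mod n)"
    have "x = (\<Sum>i<p - 1. of_int (r i + n * (c i div n)) * \<zeta> ^ i)"
      unfolding c by (intro sum.cong) (auto simp: r_def)
    also have "\<dots> = (\<Sum>i<p - 1. of_int (r i) * \<zeta> ^ i) + of_int n * (\<Sum>i<p - 1. of_int (c i div n) * \<zeta> ^ i)"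
      by (simp add: sum.distrib distrib_right sum_distrib_left mult.assoc)
    finally have "x = \<dots>" .
    moreover have "(\<Sum>i<p - 1. of_int (r i) * \<zeta> ^ i) \<in> S"
      unfolding S_def using assms by (intro imageI) (auto simp: r_def)
    ultimately show "\<exists>s\<in>S. \<exists>y\<in>Zz. x = s + of_int n * y" using Zz_sum_zeta by blast
  qed
qed

text \<open>Such an ideal is a union of residue classes modulo \<open>n\<close>, so it is determined
  by its intersection with a finite set of representatives.\<close>

lemma finite_ideals_containing:
  assumes "n > (0::int)"
  shows "finite {I. frac_ideal I \<and> I \<subseteq> Zz \<and> of_int n \<in> I}" (is "finite ?A")
proof -
  obtain S where S: "finite S" "S \<subseteq> Zz" "\<And>x. x \<in> Zz \<Longrightarrow> \<exists>s\<in>S. \<exists>y\<in>Zz. x = s + of_int n * y"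
    using assms by (rule finite_residues) blast
  have "I = {s + of_int n * y | s y. s \<in> I \<inter> S \<and> y \<in> Zz}" if "I \<in> ?A" for I
  proof (intro equalityI subsetI)
    have I: "frac_ideal I" "I \<subseteq> Zz" "of_int n \<in> I" using that by auto
    have nI: "of_int n * y \<in> I" if "y \<in> Zz" for y
      using frac_mult[OF I(1) that I(3)] by (simp add: mult.commute)
    show "x \<in> {s + of_int n * y | s y. s \<in> I \<inter> S \<and> y \<in> Zz}" if "x \<in> I" for x
    proof -
      obtain s y where sy: "s \<in> S" "y \<in> Zz" "x = s + of_int n * y" using S(3) I(2) \<open>x \<in> I\<close> by blast
      have "x - of_int n * y \<in> I" using I(1) \<open>x \<in> I\<close> nI[OF sy(2)] by (rule frac_diff)
      then have "s \<in> I" by (simp add: sy(3))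
      then show ?thesis using sy by blast
    qed
    show "x \<in> I" if "x \<in> {s + of_int n * y | s y. s \<in> I \<inter> S \<and> y \<in> Zz}" for x
      using that nI frac_add[OF I(1)] by blast
  qed
  note eq = this
  have "inj_on (\<lambda>I. I \<inter> S) ?A"
  proof (rule inj_onI)
    fix I J assume "I \<in> ?A" "J \<in> ?A" and IJ: "I \<inter> S = J \<inter> S"
    from eq[OF this(1)] eq[OF this(2)] show "I = J" unfolding IJ by simp
  qed
  moreover have "finite ((\<lambda>I. I \<inter> S) ` ?A)"
    using S(1) by (rule_tac finite_subset[of _ "Pow S"]) auto
  ultimately show ?thesis by (rule finite_imageD[rotated])
qed

text \<open>A common multiple of all multipliers \<open>t\<close> that can occur in
  \<open>hurwitz\<close>.\<close>

definition class_bound :: int where "class_bound = fact ((p - 1) ^ (p - 1))"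

definition reps :: "complex set set"
  where "reps = {I. frac_ideal I \<and> I \<subseteq> Zz \<and> of_int class_bound \<in> I}"

lemma finite_reps: "finite reps"
  unfolding reps_def by (rule finite_ideals_containing) (simp add: class_bound_def)

text \<open>Take \<open>\<beta>\<close> of least norm in an integral multiple \<open>A\<close> of
  \<open>I\<close>. For each \<open>\<alpha>\<close> in \<open>A\<close>, minimality forces the
  element \<open>t * \<alpha> - w * \<beta>\<close> from \<open>hurwitz\<close> to be 0, so
  \<open>\<beta>\<close> divides \<open>class_bound * \<alpha>\<close>. Scaling \<open>A\<close> by
  \<open>class_bound / \<beta>\<close> gives an integral ideal, which contains
  \<open>class_bound\<close> as the image of \<open>\<beta>\<close>.\<close>

lemma ex_rep:
  assumes "frac_ideal I"
  obtains a where "a \<in> Qz" "a \<noteq> 0" "(*) a ` I \<in> reps"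
proof -
  obtain d where d: "d \<in> Zz" "d \<noteq> 0" "\<And>x. x \<in> I \<Longrightarrow> d * x \<in> Zz"
    using assms by (rule frac_denominator) blast
  define A where "A = (*) d ` I"
  have A: "frac_ideal A" "A \<subseteq> Zz" unfolding A_def using d assms by (auto intro: frac_scale Zz_Qz)
  define nn where "nn x = nat \<lfloor>norm (Nm x)\<rfloor>" for x
  have nn: "norm (Nm x) = real (nn x)" if "x \<in> A" for x
  proof -
    obtain a where "Nm x = of_int a" using A(2) \<open>x \<in> A\<close> Nm_int by blast
    then show ?thesis by (simp add: nn_def)
  qed
  obtain x0 where x0: "x0 \<in> A" "x0 \<noteq> 0" using A(1) by (rule frac_nonzero)
  obtain \<beta> where \<beta>: "\<beta> \<in> A" "\<beta> \<noteq> 0" and min: "\<And>y. y \<in> A \<Longrightarrow> y \<noteq> 0 \<Longrightarrow> nn \<beta> \<le> nn y"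
    using ex_has_least_nat[of "\<lambda>x. x \<in> A \<and> x \<noteq> 0" x0 nn] x0 by blast
  have \<beta>Z: "\<beta> \<in> Zz" using \<beta> A by blast
  have div: "of_int class_bound * \<alpha> / \<beta> \<in> Zz" if \<alpha>: "\<alpha> \<in> A" for \<alpha>
  proof -
    obtain t w where tw: "t \<in> {1..(p - 1) ^ (p - 1)}" "w \<in> Zz"
      "norm (Nm (of_nat t * \<alpha> - w * \<beta>)) < norm (Nm \<beta>)"
      using hurwitz[of \<alpha> \<beta>] \<alpha> A \<beta> \<beta>Z by blast
    have mem: "of_nat t * \<alpha> - w * \<beta> \<in> A"
      using A(1) \<alpha> \<beta> tw by (intro frac_diff frac_mult) auto
    have "of_nat t * \<alpha> - w * \<beta> = 0"
    proof (rule ccontr)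
      assume "of_nat t * \<alpha> - w * \<beta> \<noteq> 0"
      then have "nn \<beta> \<le> nn (of_nat t * \<alpha> - w * \<beta>)" using mem min by blast
      then show False using tw(3) nn[OF mem] nn[OF \<beta>(1)] by simp
    qed
    then have e: "of_nat t * \<alpha> = w * \<beta>" by simp
    have "t dvd fact ((p - 1) ^ (p - 1))" using tw(1) by (intro dvd_fact) auto
    then obtain c where c: "fact ((p - 1) ^ (p - 1)) = t * c" by (elim dvdE)
    have "class_bound = int t * int c"
      unfolding class_bound_def by (metis c of_nat_fact of_nat_mult)
    then have "of_int class_bound * \<alpha> = of_nat c * (of_nat t * \<alpha>)" by simp
    also have "\<dots> = of_nat c * w * \<beta>" unfolding e by simp
    finally have "of_int class_bound * \<alpha> / \<beta> = of_nat c * w" using \<beta>(2) by simp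
    then show ?thesis using tw(2) by simp
  qed
  define a where "a = of_int class_bound / \<beta> * d"
  have cb: "class_bound \<noteq> 0" by (simp add: class_bound_def)
  have aQ: "a \<in> Qz" unfolding a_def by (intro Qz_mult Qz_divide Zz_Qz Zz_of_int \<beta>Z d(1))
  have a0: "a \<noteq> 0" unfolding a_def using \<beta> d cb by simp
  have "(*) a ` I = (*) (of_int class_bound / \<beta>) ` A" by (simp add: a_def A_def image_image mult.assoc)
  moreover have "(*) (of_int class_bound / \<beta>) ` A \<subseteq> Zz" using div by auto
  moreover have "of_int class_bound = of_int class_bound / \<beta> * \<beta>" using \<beta>(2) by simp
  then have "of_int class_bound \<in> (*) (of_int class_bound / \<beta>) ` A" using \<beta>(1) by blast
  ultimately have "(*) a ` I \<in> reps"
    unfolding reps_def using frac_scale[OF assms aQ a0] by simp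
  with aQ a0 that show thesis by blast
qed

section \<open>Invertibility of fractional ideals\<close>

definition lin :: "complex set \<Rightarrow> complex set"
  where "lin S = {\<Sum>s\<in>S. a s * s | a. a \<in> S \<rightarrow> Zz}"

lemma lin_add: assumes "x \<in> lin S" "y \<in> lin S" shows "x + y \<in> lin S"
proof -
  obtain a b where "a \<in> S \<rightarrow> Zz" "x = (\<Sum>s\<in>S. a s * s)" "b \<in> S \<rightarrow> Zz" "y = (\<Sum>s\<in>S. b s * s)"
    using assms unfolding lin_def by blast
  then show ?thesis
    unfolding lin_def by (intro CollectI exI[of _ "\<lambda>s. a s + b s"]) (auto simp: sum.distrib distrib_right)
qed

lemma lin_mult: assumes "c \<in> Zz" "x \<in> lin S" shows "c * x \<in> lin S"
proof -
  obtain a where "a \<in> S \<rightarrow> Zz" "x = (\<Sum>s\<in>S. a s * s)"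
    using assms unfolding lin_def by blast
  then show ?thesis
    using assms(1) unfolding lin_def
    by (intro CollectI exI[of _ "\<lambda>s. c * a s"]) (auto simp: sum_distrib_left mult.assoc)
qed

lemma lin_insert:
  assumes "finite S" "s \<notin> S" "x \<in> lin (insert s S)"
  obtains a y where "a \<in> Zz" "y \<in> lin S" "x = a * s + y"
proof -
  obtain a where a: "a \<in> insert s S \<rightarrow> Zz" "x = (\<Sum>s\<in>insert s S. a s * s)"
    using assms(3) unfolding lin_def by blast
  then have "x = a s * s + (\<Sum>s\<in>S. a s * s)" using assms by simp
  moreover have "(\<Sum>s\<in>S. a s * s) \<in> lin S" unfolding lin_def using a(1) by auto
  ultimately show thesis using that a(1) by auto
qed

lemma lin_superset: assumes "finite S" "s \<in> S" shows "s \<in> lin S"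
  unfolding lin_def
proof (intro CollectI exI conjI)
  show "s = (\<Sum>t\<in>S. (if t = s then 1 else 0) * t)"
    using assms by (simp add: if_distrib[of "\<lambda>a. a * _"] cong: if_cong)
qed auto

text \<open>Nakayama's lemma, eliminating the generators of \<open>C\<close> one at a time.\<close>
lemma nakayama:
  assumes B: "frac_ideal B" "B \<subseteq> Zz" and C: "frac_ideal C" and BC: "ip B C = C"
    and S: "finite S" "S \<subseteq> C" and b: "b \<in> B" "\<And>c. c \<in> C \<Longrightarrow> (1 - b) * c \<in> lin S"
  shows "1 \<in> B"
  using S b
proof (induction S arbitrary: b rule: finite_induct)
  case empty
  obtain c where c: "c \<in> C" "c \<noteq> 0" using C by (rule frac_nonzero)
  then have "(1 - b) * c = 0" using empty.prems(3) by (auto simp: lin_def)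
  then have "b = 1" using c by simp
  then show ?case using empty.prems by simp
next
  case (insert s S)
  have rep: "\<exists>a\<in>B. \<exists>g\<in>lin S. (1 - b) * c = a * s + g" if "c \<in> C" for c
  proof -
    have "c \<in> ip B C" using that BC by simp
    then show ?thesis
    proof (induction rule: ip_induct)
      case (mult i j)
      obtain a g where ag: "a \<in> Zz" "g \<in> lin S" "(1 - b) * j = a * s + g"
        using lin_insert[OF insert.hyps insert.prems(3)[OF mult(2)]] by blast
      have "(1 - b) * (i * j) = i * ((1 - b) * j)" by (simp only: mult_ac)
      also have "\<dots> = (a * i) * s + i * g" unfolding ag(3) by (simp add: algebra_simps)
      finally have e: "(1 - b) * (i * j) = (a * i) * s + i * g" .
      have "a * i \<in> B" "i * g \<in> lin S"
        using ag mult B by (auto intro: frac_mult lin_mult)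
      then show ?case using e by blast
    next
      case (add x y)
      obtain a g a' g' where ag: "a \<in> B" "g \<in> lin S" "(1 - b) * x = a * s + g"
        "a' \<in> B" "g' \<in> lin S" "(1 - b) * y = a' * s + g'" using add by blast
      have "(1 - b) * (x + y) = (1 - b) * x + (1 - b) * y" by (simp only: distrib_left)
      also have "\<dots> = (a + a') * s + (g + g')" unfolding ag(3,6) by (simp add: algebra_simps)
      finally have "(1 - b) * (x + y) = (a + a') * s + (g + g')" .
      moreover have "a + a' \<in> B" "g + g' \<in> lin S"
        using ag B by (auto intro: frac_add lin_add)
      ultimately show ?case by blast
    qed
  qed
  have sC: "s \<in> C" using insert.prems by simp
  obtain a g where ag: "a \<in> B" "g \<in> lin S" "(1 - b) * s = a * s + g" using rep[OF sC] by blast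
  \<comment> \<open>By \<open>ag\<close>, \<open>(1 - b - a) * s\<close> lies in the span of the
    other generators. The new element of \<open>B\<close> is chosen so that \<open>1 - b\<close> is
    replaced by \<open>(1 - b - a) * (1 - b)\<close>, which carries all of \<open>C\<close> into
    that span.\<close>
  have b': "1 - (b + (a - a * b) + (b - b * b)) = (1 - b - a) * (1 - b)" by (simp add: algebra_simps)
  have bZ: "b \<in> Zz" "a \<in> Zz" using B insert.prems(2) ag(1) by auto
  have mem: "b + (a - a * b) + (b - b * b) \<in> B"
    using B(1) ag(1) insert.prems(2) bZ by (intro frac_add frac_diff frac_mult) auto
  have "(1 - (b + (a - a * b) + (b - b * b))) * c \<in> lin S" if c: "c \<in> C" for c
  proof -
    obtain o' h where oh: "o' \<in> B" "h \<in> lin S" "(1 - b) * c = o' * s + h" using rep[OF c] by blast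
    have "(1 - (b + (a - a * b) + (b - b * b))) * c = (1 - b - a) * ((1 - b) * c)"
      unfolding b' by (simp only: mult.assoc)
    also have "\<dots> = o' * ((1 - b) * s - a * s) + (1 - b - a) * h"
      unfolding oh(3) by (simp add: algebra_simps)
    also have "\<dots> = o' * g + (1 - b - a) * h" unfolding ag(3) by simp
    also have "\<dots> \<in> lin S"
      using oh ag bZ B(2) by (intro lin_add lin_mult) auto
    finally show ?thesis .
  qed
  then show ?case using mem insert.prems(1) by (intro insert.IH) auto
qed

lemma ideal_finite_generators:
  assumes "frac_ideal C" "C \<subseteq> Zz"
  obtains S where "finite S" "S \<subseteq> C" "C \<subseteq> lin S"
proof -
  obtain c where c: "c \<in> C" "c \<noteq> 0" using assms(1) by (rule frac_nonzero)
  obtain y n where yn: "y \<in> Zz" "n > (0::int)" "c * y = of_int n"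
    using ex_int_multiple[of c] c assms(2) by blast
  have nC: "of_int n \<in> C" using frac_mult[OF assms(1) yn(1) c(1)] yn(3) by (simp add: mult.commute)
  obtain R where R: "finite R" "R \<subseteq> Zz" "\<And>x. x \<in> Zz \<Longrightarrow> \<exists>s\<in>R. \<exists>y\<in>Zz. x = s + of_int n * y"
    using yn(2) by (rule finite_residues) blast
  define S where "S = insert (of_int n) (R \<inter> C)"
  have fin: "finite S" using R by (simp add: S_def)
  have "x \<in> lin S" if "x \<in> C" for x
  proof -
    obtain s y where sy: "s \<in> R" "y \<in> Zz" "x = s + of_int n * y" using R(3) assms(2) \<open>x \<in> C\<close> by blast
    have "of_int n * y \<in> C" using frac_mult[OF assms(1) sy(2) nC] by (simp add: mult.commute)
    then have "x - of_int n * y \<in> C" using assms(1) \<open>x \<in> C\<close> by (intro frac_diff)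
    then have "s \<in> S" using sy by (simp add: S_def)
    then have "s \<in> lin S" "y * of_int n \<in> lin S"
      using fin sy by (auto intro!: lin_superset lin_mult simp: S_def)
    then show ?thesis using lin_add sy(3) by (simp add: mult.commute)
  qed
  moreover have "S \<subseteq> C" using nC by (auto simp: S_def)
  ultimately show thesis using fin that by blast
qed

text \<open>All \<open>y^k * c\<close> stay in \<open>C\<close>, so a denominator of
  \<open>C\<close> bounds the denominators of all powers of \<open>y\<close>; this is exactly
  membership in \<open>cint\<close>.\<close>

lemma stable_multiplier_integral:
  assumes C: "frac_ideal C" and y: "y \<in> Qz" "\<And>c. c \<in> C \<Longrightarrow> y * c \<in> C"
  shows "y \<in> Zz"
proof -
  obtain c where c: "c \<in> C" "c \<noteq> 0" using C by (rule frac_nonzero)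
  obtain d where d: "d \<in> Zz" "d \<noteq> 0" "\<And>x. x \<in> C \<Longrightarrow> d * x \<in> Zz" using C by (rule frac_denominator) blast
  have pow: "y ^ k * c \<in> C" for k
    by (induction k) (use c y(2) in \<open>auto simp: mult.assoc\<close>)
  have "d * c \<in> Zz" "d * c \<noteq> 0" using c d by auto
  then obtain z n where zn: "z \<in> Zz" "n > (0::int)" "d * c * z = of_int n" by (rule ex_int_multiple)
  have "y \<in> cint"
  proof (rule cintI[of n])
    fix k
    have "of_int n * y ^ k = z * (d * (y ^ k * c))" unfolding zn(3)[symmetric] by (simp only: mult_ac)
    also have "\<dots> \<in> Zz" using zn(1) d(3)[OF pow] by (rule Zz_mult)
    finally show "of_int n * y ^ k \<in> Zz" .
  qed (use zn in simp)
  then show ?thesis using y(1) by (rule cint_Zz)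
qed

text \<open>Elements of \<open>B\<close> map \<open>C\<close> into itself and are therefore
  integral, while Nakayama's lemma, applied to an integral multiple of \<open>C\<close>, puts 1 into
  \<open>B\<close>.\<close>

lemma cancel_ideal:
  assumes B: "frac_ideal B" and C: "frac_ideal C" and BC: "ip B C = C"
  shows "B = Zz"
proof -
  have BZ: "B \<subseteq> Zz"
  proof
    fix y assume "y \<in> B"
    then show "y \<in> Zz"
      using ip_mult[of y B _ C] BC frac_Qz[OF B] by (intro stable_multiplier_integral[OF C]) auto
  qed
  obtain d where d: "d \<in> Zz" "d \<noteq> 0" "\<And>x. x \<in> C \<Longrightarrow> d * x \<in> Zz" using C by (rule frac_denominator) blast
  define D where "D = (*) d ` C"
  have D: "frac_ideal D" "D \<subseteq> Zz" "ip B D = D"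
    using C d BC by (auto simp: D_def ip_scale_right intro: frac_scale Zz_Qz)
  obtain S where S: "finite S" "S \<subseteq> D" "D \<subseteq> lin S" using D(1,2) by (rule ideal_finite_generators)
  have "1 \<in> B"
    using B BZ D(1,3) S(1,2) frac_0[OF B] by (rule nakayama) (use S(3) in auto)
  then have "x \<in> B" if "x \<in> Zz" for x
    using frac_mult[OF B that, of 1] by simp
  with BZ show ?thesis by blast
qed

primrec ipow :: "complex set \<Rightarrow> nat \<Rightarrow> complex set" where
  "ipow I 0 = Zz"
| "ipow I (Suc n) = ip I (ipow I n)"

lemma frac_ipow: "frac_ideal I \<Longrightarrow> frac_ideal (ipow I n)"
  by (induction n) (auto intro: frac_Zz frac_ip)

lemma ipow_add: "frac_ideal I \<Longrightarrow> ipow I (m + n) = ip (ipow I m) (ipow I n)"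
  by (induction m) (simp_all add: ip_Zz frac_ipow ip_assoc)

text \<open>As there are finitely many representatives, two powers of \<open>I\<close> are
  proportional. Cancelling the lower one makes a multiple of a positive power of \<open>I\<close>
  equal to \<open>\<int>[\<zeta>]\<close>, and splitting off one factor \<open>I\<close> leaves the
  inverse.\<close>

lemma ex_inverse:
  assumes "frac_ideal I"
  obtains J where "frac_ideal J" "ip I J = Zz"
proof -
  define R where "R n = (SOME B. B \<in> reps \<and> (\<exists>a\<in>Qz. a \<noteq> 0 \<and> (*) a ` ipow I n = B))" for n
  have R: "R n \<in> reps \<and> (\<exists>a\<in>Qz. a \<noteq> 0 \<and> (*) a ` ipow I n = R n)" for n
    unfolding R_def by (rule someI_ex) (use ex_rep[OF frac_ipow[OF assms]] in metis)
  have "\<not> inj R"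
  proof
    assume "inj R"
    moreover have "range R \<subseteq> reps" using R by blast
    ultimately have "finite (UNIV :: nat set)"
      using finite_reps by (meson finite_imageD finite_subset)
    then show False by simp
  qed
  then obtain i j where ij: "i < j" "R i = R j" unfolding inj_def by (metis linorder_neqE_nat)
  obtain a where a: "a \<in> Qz" "a \<noteq> 0" "(*) a ` ipow I i = R i" using R[of i] by blast
  obtain b where b: "b \<in> Qz" "b \<noteq> 0" "(*) b ` ipow I j = R j" using R[of j] by blast
  obtain m where m: "j = Suc m + i" using ij(1) less_iff_Suc_add[of i j] by (auto simp: add.commute)
  define x where "x = b / a"
  have x: "x \<in> Qz" "x \<noteq> 0" unfolding x_def using a b by auto
  have "(*) a ` ((*) x ` ipow I j) = (*) a ` ipow I i"
    unfolding scale_scale x_def a(3) ij(2) b(3)[symmetric] using a(2) by simp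
  then have "(*) x ` ipow I j = ipow I i" using a(2) by (rule scale_inj[rotated])
  then have "ip ((*) x ` ipow I (Suc m)) (ipow I i) = ipow I i"
    unfolding m ipow_add[OF assms] ip_scale .
  then have "(*) x ` ipow I (Suc m) = Zz"
    using frac_ipow[OF assms] x by (intro cancel_ideal frac_scale)
  then have "ip I ((*) x ` ipow I m) = Zz" by (simp add: ip_scale_right)
  moreover have "frac_ideal ((*) x ` ipow I m)" using frac_ipow[OF assms] x by (intro frac_scale)
  ultimately show thesis using that by blast
qed

lemma ip_cancel:
  assumes "frac_ideal I" "frac_ideal J" "frac_ideal L" "ip I J = ip I L"
  shows "J = L"
proof -
  obtain I' where I': "frac_ideal I'" "ip I I' = Zz" using assms(1) by (rule ex_inverse)
  have "ip I' (ip I M) = M" if "frac_ideal M" for M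
    unfolding ip_assoc[symmetric] ip_comm[of I' I] I'(2) using that by (rule ip_Zz)
  then show ?thesis using assms by metis
qed

subsection \<open>The class group\<close>

abbreviation FG :: "complex set monoid" where "FG \<equiv> fractional_ideal_group Qz"

abbreviation PF :: "complex set set" where "PF \<equiv> principal_fractional_ideals Qz"

lemma FG_simps: "carrier FG = {I. frac_ideal I}" "monoid.mult FG = ip" "one FG = Zz"
  by (simp_all add: fractional_ideal_group_def fractional_ideal_iff integers_of_Qz)

lemma comm_group_FG: "comm_group FG"
proof (rule comm_groupI)
  fix I assume "I \<in> carrier FG"
  then have "frac_ideal I" by (simp add: FG_simps)
  then obtain J where "frac_ideal J" "ip I J = Zz" by (rule ex_inverse)
  then show "\<exists>J\<in>carrier FG. J \<otimes>\<^bsub>FG\<^esub> I = \<one>\<^bsub>FG\<^esub>"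
    by (auto simp: FG_simps ip_comm)
next
  fix I J assume "I \<in> carrier FG" "J \<in> carrier FG"
  show "I \<otimes>\<^bsub>FG\<^esub> J = J \<otimes>\<^bsub>FG\<^esub> I" unfolding FG_simps by (rule ip_comm)
qed (simp_all add: FG_simps frac_ip frac_Zz ip_Zz ip_assoc)

sublocale FG: comm_group FG
  by (rule comm_group_FG)

lemma PF_eq: "PF = {prin a | a. a \<in> Qz \<and> a \<noteq> 0}"
  by (auto simp: principal_fractional_ideals_def integers_of_Qz prin_def)

lemma subgroup_PF: "subgroup PF FG"
proof (rule FG.subgroupI)
  show "PF \<subseteq> carrier FG" by (auto simp: PF_eq FG_simps intro: frac_prin)
  show "PF \<noteq> {}" using Zz_Qz[of 1] by (auto simp: PF_eq)
  show "I \<otimes>\<^bsub>FG\<^esub> J \<in> PF" if IJ: "I \<in> PF" "J \<in> PF" for I J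
  proof -
    obtain a b where "a \<in> Qz" "a \<noteq> 0" "b \<in> Qz" "b \<noteq> 0" "I = prin a" "J = prin b"
      using IJ by (auto simp: PF_eq)
    then show ?thesis
      unfolding PF_eq FG_simps by (auto simp: ip_prin_prin intro!: exI[of _ "a * b"])
  qed
  show "inv\<^bsub>FG\<^esub> I \<in> PF" if I: "I \<in> PF" for I
  proof -
    obtain a where a: "a \<in> Qz" "a \<noteq> 0" "I = prin a" using I by (auto simp: PF_eq)
    have "inv\<^bsub>FG\<^esub> I = prin (inverse a)"
      using a by (intro FG.inv_equality) (auto simp: FG_simps ip_prin_prin prin_1 intro: frac_prin)
    then show ?thesis using a by (auto simp: PF_eq)
  qed
qed

lemma comm_group_class: "comm_group (class_group Qz)"
  unfolding class_group_def by (rule FG.abelian_FactGroup[OF subgroup_PF])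

definition cl :: "complex set \<Rightarrow> complex set set" where "cl I = PF #>\<^bsub>FG\<^esub> I"

lemma carrier_class: "carrier (class_group Qz) = cl ` {I. frac_ideal I}"
  by (auto simp: class_group_def FactGroup_def RCOSETS_def FG_simps cl_def)

lemma one_class: "\<one>\<^bsub>class_group Qz\<^esub> = PF"
  by (simp add: class_group_def FactGroup_def)

lemma cl_hom: "group_hom FG (class_group Qz) cl"
proof -
  have "normal PF FG" using subgroup_PF FG.normal_iff_subgroup by blast
  then have "(\<lambda>I. PF #>\<^bsub>FG\<^esub> I) \<in> hom FG (FG Mod PF)" by (rule normal.r_coset_hom_Mod)
  then show ?thesis
    using comm_group_class comm_group.axioms(2) FG.is_group
    unfolding group_hom_def group_hom_axioms_def class_group_def cl_def[abs_def] by blast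
qed

lemma cl_mult: "frac_ideal I \<Longrightarrow> frac_ideal J \<Longrightarrow> cl (ip I J) = cl I \<otimes>\<^bsub>class_group Qz\<^esub> cl J"
  using group_hom.hom_mult[OF cl_hom, of I J] by (simp add: FG_simps)

lemma cl_eq: "frac_ideal I \<Longrightarrow> cl I = {(*) a ` I | a. a \<in> Qz \<and> a \<noteq> 0}"
  by (auto simp: cl_def r_coset_def PF_eq FG_simps ip_prin)

lemma cl_scale:
  assumes "frac_ideal I" "a \<in> Qz" "a \<noteq> 0" shows "cl ((*) a ` I) = cl I"
  unfolding cl_eq[OF assms(1)] cl_eq[OF frac_scale[OF assms]]
proof (intro equalityI subsetI)
  fix J assume "J \<in> {(*) b ` (*) a ` I | b. b \<in> Qz \<and> b \<noteq> 0}"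
  then obtain b where "b \<in> Qz" "b \<noteq> 0" "J = (*) (b * a) ` I" by (auto simp: scale_scale)
  then show "J \<in> {(*) b ` I | b. b \<in> Qz \<and> b \<noteq> 0}" using assms by (auto intro!: exI[of _ "b * a"])
next
  fix J assume "J \<in> {(*) b ` I | b. b \<in> Qz \<and> b \<noteq> 0}"
  then obtain b where "b \<in> Qz" "b \<noteq> 0" "J = (*) b ` I" by blast
  then show "J \<in> {(*) b ` (*) a ` I | b. b \<in> Qz \<and> b \<noteq> 0}"
    using assms by (auto intro!: exI[of _ "b / a"] simp: scale_scale)
qed

lemma cl_one_iff: assumes "frac_ideal I" shows "cl I = PF \<longleftrightarrow> (\<exists>a. a \<in> Qz \<and> a \<noteq> 0 \<and> I = prin a)"
proof
  assume "cl I = PF"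
  moreover have "I \<in> cl I" using assms Zz_Qz[of 1] by (auto simp: cl_eq intro!: exI[of _ 1])
  ultimately show "\<exists>a. a \<in> Qz \<and> a \<noteq> 0 \<and> I = prin a" by (auto simp: PF_eq)
next
  assume "\<exists>a. a \<in> Qz \<and> a \<noteq> 0 \<and> I = prin a"
  then have "I \<in> PF" by (auto simp: PF_eq)
  then show "cl I = PF" unfolding cl_def using subgroup_PF assms
    by (intro FG.coset_join2) (auto simp: FG_simps)
qed

lemma finite_class_group: "finite (carrier (class_group Qz))"
proof -
  have "carrier (class_group Qz) \<subseteq> cl ` reps"
  proof
    fix C assume "C \<in> carrier (class_group Qz)"
    then obtain I where I: "frac_ideal I" "C = cl I" by (auto simp: carrier_class)
    obtain a where a: "a \<in> Qz" "a \<noteq> 0" "(*) a ` I \<in> reps" using I(1) by (rule ex_rep)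
    then show "C \<in> cl ` reps" using cl_scale[OF I(1) a(1,2)] I(2) by blast
  qed
  then show ?thesis using finite_reps by (meson finite_imageI finite_subset)
qed

subsection \<open>The cyclotomic field and complex conjugation\<close>

lemma rat_adjoin_zeta: "rat_adjoin \<zeta> = Qz"
proof -
  interpret C: field complex_ring by (rule field_from_type_algebra)
  have minus: "\<ominus>\<^bsub>complex_ring\<^esub> x = - x" for x
    using C.minus_equality[of "- x" x] by simp
  have inv: "inv\<^bsub>complex_ring\<^esub> x = inverse x" if "x \<noteq> 0" for x
    using C.comm_inv_char[of x "inverse x"] that by simp
  have "x \<in> Qz" if "x \<in> generate_field complex_ring {\<zeta>}" for x
    using that
  proof (induction rule: generate_field.induct)
    case (m_inv h)
    then show ?case by (simp add: inv)
  qed (auto simp: minus intro: Zz_Qz)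
  moreover have "x \<in> generate_field complex_ring {\<zeta>}" if "x \<in> Qz" for x
  proof -
    let ?G = "generate_field complex_ring {\<zeta>}"
    have one: "1 \<in> ?G" using generate_field.one[of complex_ring "{\<zeta>}"] by simp
    have zeta: "\<zeta> \<in> ?G" using generate_field.incl[of \<zeta> "{\<zeta>}" complex_ring] by simp
    have uminus: "- x \<in> ?G" if "x \<in> ?G" for x
      using generate_field.a_inv[OF that] by (simp add: minus)
    have plus: "x + y \<in> ?G" if "x \<in> ?G" "y \<in> ?G" for x y
      using generate_field.eng_add[OF that] by simp
    have times: "x * y \<in> ?G" if "x \<in> ?G" "y \<in> ?G" for x y
      using generate_field.eng_mult[OF that] by simp
    have inverse: "inverse x \<in> ?G" if "x \<in> ?G" "x \<noteq> 0" for x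
      using generate_field.m_inv[OF that(1)] that(2) by (simp add: inv)
    have zero: "0 \<in> ?G" using plus[OF one uminus[OF one]] by simp
    have nat: "of_nat n \<in> ?G" for n by (induction n) (auto intro: zero one plus)
    have int: "of_int n \<in> ?G" for n
      by (cases n) (use nat uminus[OF nat] in \<open>auto simp del: of_nat_Suc\<close>)
    have poly: "evp \<zeta> f \<in> ?G" for f
      by (induction f) (auto intro: zero int plus times zeta)
    obtain y n where "y \<in> Zz" "n \<noteq> (0::int)" "x = y / of_int n" using \<open>x \<in> Qz\<close> by (rule QzE)
    then show ?thesis
      using poly int inverse times unfolding divide_inverse by (auto elim!: ZzE)
  qed
  ultimately show ?thesis unfolding rat_adjoin_def by blast
qed

lemma Qz_cnj [simp, intro]: assumes "x \<in> Qz" shows "cnj x \<in> Qz"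
proof -
  obtain a n where "a \<in> Zz" "n \<noteq> (0::int)" "x = a / of_int n" using assms by (rule QzE)
  then show ?thesis by (intro QzI[of "cnj a" n]) auto
qed

abbreviation Kp :: "complex set" where "Kp \<equiv> max_real_subfield Qz"

lemma Kp_iff: "x \<in> Kp \<longleftrightarrow> x \<in> Qz \<and> cnj x = x"
  by (auto simp: max_real_subfield_def Reals_cnj_iff)

definition Zr :: "complex set" where "Zr = {x \<in> Zz. cnj x = x}"

lemma integers_of_Kp: "integers_of Kp = Zr"
  using integers_of_Qz unfolding integers_of_def Zr_def by (auto simp: Kp_iff)

lemma cnj_zeta_ne: "cnj \<zeta> \<noteq> \<zeta>"
proof
  assume "cnj \<zeta> = \<zeta>"
  then have "\<zeta> ^ 2 = 1" using cnj_zeta_mult(2) by (simp add: power2_eq_square)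
  then show False using p_gt_2 by (auto simp: zeta_eq_1_iff dest: dvd_imp_le)
qed

text \<open>Subtracting from \<open>x = a + b * \<zeta>\<close> its conjugate determines
  \<open>b\<close>; the quotient so found is fixed by conjugation, and then so is
  \<open>a\<close>.\<close>

lemma Kp_basis:
  assumes "x \<in> Qz"
  obtains a b where "a \<in> Kp" "b \<in> Kp" "x = a + b * \<zeta>"
proof -
  define b where "b = (x - cnj x) / (\<zeta> - cnj \<zeta>)"
  have nz: "\<zeta> - cnj \<zeta> \<noteq> 0" using cnj_zeta_ne by simp
  have bQ: "b \<in> Qz" 
    unfolding b_def using assms Zz_Qz[OF Zz_zeta] by (intro Qz_divide Qz_diff Qz_cnj)
  have "cnj b = (cnj x - x) / (cnj \<zeta> - \<zeta>)" by (simp add: b_def)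
  also have "\<dots> = b" unfolding b_def by (metis minus_diff_eq minus_divide_divide)
  finally have b: "cnj b = b" .
  have "x - cnj x = b * (\<zeta> - cnj \<zeta>)" using nz by (simp add: b_def)
  then have "cnj (x - b * \<zeta>) = x - b * \<zeta>" using b by (simp add: algebra_simps)
  then show thesis
    using bQ b assms Zz_Qz[OF Zz_zeta] by (intro that[of "x - b * \<zeta>" b]) (auto simp: Kp_iff)
qed

lemma galois_group_eq: "galois_group Qz Kp = {restrict id Qz, restrict cnj Qz}"
proof (intro equalityI subsetI)
  fix \<sigma> assume \<sigma>: "\<sigma> \<in> galois_group Qz Kp"
  then have hom: "\<sigma> \<in> ring_hom (complex_ring\<lparr>carrier := Qz\<rparr>) (complex_ring\<lparr>carrier := Qz\<rparr>)"
    and ext: "\<sigma> \<in> extensional Qz" and fix_Kp: "\<And>x. x \<in> Kp \<Longrightarrow> \<sigma> x = x"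
    by (auto simp: galois_group_def ring_iso_def)
  have add: "\<sigma> (x + y) = \<sigma> x + \<sigma> y" and mult: "\<sigma> (x * y) = \<sigma> x * \<sigma> y" if "x \<in> Qz" "y \<in> Qz" for x y
    using ring_hom_add[OF hom, of x y] ring_hom_mult[OF hom, of x y] that by simp_all
  have zQ: "\<zeta> \<in> Qz" "cnj \<zeta> \<in> Qz" by (auto intro: Zz_Qz)
  have "\<zeta> + cnj \<zeta> \<in> Kp" "1 \<in> Kp" using zQ by (auto simp: Kp_iff add.commute intro: Zz_Qz)
  then have sum: "\<sigma> \<zeta> + \<sigma> (cnj \<zeta>) = \<zeta> + cnj \<zeta>" and prod: "\<sigma> \<zeta> * \<sigma> (cnj \<zeta>) = 1"
    using fix_Kp add[OF zQ] mult[OF zQ] by auto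
  \<comment> \<open>\<open>\<zeta>\<close> is a root of a quadratic polynomial over
    \<open>Kp\<close> whose other root is \<open>cnj \<zeta>\<close>, so an automorphism fixing
    \<open>Kp\<close> has only these two choices for its image.\<close>
  have "(\<sigma> \<zeta> - \<zeta>) * (\<sigma> \<zeta> - cnj \<zeta>) = \<sigma> \<zeta> * \<sigma> \<zeta> - (\<zeta> + cnj \<zeta>) * \<sigma> \<zeta> + \<zeta> * cnj \<zeta>"
    by (simp only: algebra_simps)
  also have "\<dots> = 0" unfolding sum[symmetric] using prod by (simp add: algebra_simps)
  finally have "\<sigma> \<zeta> = \<zeta> \<or> \<sigma> \<zeta> = cnj \<zeta>" by simp
  moreover have rep: "\<sigma> (a + b * \<zeta>) = a + b * \<sigma> \<zeta>" if "a \<in> Kp" "b \<in> Kp" for a b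
  proof -
    have "a \<in> Qz" "b \<in> Qz" using that by (auto simp: Kp_iff)
    then show ?thesis using that zQ by (simp add: add mult fix_Kp)
  qed
  ultimately show "\<sigma> \<in> {restrict id Qz, restrict cnj Qz}"
  proof (elim disjE)
    assume z: "\<sigma> \<zeta> = \<zeta>"
    have "\<sigma> x = restrict id Qz x" for x
    proof (cases "x \<in> Qz")
      case True
      then show ?thesis using rep z by (auto elim!: Kp_basis)
    qed (use ext in \<open>simp add: extensional_def\<close>)
    then show ?thesis by blast
  next
    assume z: "\<sigma> \<zeta> = cnj \<zeta>"
    have "\<sigma> x = restrict cnj Qz x" for x
    proof (cases "x \<in> Qz")
      case True
      obtain a b where ab: "a \<in> Kp" "b \<in> Kp" "x = a + b * \<zeta>" using True by (rule Kp_basis)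
      then have "cnj x = a + b * cnj \<zeta>" by (simp add: Kp_iff)
      then show ?thesis using rep z ab True by simp
    qed (use ext in \<open>simp add: extensional_def\<close>)
    then show ?thesis by blast
  qed
next
  have inv: "bij_betw (restrict cnj Qz) Qz Qz"
    by (rule bij_betwI[of _ _ _ "restrict cnj Qz"]) auto
  have id: "bij_betw (restrict id Qz) Qz Qz"
    by (rule bij_betwI[of _ _ _ "restrict id Qz"]) auto
  fix \<sigma> assume "\<sigma> \<in> {restrict id Qz, restrict cnj Qz}"
  then show "\<sigma> \<in> galois_group Qz Kp"
    using inv id Zz_Qz[OF Zz_1]
    by (auto simp: galois_group_def ring_iso_def Kp_iff intro!: ring_hom_memI)
qed

lemma field_norm_eq: assumes "x \<in> Qz" shows "field_norm Qz Kp x = x * cnj x"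
proof -
  have "restrict id Qz \<zeta> \<noteq> restrict cnj Qz \<zeta>"
    using cnj_zeta_ne Zz_Qz[OF Zz_zeta] by simp
  then have "restrict id Qz \<noteq> restrict cnj Qz" by metis
  then show ?thesis using assms by (simp add: field_norm_def galois_group_eq)
qed

subsection \<open>The relative norm of ideals\<close>

text \<open>This is \<open>1 / (1 + \<zeta>)\<close>. It has trace 1 over \<open>K\<^sup>+\<close>; such an integer exists because the
  extension is tame.\<close>
definition half :: complex where "half = (\<Sum>i<(p + 1) div 2. (\<zeta>\<^sup>2) ^ i)"

lemma half_Zz: "half \<in> Zz"
  unfolding half_def by (intro Zz_sum) auto

lemma half_mult: "(\<zeta> + 1) * half = 1"
proof -
  have "(\<zeta>\<^sup>2 - 1) * half = (\<zeta>\<^sup>2) ^ ((p + 1) div 2) - 1"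
    unfolding half_def by (simp add: power_diff_1_eq)
  also have "(\<zeta>\<^sup>2) ^ ((p + 1) div 2) = \<zeta> ^ (p + 1)"
    using odd_p by (simp only: power_mult[symmetric]) simp
  also have "\<dots> = \<zeta>" by simp
  finally have "(\<zeta> - 1) * ((\<zeta> + 1) * half) = (\<zeta> - 1) * 1"
    by (simp add: algebra_simps power2_eq_square)
  then show ?thesis by (subst (asm) mult_left_cancel) auto
qed

lemma half_trace: "half + cnj half = 1"
proof -
  have "cnj ((\<zeta> + 1) * half) = 1" unfolding half_mult by simp
  then have "(cnj \<zeta> + 1) * cnj half = 1" by simp
  then have "\<zeta> * ((cnj \<zeta> + 1) * cnj half) = \<zeta>" by simp
  then have "(\<zeta> + 1) * cnj half = \<zeta>"
    by (simp only: distrib_left distrib_right mult.assoc[symmetric] cnj_zeta_mult) (simp add: add.commute)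
  with half_mult have "(\<zeta> + 1) * (half + cnj half) = (\<zeta> + 1) * 1"
    by (simp add: distrib_left)
  moreover have "\<zeta> + 1 \<noteq> 0" using half_mult by auto
  ultimately show ?thesis by (subst (asm) mult_left_cancel)
qed

lemma Zz_decomp: assumes "x \<in> Zz" obtains n y where "y \<in> Zz" "x = of_int n + (\<zeta> - 1) * y"
proof -
  obtain f where f: "x = evp \<zeta> f" using assms by (rule ZzE)
  obtain q where q: "f = [:poly f 1:] + [:-1, 1:] * q" by (rule poly_div_X_minus_1)
  have "x = of_int (poly f 1) + (\<zeta> - 1) * evp \<zeta> q"
    unfolding f by (subst q) (simp add: ring_distribs)
  then show thesis using that evp_in_Zz by blast
qed

lemma pi_dvd_int: assumes "y \<in> Zz" "of_int n = (\<zeta> - 1) * y" shows "int p dvd n"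
proof -
  obtain f where f: "y = evp \<zeta> f" using assms(1) by (rule ZzE)
  have "evp \<zeta> ([:n:] - [:-1, 1:] * f) = 0"
    using assms(2) unfolding f by (simp only: evp_diff evp_mult) simp
  then have "int p dvd poly ([:n:] - [:-1, 1:] * f) 1" by (rule evp_zero_imp_dvd)
  then show ?thesis by simp
qed

lemma p_in_pi: obtains y where "y \<in> Zz" "of_nat p = (\<zeta> - 1) * y"
proof -
  obtain w where w: "of_nat p = (\<zeta> - 1) ^ (p - 1) * evp \<zeta> w" by (rule p_eq_pi_power)
  moreover obtain m where "p - 1 = Suc m" using p_gt_2 by (cases "p - 1") auto
  ultimately have "of_nat p = (\<zeta> - 1) * ((\<zeta> - 1) ^ m * evp \<zeta> w)" by (simp add: mult.assoc)
  then show thesis by (rule that[rotated]) auto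
qed

text \<open>\<open>I / \<pi> I\<close> is one-dimensional over the prime field, for \<open>\<pi> = \<zeta> - 1\<close>.\<close>
lemma generator_mod_pi:
  assumes I: "frac_ideal I"
  obtains x where "x \<in> I" "\<And>y. y \<in> I \<Longrightarrow> \<exists>n. \<exists>z\<in>I. y = of_int n * x + (\<zeta> - 1) * z"
proof -
  obtain J where J: "frac_ideal J" "ip I J = Zz" using I by (rule ex_inverse)
  have JI: "ip J I = Zz" using J(2) ip_comm by metis
  have "\<not> I \<subseteq> (*) (\<zeta> - 1) ` I"
  proof
    assume "I \<subseteq> (*) (\<zeta> - 1) ` I"
    then have "ip I J \<subseteq> ip ((*) (\<zeta> - 1) ` I) J" by (rule ip_mono) simp
    then have "1 \<in> (*) (\<zeta> - 1) ` Zz" unfolding ip_scale J(2) by auto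
    then obtain y where "y \<in> Zz" "of_int 1 = (\<zeta> - 1) * y" by auto
    then have "int p dvd 1" by (rule pi_dvd_int)
    then show False using p_gt_2 by simp
  qed
  then obtain x where x: "x \<in> I" "x \<notin> (*) (\<zeta> - 1) ` I" by blast
  \<comment> \<open>If \<open>x J\<close> were contained in the ideal of \<open>\<zeta> - 1\<close>,
    multiplication by \<open>I\<close> would put \<open>x\<close> into
    \<open>(\<zeta> - 1) I\<close>.\<close>
  have "\<exists>q\<in>J. x * q \<notin> (*) (\<zeta> - 1) ` Zz"
  proof (rule ccontr)
    assume "\<not> ?thesis"
    then have "ip ((*) x ` J) I \<subseteq> ip ((*) (\<zeta> - 1) ` Zz) I" by (intro ip_mono) auto
    then have "(*) x ` Zz \<subseteq> (*) (\<zeta> - 1) ` I" unfolding ip_scale JI ip_Zz[OF I] .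
    then have "x * 1 \<in> (*) (\<zeta> - 1) ` I" using Zz_1 by blast
    then show False using x(2) by simp
  qed
  then obtain q where q: "q \<in> J" "x * q \<notin> (*) (\<zeta> - 1) ` Zz" by blast
  have "x * q \<in> Zz" using ip_mult[OF x(1) q(1)] J(2) by simp
  then obtain n s where ns: "s \<in> Zz" "x * q = of_int n + (\<zeta> - 1) * s" by (rule Zz_decomp)
  obtain pp where pp: "pp \<in> Zz" "of_nat p = (\<zeta> - 1) * pp" by (rule p_in_pi)
  have "\<not> int p dvd n"
  proof
    assume "int p dvd n"
    then obtain k where "n = int p * k" by (elim dvdE)
    then have "x * q = (\<zeta> - 1) * (pp * of_int k + s)" using ns(2) pp(2) by (simp add: distrib_left)
    moreover have "pp * of_int k + s \<in> Zz" using pp ns by auto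
    ultimately show False using q(2) by blast
  qed
  then have "coprime n (int p)"
    using prime_p prime_imp_coprime[of "int p" n] by (simp add: coprime_commute)
  \<comment> \<open>Bezout makes \<open>x * (k q)\<close> congruent to 1 modulo
    \<open>\<zeta> - 1\<close>. Multiplied by \<open>y\<close>, this writes \<open>y\<close> as
    \<open>x\<close> times the integral element \<open>k q y\<close>, up to
    \<open>(\<zeta> - 1) I\<close>.\<close>
  then obtain k l where kl: "n * k + int p * l = 1"
    using bezout_int[of n "int p"] by (metis coprime_imp_gcd_eq_1 mult.commute)
  define s' where "s' = s * of_int k - pp * of_int l"
  have s': "s' \<in> Zz" unfolding s'_def using ns pp by auto
  have "x * (q * of_int k) = (x * q) * of_int k" by (simp only: mult.assoc)
  also have "\<dots> = of_int (n * k) + (\<zeta> - 1) * (s * of_int k)"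
    unfolding ns(2) by (simp add: distrib_right mult.assoc)
  also have "n * k = 1 - int p * l" using kl by simp
  also have "of_int (1 - int p * l) + (\<zeta> - 1) * (s * of_int k) = 1 + (\<zeta> - 1) * s'"
    using pp(2) unfolding s'_def by (simp add: right_diff_distrib)
  finally have one: "x * (q * of_int k) = 1 + (\<zeta> - 1) * s'" .
  show thesis
  proof (rule that[OF x(1)])
    fix y assume y: "y \<in> I"
    have "of_int k * q \<in> J" using J(1) q(1) by (intro frac_mult) auto
    then have "(of_int k * q) * y \<in> Zz" using ip_mult[of "of_int k * q" J y I] y JI by simp
    then obtain m t where mt: "t \<in> Zz" "(of_int k * q) * y = of_int m + (\<zeta> - 1) * t" by (rule Zz_decomp)
    have "y = x * ((of_int k * q) * y) - (\<zeta> - 1) * (s' * y)"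
      using arg_cong[OF one, of "\<lambda>u. u * y"] by (simp add: algebra_simps)
    also have "\<dots> = of_int m * x + (\<zeta> - 1) * (t * x - s' * y)"
      unfolding mt(2) by (simp add: algebra_simps)
    finally have "y = of_int m * x + (\<zeta> - 1) * (t * x - s' * y)" .
    moreover have "t * x - s' * y \<in> I"
      using I mt(1) s' x(1) y by (intro frac_diff frac_mult)
    ultimately show "\<exists>n. \<exists>z\<in>I. y = of_int n * x + (\<zeta> - 1) * z" by blast
  qed
qed

definition NI :: "complex set \<Rightarrow> complex set"
  where "NI I = ip Zr ((\<lambda>x. x * cnj x) ` I)"

lemma ideal_norm_eq: assumes "frac_ideal I" shows "ideal_norm Qz Kp I = NI I"
proof -
  have "field_norm Qz Kp ` I = (\<lambda>x. x * cnj x) ` I"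
    using frac_Qz[OF assms] by (intro image_cong) (auto simp: field_norm_eq)
  then show ?thesis by (simp add: ideal_norm_def NI_def integers_of_Kp)
qed

lemma Zr_int: "of_int n \<in> Zr"
  by (simp add: Zr_def)

lemma Zr_mult: "x \<in> Zr \<Longrightarrow> y \<in> Zr \<Longrightarrow> x * y \<in> Zr"
  and Zr_add: "x \<in> Zr \<Longrightarrow> y \<in> Zr \<Longrightarrow> x + y \<in> Zr"
  by (auto simp: Zr_def)

lemma NI_add: "x \<in> NI I \<Longrightarrow> y \<in> NI I \<Longrightarrow> x + y \<in> NI I"
  unfolding NI_def by (rule ip_add)

lemma NI_mult: assumes "a \<in> Zr" "x \<in> NI I" shows "a * x \<in> NI I"
  using assms(2) unfolding NI_def
proof (induction rule: ip_induct)
  case (mult i j)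
  have "(a * i) * j \<in> ip Zr ((\<lambda>x. x * cnj x) ` I)"
    using assms(1) mult by (intro ip_mult Zr_mult)
  then show ?case by (simp add: mult.assoc)
qed (auto simp: distrib_left intro: ip_add)

lemma NI_norm: "x \<in> I \<Longrightarrow> x * cnj x \<in> NI I"
  using ip_mult[OF Zr_int[of 1], of "x * cnj x" "(\<lambda>x. x * cnj x) ` I"] by (simp add: NI_def)

lemma NI_diff: "x \<in> NI I \<Longrightarrow> y \<in> NI I \<Longrightarrow> x - y \<in> NI I"
  using NI_add[of x I "of_int (-1) * y"] NI_mult[OF Zr_int[of "-1"], of y I] by simp

lemma frac_cnj: assumes "frac_ideal I" shows "frac_ideal (cnj ` I)"
proof -
  obtain d where d: "d \<in> Zz" "d \<noteq> 0" "\<And>x. x \<in> I \<Longrightarrow> d * x \<in> Zz"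
    using assms by (rule frac_denominator) blast
  show ?thesis
    unfolding frac_ideal_def
  proof (intro conjI ballI)
    show "cnj ` I \<subseteq> Qz" using frac_Qz[OF assms] by auto
    show "0 \<in> cnj ` I" using frac_0[OF assms] by force
    show "x + y \<in> cnj ` I" if "x \<in> cnj ` I" "y \<in> cnj ` I" for x y
      using that frac_add[OF assms] by (auto simp flip: complex_cnj_add)
    show "a * x \<in> cnj ` I" if "a \<in> Zz" "x \<in> cnj ` I" for a x
    proof -
      obtain y where y: "y \<in> I" "x = cnj y" using \<open>x \<in> _\<close> by auto
      then have "a * x = cnj (cnj a * y)" by simp
      then show ?thesis using frac_mult[OF assms Zz_cnj[OF that(1)] y(1)] by blast
    qed
    obtain x where "x \<in> I" "x \<noteq> 0" using assms by (rule frac_nonzero)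
    then show "\<exists>x\<in>cnj ` I. x \<noteq> 0" by (intro bexI[of _ "cnj x"]) auto
    have "cnj d * cnj x \<in> Zz" if "x \<in> I" for x
      using Zz_cnj[OF d(3)[OF that]] by simp
    then show "\<exists>d\<in>Zz. d \<noteq> 0 \<and> (\<forall>x\<in>cnj ` I. d * x \<in> Zz)"
      using d by (intro bexI[of _ "cnj d"]) auto
  qed
qed

text \<open>Polarization: the trace of \<open>i * cnj y\<close> is the norm of \<open>i + y\<close>
  less the norms of \<open>i\<close> and \<open>y\<close>.\<close>

lemma trace_NI:
  assumes "frac_ideal I" "w \<in> ip I (cnj ` I)"
  shows "w + cnj w \<in> NI I"
  using assms(2)
proof (induction rule: ip_induct)
  case (mult i j)
  then obtain y where y: "y \<in> I" "j = cnj y" by auto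
  have "i * j + cnj (i * j) = (i + y) * cnj (i + y) - i * cnj i - y * cnj y"
    unfolding y by (simp add: algebra_simps)
  also have "\<dots> \<in> NI I"
    using mult y assms(1) by (intro NI_diff NI_norm frac_add)
  finally show ?case .
next
  case (add x y)
  show ?case using NI_add[OF add(3,4)] by (simp add: add_ac)
qed

lemma NI_subset: assumes "frac_ideal I" shows "NI I \<subseteq> {z \<in> ip I (cnj ` I). cnj z = z}"
  unfolding NI_def
proof (rule ip_subset)
  fix i j assume i: "i \<in> Zr" and "j \<in> (\<lambda>x. x * cnj x) ` I"
  then obtain x where x: "x \<in> I" "j = x * cnj x" by auto
  have "(i * x) * cnj x \<in> ip I (cnj ` I)"
    using x i assms by (intro ip_mult frac_mult) (auto simp: Zr_def)
  then show "i * j \<in> {z \<in> ip I (cnj ` I). cnj z = z}"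
    using x i by (simp add: Zr_def mult_ac)
qed (auto intro: ip_add)

text \<open>A real \<open>z\<close> is the trace of \<open>half * z\<close>, because
  \<open>half\<close> has trace 1, and traces lie in \<open>NI I\<close> by polarization.\<close>

lemma NI_eq: assumes "frac_ideal I" shows "NI I = {z \<in> ip I (cnj ` I). cnj z = z}"
proof
  show "{z \<in> ip I (cnj ` I). cnj z = z} \<subseteq> NI I"
  proof
    fix z assume z: "z \<in> {z \<in> ip I (cnj ` I). cnj z = z}"
    have "frac_ideal (ip I (cnj ` I))" using assms by (intro frac_ip frac_cnj)
    then have "half * z \<in> ip I (cnj ` I)" using half_Zz z by (intro frac_mult) auto
    then have "half * z + cnj (half * z) \<in> NI I" by (rule trace_NI[OF assms])
    moreover have "half * z + cnj (half * z) = (half + cnj half) * z"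
      using z by (simp add: distrib_right)
    ultimately show "z \<in> NI I" by (simp add: half_trace)
  qed
qed (rule NI_subset[OF assms])

text \<open>Polarization here reaches \<open>\<zeta> - 1\<close> times each product
  \<open>c * cnj d\<close>. What remains is a question modulo \<open>\<zeta> - 1\<close>, where
  every element of \<open>I\<close> is an integer multiple of one generator \<open>x\<close>, so
  that every product reduces to a multiple of the norm \<open>x * cnj x\<close>.\<close>

lemma extension_NI: assumes I: "frac_ideal I" shows "ip Zz (NI I) = ip I (cnj ` I)"
proof
  have fr: "frac_ideal (ip I (cnj ` I))" using I by (intro frac_ip frac_cnj)
  show "ip Zz (NI I) \<subseteq> ip I (cnj ` I)"
    by (intro ip_subset) (use NI_subset[OF I] fr in \<open>auto intro: frac_mult frac_add\<close>)
  let ?W = "ip Zz (NI I)"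
  have Wmult: "a * x \<in> ?W" if "a \<in> Zz" "x \<in> ?W" for a x
    using that(2)
  proof (induction rule: ip_induct)
    case (mult i j)
    have "(a * i) * j \<in> ?W" using that(1) mult by (intro ip_mult Zz_mult)
    then show ?case by (simp add: mult.assoc)
  qed (auto simp: distrib_left intro: ip_add)
  have NW: "x \<in> ?W" if "x \<in> NI I" for x using ip_mult[OF Zz_1 that] by simp
  have pi: "(\<zeta> - 1) * (c * cnj d) \<in> ?W" if cd: "c \<in> I" "d \<in> I" for c d
  proof -
    define T where "T c = c * cnj d + cnj (c * cnj d)" for c
    have T: "T c \<in> NI I" if "c \<in> I" for c
      unfolding T_def using that cd(2) by (intro trace_NI[OF I] ip_mult) auto
    have zc: "\<zeta> * c \<in> I" using I cd by (intro frac_mult) auto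
    have "(\<zeta> - 1) = (\<zeta> - 1) * ((\<zeta> + 1) * half)" unfolding half_mult by simp
    also have "\<dots> = (\<zeta> * half) * (\<zeta> - cnj \<zeta>)"
    proof -
      have "(\<zeta> * half) * (\<zeta> - cnj \<zeta>) = (\<zeta> * \<zeta>) * half - (\<zeta> * cnj \<zeta>) * half" by (simp only: algebra_simps)
      then show ?thesis by (simp add: algebra_simps)
    qed
    finally have e: "(\<zeta> - 1) = (\<zeta> * half) * (\<zeta> - cnj \<zeta>)" .
    \<comment> \<open>Eliminating \<open>cnj c * d\<close> from the traces belonging to
      \<open>c\<close> and \<open>\<zeta> * c\<close> isolates \<open>c * cnj d\<close>, up to the
      factor \<open>\<zeta> - cnj \<zeta>\<close>, an associate of
      \<open>\<zeta> - 1\<close>.\<close>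
    have "(\<zeta> - cnj \<zeta>) * (c * cnj d) = T (\<zeta> * c) - cnj \<zeta> * T c"
      unfolding T_def by (simp add: algebra_simps)
    moreover have "(\<zeta> - 1) * (c * cnj d) = (\<zeta> * half) * ((\<zeta> - cnj \<zeta>) * (c * cnj d))"
      by (subst e) (simp only: mult.assoc)
    ultimately have "(\<zeta> - 1) * (c * cnj d) = (\<zeta> * half) * (T (\<zeta> * c) - cnj \<zeta> * T c)" by simp
    also have "\<dots> = (\<zeta> * half) * T (\<zeta> * c) + (- (\<zeta> * half * cnj \<zeta>)) * T c"
      by (simp only: algebra_simps) simp
    also have "\<dots> \<in> ?W"
      using T[OF zc] T[OF cd(1)] half_Zz by (intro ip_add Wmult NW) auto
    finally show ?thesis .
  qed
  obtain x where x: "x \<in> I" "\<And>y. y \<in> I \<Longrightarrow> \<exists>n. \<exists>z\<in>I. y = of_int n * x + (\<zeta> - 1) * z"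
    using I by (rule generator_mod_pi) blast
  show "ip I (cnj ` I) \<subseteq> ?W"
  proof (rule ip_subset)
    fix a j assume a: "a \<in> I" and "j \<in> cnj ` I"
    then obtain b where b: "b \<in> I" "j = cnj b" by auto
    obtain n a' where a': "a' \<in> I" "a = of_int n * x + (\<zeta> - 1) * a'" using x(2)[OF a] by blast
    obtain m b' where b': "b' \<in> I" "b = of_int m * x + (\<zeta> - 1) * b'" using x(2)[OF b(1)] by blast
    have cz: "cnj \<zeta> - 1 = (- cnj \<zeta>) * (\<zeta> - 1)" by (simp add: algebra_simps)
    have cb: "cnj b = of_int m * cnj x + (- cnj \<zeta>) * (\<zeta> - 1) * cnj b'"
      unfolding b'(2) cz[symmetric] by simp
    have "a * cnj b = of_int (n * m) * (x * cnj x) + (- (of_int n * cnj \<zeta>)) * ((\<zeta> - 1) * (x * cnj b'))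
        + (\<zeta> - 1) * (a' * cnj b)"
    proof -
      have "a * cnj b = of_int n * x * cnj b + (\<zeta> - 1) * (a' * cnj b)"
        unfolding a'(2) by (simp only: distrib_right mult.assoc)
      also have "of_int n * x * cnj b = of_int (n * m) * (x * cnj x) + (- (of_int n * cnj \<zeta>)) * ((\<zeta> - 1) * (x * cnj b'))"
        unfolding cb by (simp only: distrib_left of_int_mult mult_minus_left mult_minus_right mult_ac)
      finally show ?thesis .
    qed
    also have "\<dots> \<in> ?W"
      using x(1) a' b b' by (intro ip_add Wmult NW[OF NI_norm] pi Zz_minus Zz_mult Zz_of_int Zz_cnj Zz_zeta)
    finally show "a * j \<in> ?W" by (simp add: b)
  qed (rule ip_add)
qed

end

subsection \<open>Logarithmic derivatives modulo \<open>p\<close>\<close>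

text \<open>\<open>X d/dX\<close> has the monomials as eigenvectors: degrees do not shift, and a
  factor \<open>X^t\<close> adds just the constant \<open>t\<close> to a logarithmic
  derivative.\<close>

definition euler_deriv :: "int poly \<Rightarrow> int poly"
  where "euler_deriv f = [:0, 1:] * pderiv f"

lemma euler_deriv_mult: "euler_deriv (f * g) = euler_deriv f * g + f * euler_deriv g"
  unfolding euler_deriv_def pderiv_mult by (simp only: algebra_simps)

lemma euler_deriv_diff: "euler_deriv (f - g) = euler_deriv f - euler_deriv g"
  unfolding euler_deriv_def pderiv_diff by (simp only: algebra_simps)

lemma euler_deriv_monom: "euler_deriv (monom c n) = of_nat n * monom c n"
proof (cases n)
  case 0
  then show ?thesis by (simp add: euler_deriv_def monom_0)
next
  case (Suc m)
  have "euler_deriv (monom c n) = monom 1 1 * monom (of_nat n * c) (n - 1)"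
    unfolding euler_deriv_def pderiv_monom by (simp add: monom_altdef)
  also have "\<dots> = monom (of_nat n * c) n" using Suc by (simp add: mult_monom)
  also have "\<dots> = of_nat n * monom c n" by (simp add: of_nat_poly smult_monom)
  finally show ?thesis .
qed

lemma euler_deriv_power: "euler_deriv (f ^ n) * f = of_nat n * f ^ n * euler_deriv f"
proof (induction n)
  case (Suc n)
  have "euler_deriv (f ^ Suc n) * f = f * (euler_deriv (f ^ n) * f) + f ^ n * euler_deriv f * f"
    by (simp add: euler_deriv_mult algebra_simps)
  then show ?case unfolding Suc by (simp add: algebra_simps)
qed (simp add: euler_deriv_def)

lemma euler_deriv_const_add: "euler_deriv ([:c:] + f) = euler_deriv f"
  by (simp add: euler_deriv_def pderiv_add pderiv_pCons)

text \<open>The logarithmic derivative of a quotient of products of powers, cleared of denominators: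
  \<open>x + y X\<^sup>k\<close> and \<open>y + x X\<^sup>k\<close> contribute \<open>k (y\<^sup>2 - x\<^sup>2) X\<^sup>k / ((x + y X\<^sup>k) (y + x X\<^sup>k))\<close>.\<close>
lemma log_deriv_quotient:
  fixes x y :: int and e :: "nat \<Rightarrow> nat"
  defines "f k \<equiv> [:x:] + monom y k" and "g k \<equiv> [:y:] + monom x k"
  assumes "finite A"
  shows "(euler_deriv (\<Prod>k\<in>A. f k ^ e k) * (\<Prod>k\<in>A. g k ^ e k)
      - (\<Prod>k\<in>A. f k ^ e k) * euler_deriv (\<Prod>k\<in>A. g k ^ e k)) * (\<Prod>k\<in>A. f k * g k)
    = (\<Prod>k\<in>A. f k ^ e k) * (\<Prod>k\<in>A. g k ^ e k) *
      (\<Sum>k\<in>A. monom (int (e k * k) * (y\<^sup>2 - x\<^sup>2)) k * (\<Prod>j\<in>A - {k}. f j * g j))"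
  using assms(3)
proof (induction A rule: finite_induct)
  case empty
  show ?case by (simp add: euler_deriv_def)
next
  case (insert k A)
  define P Q M S where "P = (\<Prod>k\<in>A. f k ^ e k)" and "Q = (\<Prod>k\<in>A. g k ^ e k)"
    and "M = (\<Prod>k\<in>A. f k * g k)"
    and "S = (\<Sum>k\<in>A. monom (int (e k * k) * (y\<^sup>2 - x\<^sup>2)) k * (\<Prod>j\<in>A - {k}. f j * g j))"
  define D where "D = (euler_deriv P * Q - P * euler_deriv Q) * M"
  have IH: "D = P * Q * S" using insert.IH unfolding D_def P_def Q_def M_def S_def .
  define c where "c = of_nat (e k) * (euler_deriv (f k) * g k - f k * euler_deriv (g k))"
  have "euler_deriv (f k) * g k - f k * euler_deriv (g k) =
      of_nat k * (monom y k * ([:y:] + monom x k) - ([:x:] + monom y k) * monom x k)"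
    unfolding f_def g_def euler_deriv_const_add euler_deriv_monom by (simp only: algebra_simps)
  also have "monom y k * ([:y:] + monom x k) - ([:x:] + monom y k) * monom x k = monom (y\<^sup>2 - x\<^sup>2) k"
    by (simp add: distrib_left distrib_right mult_monom smult_monom power2_eq_square diff_monom algebra_simps)
  finally have c: "c = monom (int (e k * k) * (y\<^sup>2 - x\<^sup>2)) k"
    unfolding c_def by (simp add: of_nat_poly smult_monom mult_ac)
  have S': "(\<Sum>i\<in>insert k A. monom (int (e i * i) * (y\<^sup>2 - x\<^sup>2)) i * (\<Prod>j\<in>insert k A - {i}. f j * g j))
      = c * M + f k * g k * S"
  proof -
    have "(\<Sum>i\<in>A. monom (int (e i * i) * (y\<^sup>2 - x\<^sup>2)) i * (\<Prod>j\<in>insert k A - {i}. f j * g j)) = f k * g k * S"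
      unfolding S_def sum_distrib_left
    proof (intro sum.cong refl)
      fix i assume i: "i \<in> A"
      then have "insert k A - {i} = insert k (A - {i})" using insert.hyps by auto
      then have "(\<Prod>j\<in>insert k A - {i}. f j * g j) = f k * g k * (\<Prod>j\<in>A - {i}. f j * g j)"
        using insert.hyps by simp
      then show "monom (int (e i * i) * (y\<^sup>2 - x\<^sup>2)) i * (\<Prod>j\<in>insert k A - {i}. f j * g j) =
         f k * g k * (monom (int (e i * i) * (y\<^sup>2 - x\<^sup>2)) i * (\<Prod>j\<in>A - {i}. f j * g j))"
        by (simp only: mult_ac)
    qed
    moreover have "insert k A - {k} = A" using insert.hyps by auto
    ultimately show ?thesis using insert.hyps unfolding c M_def by simp
  qed
  have "(euler_deriv (f k ^ e k * P) * (g k ^ e k * Q) - (f k ^ e k * P) * euler_deriv (g k ^ e k * Q))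
        * (f k * g k * M)
      = (euler_deriv (f k ^ e k) * f k) * (g k ^ e k * g k * P * Q * M)
        - (euler_deriv (g k ^ e k) * g k) * (f k ^ e k * f k * P * Q * M)
        + f k ^ e k * g k ^ e k * f k * g k * D"
    unfolding D_def euler_deriv_mult by (simp only: algebra_simps)
  also have "\<dots> = (f k ^ e k * P) * (g k ^ e k * Q) * (c * M + f k * g k * S)"
    unfolding euler_deriv_power IH c_def by (simp only: algebra_simps)
  finally show ?case
    unfolding S' using insert.hyps by (simp add: P_def Q_def M_def)
qed

text \<open>Modulo \<open>p\<close> and \<open>(X - 1)^p\<close>, the power \<open>W^p\<close> is
  the constant \<open>W(1)^p\<close>, so \<open>W\<close> is invertible there. The degree bound
  turns the congruence left for \<open>N\<close> into divisibility by \<open>p\<close>.\<close>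

lemma cancel_mod_X_minus_1_power:
  fixes W N U V :: "int poly"
  assumes p: "Factorial_Ring.prime p"
    and WN: "W * N = [:int p:] * U + [:-1, 1:] ^ p * V"
    and W1: "\<not> int p dvd poly W 1" and deg: "degree N < p"
  shows "[:int p:] dvd N"
proof -
  obtain W' where W': "W = [:poly W 1:] + [:-1, 1:] * W'" by (rule poly_div_X_minus_1)
  obtain c where "([:poly W 1:] + [:-1, 1:] * W') ^ p
      = [:poly W 1:] ^ p + ([:-1, 1:] * W') ^ p + of_nat p * ([:-1, 1:] * W') * c"
    by (rule prime_power_sum[OF p])
  then have "W ^ p = [:poly W 1:] ^ p + ([:-1, 1:] * W') ^ p + of_nat p * ([:-1, 1:] * W') * c"
    using W' by metis
  then have Wp: "[:poly W 1:] ^ p = W ^ p - [:-1, 1:] ^ p * W' ^ p - [:int p:] * ([:-1, 1:] * W' * c)"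
    unfolding power_mult_distrib of_nat_poly by (simp only: algebra_simps of_nat_poly)
  have "p > 0" using p prime_gt_0_nat by blast
  then have "W ^ p = W ^ (p - 1) * W" by (simp flip: power_Suc2)
  then have "[:poly W 1:] ^ p * N = W ^ (p - 1) * (W * N) - [:-1, 1:] ^ p * (W' ^ p * N)
      - [:int p:] * ([:-1, 1:] * W' * c * N)"
    unfolding Wp by (simp only: algebra_simps)
  also have "\<dots> = [:int p:] * (W ^ (p - 1) * U - [:-1, 1:] * W' * c * N)
      + [:-1, 1:] ^ p * (W ^ (p - 1) * V - W' ^ p * N)"
    unfolding WN by (simp only: algebra_simps)
  finally have eq: "[:poly W 1:] ^ p * N = \<dots>" .
  have pow: "[:a:] ^ n = [:a ^ n:]" for a :: int and n
    by (induction n) (simp_all add: one_pCons)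
  have "degree ([:poly W 1:] ^ p * N) < p" using deg unfolding pow by simp
  with eq have "[:int p:] dvd [:poly W 1:] ^ p * N" by (rule const_dvd_of_cong_X_minus_1_power)
  then have "int p dvd poly W 1 ^ p * coeff N i" for i
    unfolding pow const_poly_dvd_iff by simp
  moreover have "Factorial_Ring.prime (int p)" using p by simp
  ultimately have "int p dvd coeff N i" for i
    using W1 by (metis prime_dvd_mult_iff prime_dvd_power)
  then show ?thesis unfolding const_poly_dvd_iff by blast
qed

text \<open>The cleared logarithmic derivative of \<open>X^t\<close> times the quotient is
  \<open>N = t M + S\<close>. Its constant term gives \<open>p dvd t\<close>, since \<open>S\<close>
  has none; the coefficients of \<open>S\<close> then form a triangular system for the
  exponents.\<close>

lemma cong_quotient_exponents:
  fixes x y :: int and e :: "nat \<Rightarrow> nat"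
  defines "f k \<equiv> [:x:] + monom y k" and "g k \<equiv> [:y:] + monom x k"
  assumes p: "Factorial_Ring.prime p" and r: "r * (r + 1) < p"
    and xy: "\<not> int p dvd x" "\<not> int p dvd y" "\<not> int p dvd x + y" "\<not> int p dvd y - x"
    and H: "monom 1 t * (\<Prod>k\<in>{1..r}. f k ^ e k) - (\<Prod>k\<in>{1..r}. g k ^ e k)
      = [:int p:] * U + [:-1, 1:] ^ p * V"
    and k: "k \<in> {1..r}"
  shows "p dvd e k"
proof -
  have prime: "Factorial_Ring.prime (int p)" using p by simp
  have p0: "p > 0" using p prime_gt_0_nat by blast
  define P Q M S where "P = (\<Prod>k\<in>{1..r}. f k ^ e k)" and "Q = (\<Prod>k\<in>{1..r}. g k ^ e k)"
    and "M = (\<Prod>k\<in>{1..r}. f k * g k)"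
    and "S = (\<Sum>k\<in>{1..r}. monom (int (e k * k) * (y\<^sup>2 - x\<^sup>2)) k * (\<Prod>j\<in>{1..r} - {k}. f j * g j))"
  define h where "h = monom 1 t * P - Q"
  have h: "h = [:int p:] * U + [:-1, 1:] ^ p * V" using H unfolding h_def P_def Q_def .
  have PQ: "(euler_deriv P * Q - P * euler_deriv Q) * M = P * Q * S"
    unfolding P_def Q_def M_def S_def f_def g_def by (rule log_deriv_quotient) simp
  define N where "N = of_nat t * M + S"
  define W where "W = monom 1 t * P * Q"
  have "W * N = (euler_deriv (monom 1 t * P) * Q - monom 1 t * P * euler_deriv Q) * M"
  proof -
    have "W * N = monom 1 t * (of_nat t * P * Q * M + P * Q * S)"
      unfolding W_def N_def by (simp only: algebra_simps)
    also have "\<dots> = (of_nat t * monom 1 t * P * Q + monom 1 t * (euler_deriv P * Q - P * euler_deriv Q)) * M"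
      unfolding PQ[symmetric] by (simp only: algebra_simps)
    finally show ?thesis unfolding euler_deriv_mult euler_deriv_monom by (simp only: algebra_simps)
  qed
  \<comment> \<open>Writing \<open>X^t P = h + Q\<close> makes the terms in \<open>Q\<close> alone
    cancel, so that only \<open>h\<close> and its derivative remain, both of which are zero modulo
    \<open>p\<close> and \<open>(X - 1)^p\<close>.\<close>
  also have "\<dots> = (euler_deriv h * Q - h * euler_deriv Q) * M"
    unfolding h_def euler_deriv_diff by (simp only: algebra_simps)
  finally have WN: "W * N = (euler_deriv h * Q - h * euler_deriv Q) * M" .
  obtain p' where p': "p = Suc p'" using p0 by (cases p) auto
  \<comment> \<open>The factor \<open>X - 1\<close> lost by differentiation is compensated by the
    exponent \<open>p\<close> coming down.\<close>
  have "pderiv ([:-1, 1:] ^ p) = [:int p:] * [:-1, 1:] ^ p'"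
    unfolding p' pderiv_power_Suc by (simp add: pderiv_pCons of_nat_poly)
  then have "pderiv h = [:int p:] * (pderiv U + [:-1, 1:] ^ p' * V) + [:-1, 1:] ^ p * pderiv V"
    unfolding h pderiv_add pderiv_mult by (simp add: pderiv_pCons algebra_simps)
  then have "W * N = ([:0, 1:] * ([:int p:] * (pderiv U + [:-1, 1:] ^ p' * V) + [:-1, 1:] ^ p * pderiv V) * Q
      - ([:int p:] * U + [:-1, 1:] ^ p * V) * euler_deriv Q) * M"
    unfolding WN euler_deriv_def[of h] by (simp only: h)
  also have "\<dots> = [:int p:] * (([:0, 1:] * (pderiv U + [:-1, 1:] ^ p' * V) * Q - U * euler_deriv Q) * M)
      + [:-1, 1:] ^ p * (([:0, 1:] * pderiv V * Q - V * euler_deriv Q) * M)"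
    by (simp only: algebra_simps)
  finally have WN': "W * N = \<dots>" .
  have "poly W 1 = (x + y) ^ (\<Sum>k\<in>{1..r}. e k) * (x + y) ^ (\<Sum>k\<in>{1..r}. e k)"
    by (simp add: W_def P_def Q_def f_def g_def poly_prod poly_monom power_sum add.commute)
  then have W1: "\<not> int p dvd poly W 1"
    using xy(3) prime by (metis prime_dvd_mult_iff prime_dvd_power)
  have degfg: "degree (f j * g j) \<le> 2 * j" for j
  proof -
    have "degree (f j) \<le> j" "degree (g j) \<le> j"
      unfolding f_def g_def by (auto intro!: degree_add_le degree_monom_le)
    then show ?thesis using degree_mult_le[of "f j" "g j"] by linarith
  qed
  have degprod: "degree (\<Prod>j\<in>A. f j * g j) \<le> (\<Sum>j\<in>A. 2 * j)" if "finite A" for A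
  proof -
    have "degree (\<Prod>j\<in>A. f j * g j) \<le> (\<Sum>j\<in>A. degree (f j * g j))"
      using degree_prod_sum_le[OF that, of "\<lambda>j. f j * g j"] by (simp add: o_def)
    also have "\<dots> \<le> (\<Sum>j\<in>A. 2 * j)" by (intro sum_mono degfg)
    finally show ?thesis .
  qed
  have gauss: "(\<Sum>j\<in>{1..r}. 2 * j) = r * (r + 1)"
    by (induction r) (simp_all add: algebra_simps)
  have "degree M \<le> r * (r + 1)" unfolding M_def gauss[symmetric] by (rule degprod) simp
  then have degM: "degree (of_nat t * M) \<le> r * (r + 1)"
    using degree_smult_le[of "int t" M] by (simp add: of_nat_poly)
  have "degree S \<le> r * (r + 1)"
    unfolding S_def
  proof (rule degree_sum_le)
    fix k assume k: "k \<in> {1..r}"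
    have "(\<Sum>j\<in>{1..r}. 2 * j) = 2 * k + (\<Sum>j\<in>{1..r} - {k}. 2 * j)"
      using k by (intro sum.remove) auto
    moreover have "degree (\<Prod>j\<in>{1..r} - {k}. f j * g j) \<le> (\<Sum>j\<in>{1..r} - {k}. 2 * j)"
      by (rule degprod) simp
    moreover have "degree (monom (int (e k * k) * (y\<^sup>2 - x\<^sup>2)) k) \<le> k" by (rule degree_monom_le)
    ultimately show "degree (monom (int (e k * k) * (y\<^sup>2 - x\<^sup>2)) k * (\<Prod>j\<in>{1..r} - {k}. f j * g j)) \<le> r * (r + 1)"
      unfolding gauss using degree_mult_le by (smt (verit) add_mono le_add1 mult_2 order_trans)
  qed simp
  with degM have "degree N < p"
    using r unfolding N_def by (intro le_less_trans[OF degree_add_le]) auto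
  then have N: "[:int p:] dvd N" by (rule cancel_mod_X_minus_1_power[OF p WN' W1])
  have Mk0: "coeff (\<Prod>j\<in>A. f j * g j) 0 = (x * y) ^ card A" if "A \<subseteq> {1..r}" for A
  proof -
    have "poly (\<Prod>j\<in>A. f j * g j) 0 = (\<Prod>j\<in>A. x * y)"
      unfolding poly_prod using that
      by (intro prod.cong) (auto simp: f_def g_def poly_monom power_0_left)
    then show ?thesis by (simp add: poly_0_coeff_0)
  qed
  have xy0: "\<not> int p dvd (x * y) ^ n" for n
    using xy prime by (meson prime_dvd_mult_iff prime_dvd_power)
  have S0: "coeff S 0 = 0"
    unfolding S_def coeff_sum by (intro sum.neutral) (auto simp: coeff_monom_mult)
  have "int p dvd coeff N 0" using N unfolding const_poly_dvd_iff by blast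
  then have "int p dvd int t * (x * y) ^ r"
    using S0 Mk0[of "{1..r}"] by (simp add: N_def M_def of_nat_poly)
  then have t: "int p dvd int t" using xy0[of r] prime by (simp add: prime_dvd_mult_iff)
  have pS: "int p dvd coeff S i" for i
  proof -
    have "int p dvd coeff N i" using N unfolding const_poly_dvd_iff by blast
    then have "int p dvd int t * coeff M i + coeff S i" by (simp add: N_def of_nat_poly)
    then show ?thesis using t by (simp add: dvd_add_right_iff)
  qed
  show ?thesis
    using k
  proof (induction k rule: less_induct)
    case (less m)
    define T where "T k = coeff (monom (int (e k * k) * (y\<^sup>2 - x\<^sup>2)) k * (\<Prod>j\<in>{1..r} - {k}. f j * g j)) m" for k
    \<comment> \<open>The summand with index \<open>k\<close> is a multiple of \<open>X^k\<close>:
      larger \<open>k\<close> do not reach \<open>X^m\<close>, and smaller ones are divisible by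
      \<open>p\<close> by induction. What is left is \<open>e m * m * (y^2 - x^2)\<close> times a
      power of \<open>x * y\<close>.\<close>
    have "coeff S m = T m + (\<Sum>k\<in>{1..r} - {m}. T k)"
      unfolding S_def coeff_sum T_def using less.prems by (intro sum.remove) auto
    moreover have "int p dvd (\<Sum>k\<in>{1..r} - {m}. T k)"
    proof (rule dvd_sum)
      fix k assume k: "k \<in> {1..r} - {m}"
      show "int p dvd T k"
      proof (cases "k < m")
        case True
        then have "p dvd e k" using less.IH k by auto
        then have "int p dvd int (e k * k) * (y\<^sup>2 - x\<^sup>2)" by (metis dvd_mult2 int_dvd_int_iff)
        then show ?thesis unfolding T_def by (simp add: coeff_monom_mult)
      next
        case False
        then have "m < k" using k by auto
        then show ?thesis unfolding T_def by (simp add: coeff_monom_mult)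
      qed
    qed
    ultimately have "int p dvd T m" using pS[of m] by (simp add: dvd_add_left_iff)
    moreover have "T m = int (e m * m) * (y\<^sup>2 - x\<^sup>2) * (x * y) ^ (r - 1)"
      unfolding T_def using Mk0[of "{1..r} - {m}"] less.prems by (simp add: coeff_monom_mult)
    ultimately have "int p dvd int (e m * m) * (y\<^sup>2 - x\<^sup>2)"
      using xy0 prime by (simp add: prime_dvd_mult_iff)
    moreover have "y\<^sup>2 - x\<^sup>2 = (x + y) * (y - x)" by (simp add: power2_eq_square algebra_simps)
    ultimately have "int p dvd int (e m * m)"
      using xy prime by (simp add: prime_dvd_mult_iff)
    then have "p dvd e m * m" by (simp only: int_dvd_int_iff)
    moreover have "\<not> p dvd m"
    proof
      assume "p dvd m"
      then have "p \<le> m" using less.prems by (auto dest: dvd_imp_le)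
      moreover have "m \<le> r * (r + 1)" using less.prems by (simp add: trans_le_add1)
      ultimately show False using r by simp
    qed
    ultimately show "p dvd e m" using p by (simp add: prime_dvd_mult_iff)
  qed
qed

subsection \<open>Torsion and \<open>p\<close>-rank of finite abelian groups\<close>

text \<open>\<open>dim\<close> is the least size of a finite generating set. In a finite space such
  sets exist, so one of size \<open>dim\<close> does, and its linear combinations are counted by
  their coefficients.\<close>

lemma (in vectorspace) card_le_of_finite:
  assumes fin: "finite (carrier V)" "finite (carrier K)"
  shows "card (carrier V) \<le> card (carrier K) ^ dim"
proof -
  let ?P = "\<lambda>n. \<exists>A. finite A \<and> card A = n \<and> A \<subseteq> carrier V \<and> gen_set A"
  have "gen_set (carrier V)"
    using in_own_span[of "carrier V"] span_is_subset2[of "carrier V"] by auto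
  then have "?P (card (carrier V))" using fin by blast
  then have "?P dim" unfolding dim_def by (rule LeastI[of ?P])
  then obtain A where A: "finite A" "card A = dim" "A \<subseteq> carrier V" "gen_set A" by blast
  have "carrier V \<subseteq> (\<lambda>a. lincomb a A) ` (A \<rightarrow>\<^sub>E carrier K)"
  proof
    fix v assume "v \<in> carrier V"
    then have "v \<in> span A" using A(4) by simp
    then obtain a where a: "a \<in> A \<rightarrow> carrier K" "v = lincomb a A"
      using finite_span[OF A(1,3)] by auto
    then have "v = lincomb (restrict a A) A"
      using A(3) by (auto intro!: lincomb_cong)
    moreover have "restrict a A \<in> A \<rightarrow>\<^sub>E carrier K" using a by auto
    ultimately show "v \<in> (\<lambda>a. lincomb a A) ` (A \<rightarrow>\<^sub>E carrier K)" by blast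
  qed
  then have "card (carrier V) \<le> card (A \<rightarrow>\<^sub>E carrier K)"
    using A(1) fin by (meson surj_card_le finite_PiE)
  also have "\<dots> = card (carrier K) ^ dim" using A by (simp add: card_PiE)
  finally show ?thesis .
qed

lemma (in comm_group) power_hom: "(\<lambda>x. x [^] (n::nat)) \<in> hom G G"
  by (auto intro!: homI simp: pow_mult_distrib m_comm)

lemma (in comm_group) subgroup_powers: "subgroup ((\<lambda>x. x [^] (n::nat)) ` carrier G) G"
  using group_hom.img_is_subgroup[of G G "\<lambda>x. x [^] n"] power_hom
  by (auto simp: group_hom_def group_hom_axioms_def)

text \<open>Kernel and cokernel of an endomorphism of a finite abelian group have the same order, by
  the homomorphism theorem and Lagrange.\<close>

lemma (in comm_group) card_torsion_eq:
  assumes fin: "finite (carrier G)"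
  shows "card {x \<in> carrier G. x [^] (n::nat) = \<one>} = card (carrier (G Mod ((\<lambda>x. x [^] n) ` carrier G)))"
proof -
  let ?h = "\<lambda>x. x [^] n" and ?H = "(\<lambda>x. x [^] n) ` carrier G"
  let ?I = "G\<lparr>carrier := ?H\<rparr>"
  have sub: "subgroup ?H G" by (rule subgroup_powers)
  interpret h: group_hom G ?I ?h
    using power_hom sub subgroup.subgroup_is_group[OF sub]
    by (auto simp: group_hom_def group_hom_axioms_def hom_def)
  have ker: "kernel G ?I ?h = {x \<in> carrier G. x [^] n = \<one>}" by (auto simp: kernel_def)
  have "bij_betw (\<lambda>C. the_elem (?h ` C)) (carrier (G Mod (kernel G ?I ?h))) ?H"
    using h.FactGroup_inj_on h.FactGroup_onto by (simp add: bij_betw_def)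
  from bij_betw_same_card[OF this] have "card (rcosets (kernel G ?I ?h)) = card ?H"
    by (simp add: FactGroup_def)
  moreover have "card (rcosets (kernel G ?I ?h)) * card (kernel G ?I ?h) = Coset.order G"
    using lagrange[OF h.subgroup_kernel] by (simp add: mult.commute)
  moreover have "card (rcosets ?H) * card ?H = Coset.order G"
    using lagrange[OF sub] by (simp add: mult.commute)
  moreover have "card ?H > 0"
    using fin by (auto simp: card_gt_0_iff)
  ultimately have "card (kernel G ?I ?h) = card (rcosets ?H)"
    by (metis mult.commute mult_cancel2 not_gr0)
  then show ?thesis by (simp add: ker FactGroup_def)
qed

lemma mod_p_space_vectorspace:
  assumes A: "comm_group A" and p: "Factorial_Ring.prime p"
  shows "vectorspace (residue_ring (int p)) (mod_p_space p A)"
proof -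
  interpret A: comm_group A by (rule A)
  define B where "B = mod_p_powers p A"
  let ?H = "(\<lambda>x. x [^]\<^bsub>A\<^esub> p) ` carrier A"
  have sub: "subgroup ?H A" by (rule A.subgroup_powers)
  have normal: "normal ?H A" using A.normal_iff_subgroup sub by blast
  interpret B: comm_group B
    unfolding B_def mod_p_powers_def by (rule A.abelian_FactGroup[OF sub])
  have ord: "C [^]\<^bsub>B\<^esub> p = \<one>\<^bsub>B\<^esub>" if C: "C \<in> carrier B" for C
  proof -
    obtain x where x: "x \<in> carrier A" "C = ?H #>\<^bsub>A\<^esub> x"
      using C unfolding B_def mod_p_powers_def FactGroup_def RCOSETS_def by auto
    have hom: "group_hom A B (\<lambda>a. ?H #>\<^bsub>A\<^esub> a)"
      using normal.r_coset_hom_Mod[OF normal] A.is_group B.is_group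
      unfolding group_hom_def group_hom_axioms_def B_def mod_p_powers_def by auto
    have "C [^]\<^bsub>B\<^esub> p = ?H #>\<^bsub>A\<^esub> (x [^]\<^bsub>A\<^esub> p)"
      using group_hom.hom_nat_pow[OF hom x(1)] x(2) by simp
    also have "\<dots> = ?H"
      using x(1) by (intro A.coset_join2 sub) auto
    finally show ?thesis by (simp add: B_def mod_p_powers_def FactGroup_def)
  qed
  \<comment> \<open>Scalars are residues modulo \<open>p\<close>, so the module laws hold only
    because exponents may be reduced modulo \<open>p\<close>.\<close>
  have mod: "C [^]\<^bsub>B\<^esub> (n mod int p) = C [^]\<^bsub>B\<^esub> n" if C: "C \<in> carrier B" for C n
  proof -
    have "C [^]\<^bsub>B\<^esub> n = C [^]\<^bsub>B\<^esub> (int p * (n div int p) + n mod int p)" by simp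
    also have "\<dots> = C [^]\<^bsub>B\<^esub> (int p * (n div int p)) \<otimes>\<^bsub>B\<^esub> C [^]\<^bsub>B\<^esub> (n mod int p)"
      by (rule B.int_pow_mult[OF C])
    also have "C [^]\<^bsub>B\<^esub> (int p * (n div int p)) = (C [^]\<^bsub>B\<^esub> int p) [^]\<^bsub>B\<^esub> (n div int p)"
      using B.int_pow_pow[OF C] by simp
    also have "C [^]\<^bsub>B\<^esub> int p = \<one>\<^bsub>B\<^esub>" using ord[OF C] by (simp add: int_pow_int)
    finally show ?thesis using C by simp
  qed
  interpret R: residues_prime p "residue_ring (int p)"
    using p by unfold_locales auto
  have abelian: "abelian_group (mod_p_space p A)"
  proof (rule abelian_groupI)
    fix x assume "x \<in> carrier (mod_p_space p A)"
    then show "\<exists>y\<in>carrier (mod_p_space p A). y \<oplus>\<^bsub>mod_p_space p A\<^esub> x = \<zero>\<^bsub>mod_p_space p A\<^esub>"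
      using B.l_inv_ex by (simp add: mod_p_space_def B_def)
  qed (use B.m_assoc B.m_comm in \<open>auto simp: mod_p_space_def simp flip: B_def\<close>)
  have "Module.module (residue_ring (int p)) (mod_p_space p A)"
  proof (rule moduleI)
    show "cring (residue_ring (int p))" by (rule R.cring)
    show "abelian_group (mod_p_space p A)" by (rule abelian)
  next
    fix a b x assume "a \<in> carrier (residue_ring (int p))" "b \<in> carrier (residue_ring (int p))"
      "x \<in> carrier (mod_p_space p A)"
    then have x: "x \<in> carrier B" by (simp add: mod_p_space_def B_def)
    show "(a \<oplus>\<^bsub>residue_ring (int p)\<^esub> b) \<odot>\<^bsub>mod_p_space p A\<^esub> x
        = a \<odot>\<^bsub>mod_p_space p A\<^esub> x \<oplus>\<^bsub>mod_p_space p A\<^esub> b \<odot>\<^bsub>mod_p_space p A\<^esub> x"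
      using x by (simp add: mod_p_space_def residue_ring_def mod B.int_pow_mult flip: B_def)
    show "(a \<otimes>\<^bsub>residue_ring (int p)\<^esub> b) \<odot>\<^bsub>mod_p_space p A\<^esub> x
        = a \<odot>\<^bsub>mod_p_space p A\<^esub> (b \<odot>\<^bsub>mod_p_space p A\<^esub> x)"
      using x by (simp add: mod_p_space_def residue_ring_def mod B.int_pow_pow mult.commute flip: B_def)
  qed (auto simp: mod_p_space_def residue_ring_def B.int_pow_mult_distrib B.m_comm simp flip: B_def)
  then show ?thesis
    unfolding vectorspace_def using R.is_field by blast
qed

text \<open>The passage from the rank, which concerns A/A^p, to the elements of order dividing
  \<open>p\<close>, among which relations are sought.\<close>

theorem card_p_torsion_le:
  assumes A: "comm_group A" and fin: "finite (carrier A)" and p: "Factorial_Ring.prime p"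
  shows "card {x \<in> carrier A. x [^]\<^bsub>A\<^esub> p = \<one>\<^bsub>A\<^esub>} \<le> p ^ p_rank p A"
proof -
  interpret A: comm_group A by (rule A)
  interpret V: vectorspace "residue_ring (int p)" "mod_p_space p A"
    using A p by (rule mod_p_space_vectorspace)
  let ?H = "(\<lambda>x. x [^]\<^bsub>A\<^esub> p) ` carrier A"
  have "finite (carrier (A Mod ?H))"
    using fin unfolding FactGroup_def RCOSETS_def by simp
  then have "finite (carrier (mod_p_space p A))"
    by (simp add: mod_p_space_def mod_p_powers_def)
  then have "card (carrier (mod_p_space p A)) \<le> card (carrier (residue_ring (int p))) ^ V.dim"
    by (rule V.card_le_of_finite) (simp add: residue_ring_def)
  also have "card (carrier (residue_ring (int p))) = p" by (simp add: residue_ring_def)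
  finally show ?thesis
    unfolding A.card_torsion_eq[OF fin] p_rank_def by (simp add: mod_p_space_def mod_p_powers_def)
qed

lemma (in comm_group) finprod_subgroup:
  assumes "subgroup H G" "\<And>k. k \<in> A \<Longrightarrow> f k \<in> H"
  shows "finprod G f A \<in> H"
  using assms(2)
proof (induction A rule: infinite_finite_induct)
  case (insert k A)
  have "f \<in> insert k A \<rightarrow> carrier G"
    using insert.prems subgroup.subset[OF assms(1)] by blast
  then have "finprod G f (insert k A) = f k \<otimes> finprod G f A"
    using insert.hyps by (intro finprod_insert) auto
  then show ?case using insert subgroup.m_closed[OF assms(1)] by simp
qed (use subgroup.one_closed[OF assms(1)] in auto)

lemma comm_group_restrict:
  assumes "comm_group G" "subgroup H G" shows "comm_group (G\<lparr>carrier := H\<rparr>)"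
proof -
  interpret G: comm_group G by (rule assms(1))
  interpret H: group "G\<lparr>carrier := H\<rparr>" by (rule subgroup.subgroup_is_group[OF assms(2) G.is_group])
  show ?thesis
    by (rule H.group_comm_groupI) (use subgroup.subset[OF assms(2)] G.m_comm in auto)
qed

lemma (in comm_group) subgroup_p_part:
  "subgroup {x \<in> carrier G. \<exists>k::nat. x [^] ((p::nat) ^ k) = \<one>} G"
proof (rule subgroupI)
  show "inv x \<in> {x \<in> carrier G. \<exists>k::nat. x [^] (p ^ k) = \<one>}"
    if "x \<in> {x \<in> carrier G. \<exists>k::nat. x [^] (p ^ k) = \<one>}" for x
    using that nat_pow_inv by fastforce
  show "x \<otimes> y \<in> {x \<in> carrier G. \<exists>k::nat. x [^] (p ^ k) = \<one>}"
    if xy: "x \<in> {x \<in> carrier G. \<exists>k::nat. x [^] (p ^ k) = \<one>}"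
      "y \<in> {x \<in> carrier G. \<exists>k::nat. x [^] (p ^ k) = \<one>}" for x y
  proof -
    obtain k l :: nat where x: "x \<in> carrier G" "x [^] (p ^ k) = \<one>" and y: "y \<in> carrier G" "y [^] (p ^ l) = \<one>"
      using xy by blast
    have "x [^] (p ^ (k + l)) = (x [^] (p ^ k)) [^] (p ^ l)"
      by (simp only: nat_pow_pow[OF x(1)] power_add)
    moreover have "y [^] (p ^ (k + l)) = (y [^] (p ^ l)) [^] (p ^ k)"
      by (simp only: nat_pow_pow[OF y(1)] power_add mult.commute)
    ultimately have "(x \<otimes> y) [^] (p ^ (k + l)) = \<one>"
      using x y by (simp add: pow_mult_distrib m_comm)
    then show ?thesis using x y by blast
  qed
  show "{x \<in> carrier G. \<exists>k::nat. x [^] (p ^ k) = \<one>} \<noteq> {}" using one_closed nat_pow_one by blast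
qed auto

lemma (in comm_group) subgroup_torsion:
  assumes "subgroup H G" shows "subgroup {x \<in> H. x [^] (n::nat) = \<one>} G"
proof (rule subgroupI)
  have H: "x \<in> carrier G" if "x \<in> H" for x using subgroup.subset[OF assms] that by blast
  show "{x \<in> H. x [^] n = \<one>} \<subseteq> carrier G" using H by blast
  show "{x \<in> H. x [^] n = \<one>} \<noteq> {}" using subgroup.one_closed[OF assms] by auto
  show "inv x \<in> {x \<in> H. x [^] n = \<one>}" if "x \<in> {x \<in> H. x [^] n = \<one>}" for x
    using that subgroup.m_inv_closed[OF assms] H nat_pow_inv[of x n] by auto
  show "x \<otimes> y \<in> {x \<in> H. x [^] n = \<one>}"
    if "x \<in> {x \<in> H. x [^] n = \<one>}" "y \<in> {x \<in> H. x [^] n = \<one>}" for x y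
    using that subgroup.m_closed[OF assms] H by (auto simp: pow_mult_distrib m_comm)
qed

text \<open>An element killed by \<open>p\<close> already lies in the p-part, so restricting to the
  p-part keeps the p-torsion.\<close>

lemma card_torsion_subgroup_le:
  fixes G :: "'a monoid" (structure)
  assumes G: "comm_group G" and H: "subgroup H G" and fin: "finite (carrier G)" and p: "Factorial_Ring.prime p"
  shows "card {x \<in> H. x [^] p = \<one>} \<le> p ^ p_rank p (p_part p (G\<lparr>carrier := H\<rparr>))"
proof -
  interpret comm_group G by (rule G)
  interpret H: comm_group "G\<lparr>carrier := H\<rparr>"
    by (rule comm_group_restrict[OF G H])
  let ?P = "p_part p (G\<lparr>carrier := H\<rparr>)"
  have pow: "x [^]\<^bsub>G\<lparr>carrier := S\<rparr>\<^esub> (n::nat) = x [^] n" for S x n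
    by (simp add: nat_pow_def)
  have P: "comm_group ?P"
    using comm_group_restrict[OF H.comm_group_axioms H.subgroup_p_part[of p]]
    by (simp add: p_part_def)
  have carrier: "carrier ?P = {x \<in> H. \<exists>k::nat. x [^] (p ^ k) = \<one>}"
    by (simp add: p_part_def pow)
  have "finite (carrier ?P)"
    unfolding carrier using fin subgroup.subset[OF H] by (auto intro: finite_subset)
  then have "card {x \<in> carrier ?P. x [^]\<^bsub>?P\<^esub> p = \<one>\<^bsub>?P\<^esub>} \<le> p ^ p_rank p ?P"
    by (rule card_p_torsion_le[OF P _ p])
  moreover have "{x \<in> carrier ?P. x [^]\<^bsub>?P\<^esub> p = \<one>\<^bsub>?P\<^esub>} = {x \<in> H. x [^] p = \<one>}"
  proof -
    have "x [^]\<^bsub>?P\<^esub> p = x [^] p" for x by (simp add: p_part_def pow)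
    moreover have "\<exists>k::nat. x [^] (p ^ k) = \<one>" if "x [^] p = \<one>" for x
      using that by (intro exI[of _ 1]) simp
    ultimately show ?thesis unfolding carrier by (auto simp: p_part_def)
  qed
  ultimately show ?thesis by simp
qed

text \<open>More exponent vectors than torsion elements: two of them give the same product.\<close>
lemma (in comm_group) torsion_relation:
  assumes H: "subgroup H G" and fin: "finite H" and p: "Factorial_Ring.prime (p::nat)"
    and small: "card {x \<in> H. x [^] p = \<one>} < p ^ r"
    and x: "\<And>k. k \<in> {1..r} \<Longrightarrow> x k \<in> H \<and> x k [^] p = \<one>"
  obtains b :: "nat \<Rightarrow> nat" and k where "k \<in> {1..r}" "\<not> p dvd b k"
    "finprod G (\<lambda>k. x k [^] b k) {1..r} = \<one>"
proof -
  let ?T = "{x \<in> H. x [^] p = \<one>}"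
  have T: "subgroup ?T G" by (rule subgroup_torsion[OF H])
  have xG: "x k \<in> carrier G" if "k \<in> {1..r}" for k
    using x[OF that] subgroup.subset[OF H] by blast
  define F where "F b = finprod G (\<lambda>k. x k [^] (b k :: nat)) {1..r}" for b
  have pi: "(\<lambda>k. x k [^] (b k :: nat)) \<in> {1..r} \<rightarrow> carrier G" for b
    using xG by auto
  have "F b \<in> ?T" for b
    unfolding F_def
  proof (rule finprod_subgroup[OF T])
    fix k assume k: "k \<in> {1..r}"
    show "x k [^] b k \<in> ?T"
    proof (induction "b k")
      case 0
      show ?case using subgroup.one_closed[OF T] by (simp flip: 0)
    next
      case (Suc n)
      have "x k [^] m \<in> ?T" for m :: nat
        by (induction m) (use subgroup.one_closed[OF T] subgroup.m_closed[OF T] x[OF k] in auto)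
      then show ?case .
    qed
  qed
  then have "F ` ({1..r} \<rightarrow>\<^sub>E {..<p}) \<subseteq> ?T" by blast
  then have "card (F ` ({1..r} \<rightarrow>\<^sub>E {..<p})) \<le> card ?T"
    using fin by (intro card_mono) auto
  also have "\<dots> < card ({1..r} \<rightarrow>\<^sub>E {..<p})" using small by (simp add: card_PiE)
  finally have "\<not> inj_on F ({1..r} \<rightarrow>\<^sub>E {..<p})" by (rule pigeonhole)
  then obtain b c where bc: "b \<in> {1..r} \<rightarrow>\<^sub>E {..<p}" "c \<in> {1..r} \<rightarrow>\<^sub>E {..<p}" "b \<noteq> c" "F b = F c"
    unfolding inj_on_def by blast
  obtain k where k: "k \<in> {1..r}" "b k \<noteq> c k"
    using bc(1-3) by (meson PiE_ext)
  have lt: "b k < p" "c k < p" if "k \<in> {1..r}" for k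
    using bc(1,2) that by (auto simp: PiE_iff)
  have mult: "F b \<otimes> F c = F (\<lambda>k. b k + c k)" for b c
  proof -
    have "F b \<otimes> F c = finprod G (\<lambda>k. x k [^] b k \<otimes> x k [^] c k) {1..r}"
      unfolding F_def by (rule finprod_multf[OF pi pi, symmetric])
    also have "\<dots> = F (\<lambda>k. b k + c k)"
      unfolding F_def using xG by (intro finprod_cong') (auto simp: nat_pow_mult)
    finally show ?thesis .
  qed
  \<comment> \<open>\<open>p - c k\<close> stands for the exponent \<open>- c k\<close>. At an index
    where \<open>b\<close> and \<open>c\<close> differ, the sum lies strictly between 0 and
    \<open>2 p\<close> and is not \<open>p\<close>.\<close>
  have "F (\<lambda>k. b k + (p - c k)) = F c \<otimes> F (\<lambda>k. p - c k)"
    unfolding mult[symmetric] bc(4) ..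
  also have "\<dots> = F (\<lambda>k. c k + (p - c k))" by (rule mult)
  also have "\<dots> = finprod G (\<lambda>k. \<one>) {1..r}"
    unfolding F_def
  proof (rule finprod_cong')
    fix k assume k: "k \<in> {1..r}"
    have "c k + (p - c k) = p" using lt[OF k] by simp
    then show "x k [^] (c k + (p - c k)) = \<one>" using x[OF k] by simp
  qed auto
  also have "\<dots> = \<one>" by simp
  finally have "F (\<lambda>k. b k + (p - c k)) = \<one>" .
  moreover have "\<not> p dvd b k + (p - c k)"
  proof
    assume "p dvd b k + (p - c k)"
    then obtain q where q: "b k + (p - c k) = p * q" by (elim dvdE)
    have "0 < b k + (p - c k)" "b k + (p - c k) < p * 2" using lt[OF k(1)] by auto
    then have "0 < p * q" "p * q < p * 2" by (simp_all only: q)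
    then have "q = 1" by simp
    then show False using q k(2) lt[OF k(1)] by simp
  qed
  ultimately show thesis
    using k(1) unfolding F_def by (intro that[of k "\<lambda>k. b k + (p - c k)"])
qed

lemma ip_interchange: "ip (ip A B) (ip C D) = ip (ip A C) (ip B D)"
proof -
  have "ip B (ip C D) = ip C (ip B D)"
    unfolding ip_assoc[symmetric] ip_comm[of B C] ..
  then show ?thesis unfolding ip_assoc by simp
qed

context cyclotomic
begin

subsection \<open>The relative class group\<close>

abbreviation PFp :: "complex set set" where "PFp \<equiv> principal_fractional_ideals Kp"

definition prinr :: "complex \<Rightarrow> complex set" where "prinr a = (*) a ` Zr"

lemma PFp_eq: "PFp = {prinr a | a. a \<in> Kp \<and> a \<noteq> 0}"
  by (auto simp: principal_fractional_ideals_def integers_of_Kp prinr_def)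

lemma ip_Zr_NI: "ip Zr (NI I) = NI I"
proof
  show "ip Zr (NI I) \<subseteq> NI I" by (intro ip_subset NI_mult NI_add)
  show "NI I \<subseteq> ip Zr (NI I)" using ip_mult[OF Zr_int[of 1], of _ "NI I"] by auto
qed

lemma coset_NI: "PFp #>\<^bsub>fractional_ideal_group Kp\<^esub> NI I = {(*) x ` NI I | x. x \<in> Kp \<and> x \<noteq> 0}"
  by (auto simp: r_coset_def PFp_eq fractional_ideal_group_def prinr_def ip_scale ip_Zr_NI)

lemma NI_scale: "NI ((*) a ` I) = (*) (a * cnj a) ` NI I"
proof -
  have "(\<lambda>x. x * cnj x) ` ((*) a ` I) = (*) (a * cnj a) ` ((\<lambda>x. x * cnj x) ` I)"
    by (simp add: image_image mult_ac)
  then show ?thesis by (simp add: NI_def ip_scale_right)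
qed

text \<open>Scaling \<open>I\<close> by \<open>a\<close> scales its norm by
  \<open>a * cnj a\<close>, a nonzero element of \<open>Kp\<close>, so all members of a class have
  norms in one class and \<open>the_elem\<close> is applied to a singleton.\<close>

lemma class_norm_cl:
  assumes "frac_ideal I"
  shows "class_norm Qz Kp (cl I) = {(*) x ` NI I | x. x \<in> Kp \<and> x \<noteq> 0}"
proof -
  have "PFp #>\<^bsub>fractional_ideal_group Kp\<^esub> ideal_norm Qz Kp J = {(*) x ` NI I | x. x \<in> Kp \<and> x \<noteq> 0}"
    if J: "J \<in> cl I" for J
  proof -
    obtain a where a: "a \<in> Qz" "a \<noteq> 0" "J = (*) a ` I" using J by (auto simp: cl_eq[OF assms])
    have c: "a * cnj a \<in> Kp" "a * cnj a \<noteq> 0" using a by (auto simp: Kp_iff)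
    have "frac_ideal J" using a assms by (auto intro: frac_scale)
    then have "PFp #>\<^bsub>fractional_ideal_group Kp\<^esub> ideal_norm Qz Kp J = {(*) x ` NI J | x. x \<in> Kp \<and> x \<noteq> 0}"
      by (simp add: ideal_norm_eq coset_NI)
    also have "\<dots> = {(*) x ` NI I | x. x \<in> Kp \<and> x \<noteq> 0}"
    proof (intro equalityI subsetI)
      fix B assume "B \<in> {(*) x ` NI J | x. x \<in> Kp \<and> x \<noteq> 0}"
      then obtain x where "x \<in> Kp" "x \<noteq> 0" "B = (*) (x * (a * cnj a)) ` NI I"
        unfolding a(3) NI_scale scale_scale by blast
      then show "B \<in> {(*) x ` NI I | x. x \<in> Kp \<and> x \<noteq> 0}"
        using c by (intro CollectI exI[of _ "x * (a * cnj a)"]) (auto simp: Kp_iff)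
    next
      fix B assume "B \<in> {(*) x ` NI I | x. x \<in> Kp \<and> x \<noteq> 0}"
      then obtain x where x: "x \<in> Kp" "x \<noteq> 0" "B = (*) x ` NI I" by blast
      have "B = (*) (x / (a * cnj a)) ` NI J"
        unfolding a(3) NI_scale scale_scale x(3) using c by simp
      then show "B \<in> {(*) x ` NI J | x. x \<in> Kp \<and> x \<noteq> 0}"
        using c x by (intro CollectI exI[of _ "x / (a * cnj a)"]) (auto simp: Kp_iff)
    qed
    finally show ?thesis .
  qed
  then have "(\<lambda>J. PFp #>\<^bsub>fractional_ideal_group Kp\<^esub> ideal_norm Qz Kp J) ` cl I
      = (\<lambda>J. {(*) x ` NI I | x. x \<in> Kp \<and> x \<noteq> 0}) ` cl I" by (rule image_cong[OF refl])
  also have "\<dots> = {{(*) x ` NI I | x. x \<in> Kp \<and> x \<noteq> 0}}"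
  proof -
    have "cl I \<noteq> {}" unfolding cl_eq[OF assms] using Zz_Qz[OF Zz_1] one_neq_zero by blast
    then show ?thesis by (simp only: image_constant_conv if_False)
  qed
  finally have "(\<lambda>J. PFp #>\<^bsub>fractional_ideal_group Kp\<^esub> ideal_norm Qz Kp J) ` cl I
      = {{(*) x ` NI I | x. x \<in> Kp \<and> x \<noteq> 0}}" .
  then show ?thesis unfolding class_norm_def by simp
qed

text \<open>\<open>NI I\<close> and the product of \<open>I\<close> with its conjugate determine
  each other, by \<open>extension_NI\<close> in one direction and by taking real elements,
  \<open>NI_eq\<close>, in the other. The norm condition thus becomes one on ideals of
  \<open>Qz\<close>, with the generator still required to lie in \<open>Kp\<close>.\<close>

lemma class_norm_trivial_iff:
  assumes I: "frac_ideal I"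
  shows "class_norm Qz Kp (cl I) = PFp \<longleftrightarrow> (\<exists>a\<in>Kp. a \<noteq> 0 \<and> ip I (cnj ` I) = prin a)"
proof -
  have 1: "1 \<in> Kp" using Zz_Qz[of 1] by (simp add: Kp_iff)
  have "class_norm Qz Kp (cl I) = PFp \<longleftrightarrow> (\<exists>a\<in>Kp. a \<noteq> 0 \<and> NI I = prinr a)"
  proof
    assume *: "class_norm Qz Kp (cl I) = PFp"
    have "NI I \<in> {(*) x ` NI I | x. x \<in> Kp \<and> x \<noteq> 0}" using 1 by (auto intro!: exI[of _ 1])
    then have "NI I \<in> PFp" using * unfolding class_norm_cl[OF I] by simp
    then show "\<exists>a\<in>Kp. a \<noteq> 0 \<and> NI I = prinr a" by (auto simp: PFp_eq)
  next
    assume "\<exists>a\<in>Kp. a \<noteq> 0 \<and> NI I = prinr a"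
    then obtain a where a: "a \<in> Kp" "a \<noteq> 0" "NI I = prinr a" by blast
    show "class_norm Qz Kp (cl I) = PFp"
      unfolding class_norm_cl[OF I] PFp_eq
    proof (intro equalityI subsetI)
      fix B assume "B \<in> {(*) x ` NI I | x. x \<in> Kp \<and> x \<noteq> 0}"
      then obtain x where x: "x \<in> Kp" "x \<noteq> 0" "B = (*) x ` prinr a" unfolding a(3) by blast
      then have "B = prinr (x * a)" by (simp add: prinr_def scale_scale)
      moreover have "x * a \<in> Kp" "x * a \<noteq> 0" using x a by (auto simp: Kp_iff)
      ultimately show "B \<in> {prinr a | a. a \<in> Kp \<and> a \<noteq> 0}" by blast
    next
      fix B assume "B \<in> {prinr a | a. a \<in> Kp \<and> a \<noteq> 0}"
      then obtain b where b: "b \<in> Kp" "b \<noteq> 0" "B = prinr b" by blast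
      have "B = (*) (b / a) ` NI I"
        unfolding b(3) a(3) prinr_def scale_scale using a(2) by simp
      moreover have "b / a \<in> Kp" "b / a \<noteq> 0" using a b by (auto simp: Kp_iff)
      ultimately show "B \<in> {(*) x ` NI I | x. x \<in> Kp \<and> x \<noteq> 0}" by blast
    qed
  qed
  also have "\<dots> \<longleftrightarrow> (\<exists>a\<in>Kp. a \<noteq> 0 \<and> ip I (cnj ` I) = prin a)"
  proof (intro bex_cong refl conj_cong iffI)
    fix a assume a: "a \<in> Kp" "a \<noteq> 0"
    {
      assume *: "NI I = prinr a"
      have "ip Zz Zr = Zz"
      proof
        show "ip Zz Zr \<subseteq> Zz" by (intro ip_subset) (auto simp: Zr_def)
        show "Zz \<subseteq> ip Zz Zr" using ip_mult[OF _ Zr_int[of 1], of _ Zz] by auto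
      qed
      then show "ip I (cnj ` I) = prin a"
        unfolding extension_NI[OF I, symmetric] * by (simp add: prinr_def prin_def ip_scale_right)
    }
    {
      assume *: "ip I (cnj ` I) = prin a"
      have real: "cnj (a * y) = a * y \<longleftrightarrow> cnj y = y" for y using a by (simp add: Kp_iff)
      show "NI I = prinr a"
        unfolding NI_eq[OF I] * prin_def prinr_def
      proof (intro equalityI subsetI)
        fix z assume "z \<in> {z \<in> (*) a ` Zz. cnj z = z}"
        then obtain y where y: "y \<in> Zz" "z = a * y" "cnj (a * y) = a * y" by blast
        then have "y \<in> Zr" unfolding real by (simp add: Zr_def)
        then show "z \<in> (*) a ` Zr" unfolding y(2) by (rule imageI)
      next
        fix z assume "z \<in> (*) a ` Zr"
        then obtain y where y: "y \<in> Zr" "z = a * y" by blast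
        then have "cnj z = z" unfolding y(2) real by (simp add: Zr_def)
        then show "z \<in> {z \<in> (*) a ` Zz. cnj z = z}" using y by (auto simp: Zr_def)
      qed
    }
  qed
  finally show ?thesis .
qed

definition relker :: "complex set set set"
  where "relker = {cl I | I. frac_ideal I \<and> (\<exists>a\<in>Kp. a \<noteq> 0 \<and> ip I (cnj ` I) = prin a)}"

lemma relative_class_group_eq: "relative_class_group Qz Kp = (class_group Qz)\<lparr>carrier := relker\<rparr>"
proof -
  have "one (class_group Kp) = PFp" by (simp add: class_group_def FactGroup_def)
  then have "kernel (class_group Qz) (class_group Kp) (class_norm Qz Kp) = relker"
    unfolding kernel_def carrier_class relker_def using class_norm_trivial_iff by auto
  then show ?thesis by (simp add: relative_class_group_def)
qed

lemma cnj_ip: "cnj ` ip I J = ip (cnj ` I) (cnj ` J)"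
proof -
  have sub: "cnj ` ip I J \<subseteq> ip (cnj ` I) (cnj ` J)" for I J
  proof
    fix z assume "z \<in> cnj ` ip I J"
    then obtain x where x: "x \<in> ip I J" "z = cnj x" by auto
    from x(1) have "cnj x \<in> ip (cnj ` I) (cnj ` J)"
      by (induction rule: ip_induct) (auto intro: ip_mult ip_add)
    then show "z \<in> ip (cnj ` I) (cnj ` J)" by (simp add: x)
  qed
  have "cnj ` ip (cnj ` I) (cnj ` J) \<subseteq> ip I J" using sub[of "cnj ` I" "cnj ` J"] by (simp add: image_image)
  then have "cnj ` cnj ` ip (cnj ` I) (cnj ` J) \<subseteq> cnj ` ip I J" by (rule image_mono)
  then have "ip (cnj ` I) (cnj ` J) \<subseteq> cnj ` ip I J" by (simp add: image_image)
  with sub show ?thesis by blast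
qed

lemma cl_Zz: "cl Zz = \<one>\<^bsub>class_group Qz\<^esub>"
proof -
  have "1 \<in> Qz \<and> (1::complex) \<noteq> 0 \<and> Zz = prin 1" by (simp add: prin_1 Zz_Qz)
  then show ?thesis using cl_one_iff[OF frac_Zz] unfolding one_class by blast
qed

sublocale CG: comm_group "class_group Qz"
  by (rule comm_group_class)

lemma subgroup_relker: "subgroup relker (class_group Qz)"
proof (rule CG.subgroupI)
  show "relker \<subseteq> carrier (class_group Qz)" by (auto simp: relker_def carrier_class)
  have "cnj ` Zz = Zz"
  proof
    show "Zz \<subseteq> cnj ` Zz" using Zz_cnj by (metis complex_cnj_cnj image_eqI subsetI)
  qed auto
  then have "ip Zz (cnj ` Zz) = prin 1" by (simp add: ip_Zz frac_Zz prin_1)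
  then have "cl Zz \<in> relker" unfolding relker_def
    using frac_Zz Zz_Qz[of 1] by (intro CollectI exI[of _ Zz] conjI bexI[of _ 1]) (auto simp: Kp_iff)
  then show "relker \<noteq> {}" by blast
  show "C \<otimes>\<^bsub>class_group Qz\<^esub> D \<in> relker" if CD: "C \<in> relker" "D \<in> relker" for C D
  proof -
    obtain I a where I: "C = cl I" "frac_ideal I" "a \<in> Kp" "a \<noteq> 0" "ip I (cnj ` I) = prin a"
      using CD(1) by (auto simp: relker_def)
    obtain J b where J: "D = cl J" "frac_ideal J" "b \<in> Kp" "b \<noteq> 0" "ip J (cnj ` J) = prin b"
      using CD(2) by (auto simp: relker_def)
    have "ip (ip I J) (cnj ` ip I J) = ip (ip I (cnj ` I)) (ip J (cnj ` J))"
      unfolding cnj_ip by (rule ip_interchange)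
    also have "\<dots> = prin (a * b)" by (simp add: I J ip_prin_prin)
    finally have "ip (ip I J) (cnj ` ip I J) = prin (a * b)" .
    moreover have "C \<otimes>\<^bsub>class_group Qz\<^esub> D = cl (ip I J)" using I J by (simp add: cl_mult)
    ultimately show ?thesis unfolding relker_def
      using I J by (auto intro!: exI[of _ "ip I J"] bexI[of _ "a * b"] frac_ip simp: Kp_iff)
  qed
  show "inv\<^bsub>class_group Qz\<^esub> C \<in> relker" if C: "C \<in> relker" for C
  proof -
    obtain I a where I: "C = cl I" "frac_ideal I" "a \<in> Kp" "a \<noteq> 0" "ip I (cnj ` I) = prin a"
      using C by (auto simp: relker_def)
    obtain J where J: "frac_ideal J" "ip I J = Zz" using I(2) by (rule ex_inverse)
    have aQ: "a \<in> Qz" using I by (simp add: Kp_iff)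
    note cl1 = cl_Zz
    have "cl J \<otimes>\<^bsub>class_group Qz\<^esub> cl I = \<one>\<^bsub>class_group Qz\<^esub>"
      using cl_mult[OF J(1) I(2)] J(2) cl1 by (simp add: ip_comm)
    then have inv: "inv\<^bsub>class_group Qz\<^esub> C = cl J"
      using I J by (intro CG.inv_equality) (auto simp: carrier_class)
    have "ip (prin a) (ip J (cnj ` J)) = ip (ip I J) (cnj ` ip I J)"
      unfolding cnj_ip I(5)[symmetric] by (rule ip_interchange)
    then have 1: "ip (prin a) (ip J (cnj ` J)) = Zz"
      unfolding J(2) \<open>cnj ` Zz = Zz\<close> by (simp only: ip_Zz[OF frac_Zz])
    have "a * (1 / a) = 1" using I(4) by simp
    then have "prin (a * (1 / a)) = Zz" by (simp only: prin_1)
    then have 2: "ip (prin a) (prin (1 / a)) = Zz" unfolding ip_prin_prin .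
    have "1 / a \<in> Qz" using aQ Zz_Qz[OF Zz_1] by (rule Qz_divide[rotated])
    then have 3: "frac_ideal (prin (1 / a))" using I(4) by (intro frac_prin) auto
    have "ip J (cnj ` J) = prin (1 / a)"
      by (rule ip_cancel[OF frac_prin[OF aQ I(4)] frac_ip[OF J(1) frac_cnj[OF J(1)]] 3])
        (simp only: 1 2)
    moreover have "1 / a \<in> Kp" "1 / a \<noteq> 0"
      using \<open>1 / a \<in> Qz\<close> I(3,4) by (auto simp: Kp_iff)
    ultimately show ?thesis unfolding inv relker_def using J(1) by blast
  qed
qed

lemma ipow_eq: "frac_ideal I \<Longrightarrow> ipow I n = I [^]\<^bsub>FG\<^esub> n"
  by (induction n) (simp_all add: FG_simps ip_comm)

lemma cl_ipow: "frac_ideal I \<Longrightarrow> cl (ipow I n) = cl I [^]\<^bsub>class_group Qz\<^esub> n"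
  using group_hom.hom_nat_pow[OF cl_hom, of I n] by (simp add: ipow_eq FG_simps)

lemma ipow_ip: "frac_ideal I \<Longrightarrow> frac_ideal J \<Longrightarrow> ipow (ip I J) n = ip (ipow I n) (ipow J n)"
  using FG.pow_mult_distrib[of I J n] FG.m_comm[of I J] by (simp add: ipow_eq FG_simps frac_ip)

lemma ipow_ipow: "frac_ideal I \<Longrightarrow> ipow (ipow I m) n = ipow I (m * n)"
  using FG.nat_pow_pow[of I m n] frac_ipow[of I m] by (simp add: ipow_eq FG_simps)

lemma ipow_prin: "ipow (prin a) n = prin (a ^ n)"
  by (induction n) (simp_all add: prin_1 ip_prin_prin)

text \<open>With more classes than the rank, some product \<open>L\<close> of powers of the
  \<open>J k\<close>, not all exponents divisible by \<open>p\<close>, is principal. Comparing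
  generators of its p-th power gives the conclusion.\<close>

lemma relative_class_relation:
  assumes rank: "p_rank p (p_part p (relative_class_group Qz Kp)) < r"
    and J: "\<And>k. k \<in> {1..r} \<Longrightarrow> frac_ideal (J k) \<and> (\<exists>a\<in>Kp. a \<noteq> 0 \<and> ip (J k) (cnj ` J k) = prin a)"
    and Jp: "\<And>k. k \<in> {1..r} \<Longrightarrow> c k \<in> Qz \<and> c k \<noteq> 0 \<and> ipow (J k) p = prin (c k)"
  obtains b :: "nat \<Rightarrow> nat" and k \<gamma> where "k \<in> {1..r}" "\<not> p dvd b k" "\<gamma> \<in> Qz" "\<gamma> \<noteq> 0"
    "prin (\<gamma> ^ p) = prin (\<Prod>k\<in>{1..r}. c k ^ b k)"
proof -
  let ?x = "\<lambda>k. cl (J k)"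
  have fin: "finite relker"
    using finite_class_group subgroup.subset[OF subgroup_relker] by (rule finite_subset[rotated])
  have "card {x \<in> relker. x [^]\<^bsub>class_group Qz\<^esub> p = \<one>\<^bsub>class_group Qz\<^esub>} \<le>
      p ^ p_rank p (p_part p (relative_class_group Qz Kp))"
    unfolding relative_class_group_eq
    by (rule card_torsion_subgroup_le[OF comm_group_class subgroup_relker finite_class_group prime_p])
  also have "\<dots> < p ^ r" using rank p_gt_2 by simp
  finally have small: "card {x \<in> relker. x [^]\<^bsub>class_group Qz\<^esub> p = \<one>\<^bsub>class_group Qz\<^esub>} < p ^ r" .
  have x: "?x k \<in> relker \<and> ?x k [^]\<^bsub>class_group Qz\<^esub> p = \<one>\<^bsub>class_group Qz\<^esub>" if k: "k \<in> {1..r}" for k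
  proof
    show "?x k \<in> relker" using J[OF k] by (auto simp: relker_def)
    have "cl (prin (c k)) = PF" using Jp[OF k] by (subst cl_one_iff) (auto intro: frac_prin)
    then show "?x k [^]\<^bsub>class_group Qz\<^esub> p = \<one>\<^bsub>class_group Qz\<^esub>"
      using J[OF k] Jp[OF k] by (simp add: cl_ipow[symmetric] one_class)
  qed
  obtain b :: "nat \<Rightarrow> nat" and k where bk: "k \<in> {1..r}" "\<not> p dvd b k"
    "finprod (class_group Qz) (\<lambda>k. ?x k [^]\<^bsub>class_group Qz\<^esub> b k) {1..r} = \<one>\<^bsub>class_group Qz\<^esub>"
    by (rule CG.torsion_relation[OF subgroup_relker fin prime_p small x]) auto
  \<comment> \<open>One ideal must carry both facts: its class shows that it is principal, and its
    p-th power links the generator to the \<open>c k\<close>.\<close>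
  have "\<exists>L. frac_ideal L \<and> cl L = finprod (class_group Qz) (\<lambda>k. ?x k [^]\<^bsub>class_group Qz\<^esub> b k) A
      \<and> ipow L p = prin (\<Prod>k\<in>A. c k ^ b k)" if "finite A" "A \<subseteq> {1..r}" for A
    using that
  proof (induction A rule: finite_induct)
    case empty
    show ?case using frac_Zz cl_Zz ipow_prin[of 1 p] by (intro exI[of _ Zz]) (simp add: prin_1)
  next
    case (insert k A)
    then obtain L where L: "frac_ideal L" "cl L = finprod (class_group Qz) (\<lambda>k. ?x k [^]\<^bsub>class_group Qz\<^esub> b k) A"
      "ipow L p = prin (\<Prod>k\<in>A. c k ^ b k)" by auto
    have k: "k \<in> {1..r}" using insert.prems by simp
    have fJ: "frac_ideal (J k)" using J[OF k] by simp
    have car: "?x j \<in> carrier (class_group Qz)" if "j \<in> insert k A" for j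
      using J[of j] that insert.prems by (auto simp: carrier_class)
    have "cl (ip (ipow (J k) (b k)) L) = finprod (class_group Qz) (\<lambda>k. ?x k [^]\<^bsub>class_group Qz\<^esub> b k) (insert k A)"
      using insert.hyps car L fJ
      by (subst CG.finprod_insert) (auto simp: cl_mult cl_ipow frac_ipow)
    moreover have "ipow (ip (ipow (J k) (b k)) L) p = prin (\<Prod>k\<in>insert k A. c k ^ b k)"
    proof -
      have "ipow (ipow (J k) (b k)) p = ipow (ipow (J k) p) (b k)"
        using fJ by (simp add: ipow_ipow mult.commute)
      also have "\<dots> = prin (c k ^ b k)" using Jp[OF k] by (simp add: ipow_prin)
      finally show ?thesis
        using insert.hyps fJ L by (simp add: ipow_ip frac_ipow ip_prin_prin)
    qed
    moreover have "frac_ideal (ip (ipow (J k) (b k)) L)" using fJ L by (intro frac_ip frac_ipow)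
    ultimately show ?case by blast
  qed
  from this[of "{1..r}"] obtain L where L: "frac_ideal L" "cl L = \<one>\<^bsub>class_group Qz\<^esub>"
    "ipow L p = prin (\<Prod>k\<in>{1..r}. c k ^ b k)" using bk(3) by auto
  then obtain \<gamma> where \<gamma>: "\<gamma> \<in> Qz" "\<gamma> \<noteq> 0" "L = prin \<gamma>"
    using cl_one_iff[OF L(1)] unfolding one_class by blast
  have "prin (\<gamma> ^ p) = prin (\<Prod>k\<in>{1..r}. c k ^ b k)"
    using L(3) by (simp add: \<gamma>(3) ipow_prin)
  with bk(1,2) \<gamma>(1,2) show thesis by (rule that[of k b \<gamma>])
qed

subsection \<open>Units\<close>

text \<open>By \<open>coeff_trace\<close> each coefficient of the reduced representative is
  \<open>1 / p\<close> times a sum of \<open>p - 1\<close> terms of absolute value at most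
  2.\<close>

lemma finite_bounded_conjugates:
  "finite {w \<in> Zz. \<forall>k\<in>{1..<p}. norm (sigma k w) \<le> 1}"
proof (rule finite_subset)
  let ?F = "(\<lambda>c. \<Sum>i<p - 1. of_int (c i) * \<zeta> ^ i) ` ({..<p - 1} \<rightarrow>\<^sub>E {-2..2::int})"
  show "finite ?F" by (intro finite_imageI finite_PiE) auto
  show "{w \<in> Zz. \<forall>k\<in>{1..<p}. norm (sigma k w) \<le> 1} \<subseteq> ?F"
  proof
    fix w assume "w \<in> {w \<in> Zz. \<forall>k\<in>{1..<p}. norm (sigma k w) \<le> 1}"
    then have w: "w \<in> Zz" "\<And>k. k \<in> {1..<p} \<Longrightarrow> norm (sigma k w) \<le> 1" by auto
    obtain f where f: "w = evp \<zeta> f" using w(1) by (rule ZzE)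
    obtain r where r: "degree r < p - 1" "\<And>k. k \<in> {1..<p} \<Longrightarrow> evp (\<zeta> ^ k) r = evp (\<zeta> ^ k) f"
      by (rule evp_reduce[of f]) blast
    have bound: "coeff r j \<in> {-2..2}" if j: "j < p - 1" for j
    proof -
      have eq: "{..<p} = insert 0 {1..<p}" using p_pos by auto
      have "of_nat p * of_int (coeff r j) = (\<Sum>k\<in>{1..<p}. evp (\<zeta> ^ k) r * ((\<zeta> ^ k) ^ (p - j) - \<zeta> ^ k))"
        unfolding coeff_trace[OF r(1) j, symmetric] eq by simp
      then have "norm (of_nat p * of_int (coeff r j) :: complex)
          \<le> (\<Sum>k\<in>{1..<p}. norm (evp (\<zeta> ^ k) r * ((\<zeta> ^ k) ^ (p - j) - \<zeta> ^ k)))"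
        by (simp only: norm_sum)
      also have "\<dots> \<le> (\<Sum>k\<in>{1..<p}. 2)"
      proof (rule sum_mono)
        fix k assume k: "k \<in> {1..<p}"
        have "norm (evp (\<zeta> ^ k) r) \<le> 1" using w(2)[OF k] r(2)[OF k] f sigma_evp[OF k] by simp
        moreover have "norm ((\<zeta> ^ k) ^ (p - j) - \<zeta> ^ k) \<le> 2"
          using norm_triangle_ineq4[of "(\<zeta> ^ k) ^ (p - j)" "\<zeta> ^ k"] by (simp add: norm_power)
        ultimately have "norm (evp (\<zeta> ^ k) r) * norm ((\<zeta> ^ k) ^ (p - j) - \<zeta> ^ k) \<le> 1 * 2"
          by (intro mult_mono) auto
        then show "norm (evp (\<zeta> ^ k) r * ((\<zeta> ^ k) ^ (p - j) - \<zeta> ^ k)) \<le> 2" by (simp add: norm_mult)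
      qed
      also have "\<dots> \<le> 2 * real p" by simp
      finally have "real p * \<bar>of_int (coeff r j)\<bar> \<le> real p * 2" by (simp add: norm_mult mult.commute)
      then have "\<bar>coeff r j\<bar> \<le> 2" using p_pos by simp
      then show ?thesis by auto
    qed
    have "w = evp \<zeta> r" using r(2)[of 1] p_gt_2 f by simp
    also have "\<dots> = (\<Sum>i<p - 1. of_int (coeff r i) * \<zeta> ^ i)" by (rule evp_altdef[OF r(1)])
    also have "\<dots> = (\<Sum>i<p - 1. of_int (restrict (coeff r) {..<p - 1} i) * \<zeta> ^ i)" by (intro sum.cong) auto
    finally have "w = \<dots>" .
    moreover have "restrict (coeff r) {..<p - 1} \<in> {..<p - 1} \<rightarrow>\<^sub>E {-2..2}" using bound by auto
    ultimately show "w \<in> ?F" by blast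
  qed
qed

lemma sigma_power: "k \<in> {1..<p} \<Longrightarrow> x \<in> Zz \<Longrightarrow> sigma k (x ^ n) = sigma k x ^ n"
  using sigma_of_int[of k 1] by (induction n) (simp_all add: sigma_mult)

text \<open>All powers of \<open>v\<close> lie in the finite set of
  \<open>finite_bounded_conjugates\<close>, so two of them coincide.\<close>

lemma kronecker:
  assumes v: "v \<in> Zz" "\<And>k. k \<in> {1..<p} \<Longrightarrow> norm (sigma k v) = 1"
  obtains n where "n > 0" "v ^ n = 1"
proof -
  have "range (\<lambda>n. v ^ n) \<subseteq> {w \<in> Zz. \<forall>k\<in>{1..<p}. norm (sigma k w) \<le> 1}"
    using v by (auto simp: sigma_power norm_power)
  then have "finite (range (\<lambda>n. v ^ n))" using finite_bounded_conjugates by (rule finite_subset)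
  then have "\<not> inj (\<lambda>n. v ^ n)" using finite_imageD infinite_UNIV_nat by blast
  then obtain i j where ij: "i < j" "v ^ i = v ^ j" unfolding inj_def by (metis linorder_neqE_nat)
  have "norm v = 1" using v(2)[of 1] v(1) p_gt_2 sigma_1 by simp
  then have "v \<noteq> 0" by auto
  moreover have "v ^ j = v ^ i * v ^ (j - i)" using ij(1) by (simp flip: power_add)
  ultimately have "v ^ (j - i) = 1" using ij(2) by simp
  then show thesis using ij(1) that[of "j - i"] by simp
qed

lemma pth_root_of_unity: assumes "w ^ p = 1" obtains s where "s < p" "w = \<zeta> ^ s"
proof -
  have "poly (\<Prod>k<p. [:- (\<zeta> ^ k), 1:]) w = 0" unfolding prod_X_zeta using assms by (simp add: poly_monom)
  then have "\<exists>k<p. w = \<zeta> ^ k" by (auto simp: poly_prod)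
  then show thesis using that by blast
qed

text \<open>The mixed terms of the binomial expansion keep a factor \<open>p * (\<zeta> - 1)\<close>
  by \<open>prime_power_sum\<close>, and the last term has it because
  \<open>(\<zeta> - 1)^(p-1)\<close> is a multiple of \<open>p\<close>.\<close>

lemma power_p_cong:
  assumes "x = of_int c + (\<zeta> - 1) * t" "t \<in> Zz"
  obtains y where "y \<in> Zz" "x ^ p = of_int (c ^ p) + of_nat p * (\<zeta> - 1) * y"
proof -
  obtain q where q: "t = evp \<zeta> q" using assms(2) by (rule ZzE)
  obtain d where d: "([:c:] + [:-1, 1:] * q) ^ p = [:c:] ^ p + ([:-1, 1:] * q) ^ p + of_nat p * ([:-1, 1:] * q) * d"
    by (rule prime_power_sum[OF prime_p])
  obtain e where e: "e \<in> Zz" "(\<zeta> - 1) ^ (p - 1) = of_nat p * e" by (rule pi_power_p)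
  have P: "(\<zeta> - 1) ^ p = (\<zeta> - 1) * (of_nat p * e)"
    unfolding e(2)[symmetric] using p_pos by (simp flip: power_Suc)
  have x: "x = evp \<zeta> ([:c:] + [:-1, 1:] * q)" unfolding assms(1) q by (simp add: ring_distribs)
  have "x ^ p = evp \<zeta> (([:c:] + [:-1, 1:] * q) ^ p)" unfolding x by (rule evp_power[symmetric])
  also have "\<dots> = evp \<zeta> [:c:] ^ p + (evp \<zeta> [:-1, 1:] * t) ^ p + of_nat p * (evp \<zeta> [:-1, 1:] * t) * evp \<zeta> d"
    unfolding d q by (simp only: evp_add evp_mult evp_power evp_of_nat)
  also have "\<dots> = of_int (c ^ p) + ((\<zeta> - 1) * t) ^ p + of_nat p * ((\<zeta> - 1) * t) * evp \<zeta> d" by simp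
  also have "\<dots> = of_int (c ^ p) + of_nat p * (\<zeta> - 1) * (e * t ^ p + t * evp \<zeta> d)"
    unfolding power_mult_distrib P by (simp only: algebra_simps)
  finally show thesis using assms(2) e(1) by (intro that[of "e * t ^ p + t * evp \<zeta> d"]) auto
qed

text \<open>After lifting, differentiate at 1: \<open>X^s\<close> contributes \<open>s\<close>, the
  constant nothing, and \<open>(X - 1)^(p-1)\<close> has at least a double zero there since
  \<open>p > 2\<close>. So \<open>p\<close> divides \<open>s\<close>.\<close>

lemma zeta_power_not_rational_mod_p:
  assumes "y \<in> Zz" "\<zeta> ^ s = of_int c + of_nat p * y" "s < p"
  shows "s = 0"
proof -
  obtain g where g: "y = evp \<zeta> g" using assms(1) by (rule ZzE)
  have "evp \<zeta> (monom 1 s - [:c:]) = of_nat p * evp \<zeta> g" using assms(2) unfolding g by simp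
  then obtain U V where UV: "monom 1 s - [:c:] = of_nat p * U + [:-1, 1:] ^ (p - 1) * V" by (rule p_dvd_evp)
  obtain n where n: "p - 1 = Suc (Suc n)" using p_gt_2 by (cases "p - 1"; cases "p - 1 - 1") auto
  have "poly (pderiv (monom 1 s - [:c:])) 1 = poly (pderiv (of_nat p * U + [:-1, 1:] ^ Suc (Suc n) * V)) 1"
    unfolding UV n ..
  then have "int s = int p * poly (pderiv U) 1"
    by (simp add: pderiv_diff pderiv_monom pderiv_pCons pderiv_add pderiv_mult pderiv_power_Suc poly_monom)
  then have "int p dvd int s" by (rule dvdI)
  then have "p dvd s" by (simp only: int_dvd_int_iff)
  then show ?thesis using assms(3) by (auto dest: dvd_imp_le)
qed

text \<open>Inductively \<open>w^p\<close> is some \<open>\<zeta>^s\<close>; being a p-th power it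
  is congruent to a rational integer modulo \<open>p\<close>, which forces
  \<open>s = 0\<close>.\<close>

lemma p_power_root_of_unity:
  assumes "w \<in> Zz" "w ^ (p ^ a) = 1"
  shows "w ^ p = 1"
  using assms
proof (induction a arbitrary: w)
  case (Suc a)
  show ?case
  proof (cases a)
    case 0
    then show ?thesis using Suc.prems by simp
  next
    case (Suc b)
    have "(w ^ p) ^ p ^ a = 1" using Suc.prems by (simp add: power_mult)
    then have "(w ^ p) ^ p = 1" using Suc.prems by (intro Suc.IH) auto
    then obtain s where s: "s < p" "w ^ p = \<zeta> ^ s" by (rule pth_root_of_unity)
    obtain n t where "t \<in> Zz" "w = of_int n + (\<zeta> - 1) * t" using Suc.prems(1) by (rule Zz_decomp)
    then obtain y where y: "y \<in> Zz" "w ^ p = of_int (n ^ p) + of_nat p * (\<zeta> - 1) * y"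
      using power_p_cong by blast
    have "(\<zeta> - 1) * y \<in> Zz" using y(1) by simp
    moreover have "\<zeta> ^ s = of_int (n ^ p) + of_nat p * ((\<zeta> - 1) * y)" using y(2) s(2) by (simp add: mult.assoc)
    ultimately have "s = 0" using s(1) by (rule zeta_power_not_rational_mod_p)
    then show ?thesis using s by simp
  qed
qed simp

text \<open>Kummer's lemma on \<open>u / cnj u\<close> up to a power prime to \<open>p\<close>, which spares the determination of
  all roots of unity in \<open>K\<close>.\<close>
lemma unit_quotient:
  assumes "u \<in> Zz" "u' \<in> Zz" "u * u' = 1"
  obtains m s where "m > 0" "\<not> p dvd m" "s < p" "(u * cnj u') ^ m = \<zeta> ^ s"
proof -
  define v where "v = u * cnj u'"
  have v: "v \<in> Zz" unfolding v_def using assms by simp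
  \<comment> \<open>\<open>v\<close> is \<open>u\<close> divided by its conjugate, and
    \<open>sigma k\<close> commutes with conjugation, so the same holds for each conjugate of
    \<open>v\<close>.\<close>
  have "norm (sigma k v) = 1" if k: "k \<in> {1..<p}" for k
  proof -
    have "norm (sigma k v) = norm (sigma k u) * norm (sigma k u')"
      unfolding v_def using assms by (simp add: sigma_mult[OF k] sigma_cnj[OF k] norm_mult)
    also have "\<dots> = norm (sigma k (u * u'))" by (simp only: sigma_mult[OF k assms(1,2)] norm_mult)
    also have "\<dots> = 1" unfolding assms(3) using sigma_of_int[OF k, of 1] by simp
    finally show ?thesis .
  qed
  then obtain n where n: "n > 0" "v ^ n = 1" using kronecker[OF v] by blast
  obtain m where m: "n = p ^ multiplicity p n * m" "\<not> p dvd m"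
  proof (rule multiplicity_decompose')
    show "n \<noteq> 0" using n(1) by simp
    show "\<not> is_unit p" using p_gt_2 by simp
  qed
  have "m > 0" using n(1) m(1) by (cases m) auto
  have "(v ^ m) ^ (p ^ multiplicity p n) = v ^ (p ^ multiplicity p n * m)"
    by (simp only: power_mult[symmetric] mult.commute)
  also have "\<dots> = v ^ n" using arg_cong[OF m(1), of "\<lambda>i. v ^ i"] by (rule sym)
  finally have "(v ^ m) ^ (p ^ multiplicity p n) = v ^ n" .
  then have "(v ^ m) ^ p = 1" using n(2) v by (intro p_power_root_of_unity) auto
  then obtain s where "s < p" "v ^ m = \<zeta> ^ s" by (rule pth_root_of_unity)
  then show thesis using that m(2) \<open>m > 0\<close> unfolding v_def by blast
qed

subsection \<open>Congruences modulo \<open>p \<pi>\<close>\<close>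

text \<open>Membership in \<open>\<int>[\<zeta>]\<close> is built in, which lets
  \<open>cg_mult\<close> and \<open>cg_power\<close> be applied without side conditions.\<close>

definition cg :: "complex \<Rightarrow> complex \<Rightarrow> bool"
  where "cg a b \<longleftrightarrow> a \<in> Zz \<and> b \<in> Zz \<and> (\<exists>y\<in>Zz. a - b = of_nat p * (\<zeta> - 1) * y)"

lemma cgI: "b \<in> Zz \<Longrightarrow> y \<in> Zz \<Longrightarrow> a = b + of_nat p * (\<zeta> - 1) * y \<Longrightarrow> cg a b"
  by (auto simp: cg_def intro!: bexI[of _ y])

lemma cg_refl: "a \<in> Zz \<Longrightarrow> cg a a"
  by (auto simp: cg_def intro!: bexI[of _ 0])

lemma cg_sym: "cg a b \<Longrightarrow> cg b a"
  unfolding cg_def by (metis Zz_minus minus_diff_eq mult_minus_right)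

lemma cg_trans: assumes "cg a b" "cg b c" shows "cg a c"
proof -
  obtain y z where "y \<in> Zz" "a - b = of_nat p * (\<zeta> - 1) * y" "z \<in> Zz" "b - c = of_nat p * (\<zeta> - 1) * z"
    using assms by (auto simp: cg_def)
  moreover have "a - c = (a - b) + (b - c)" by simp
  ultimately have "y + z \<in> Zz" "a - c = of_nat p * (\<zeta> - 1) * (y + z)"
    by (auto simp only: distrib_left intro: Zz_add)
  then show ?thesis using assms by (auto simp: cg_def)
qed

lemma cg_mult: assumes "cg a b" "cg c d" shows "cg (a * c) (b * d)"
proof -
  obtain y z where yz: "y \<in> Zz" "a - b = of_nat p * (\<zeta> - 1) * y" "z \<in> Zz" "c - d = of_nat p * (\<zeta> - 1) * z"
    using assms by (auto simp: cg_def)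
  have Z: "a \<in> Zz" "b \<in> Zz" "c \<in> Zz" "d \<in> Zz" using assms by (auto simp: cg_def)
  have "a * c - b * d = (a - b) * c + b * (c - d)" by (simp add: algebra_simps)
  also have "\<dots> = of_nat p * (\<zeta> - 1) * (y * c + b * z)" unfolding yz by (simp only: algebra_simps)
  finally show ?thesis using Z yz by (auto simp: cg_def)
qed

lemma cg_power: "cg a b \<Longrightarrow> cg (a ^ n) (b ^ n)"
  by (induction n) (auto intro: cg_mult cg_refl)

lemma cg_prod: "(\<And>k. k \<in> A \<Longrightarrow> cg (f k) (g k)) \<Longrightarrow> cg (prod f A) (prod g A)"
  by (induction A rule: infinite_finite_induct) (auto intro: cg_mult cg_refl)

text \<open>\<open>n\<close> is invertible modulo \<open>p^2\<close>, which is a multiple of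
  \<open>p * (\<zeta> - 1)\<close>.\<close>

lemma cg_cancel_int:
  assumes "cg (a * of_int n) (b * of_int n)" "\<not> int p dvd n" "a \<in> Zz" "b \<in> Zz"
  shows "cg a b"
proof -
  have "coprime n (int p)" using assms(2) prime_p prime_imp_coprime[of "int p" n] by (simp add: coprime_commute)
  then have "coprime n (int p ^ 2)" by simp
  then obtain k l where kl: "n * k + int p ^ 2 * l = 1"
    using bezout_int[of n "int p ^ 2"] by (metis coprime_imp_gcd_eq_1 mult.commute)
  obtain y where y: "y \<in> Zz" "of_nat p = (\<zeta> - 1) * y" by (rule p_in_pi)
  have "of_int (n * k) + of_nat p * of_nat p * of_int l = (1 :: complex)"
    using arg_cong[OF kl, of "of_int :: int \<Rightarrow> complex"] by (simp add: power2_eq_square)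
  then have "(1 :: complex) = of_int (n * k) + of_nat p * ((\<zeta> - 1) * y) * of_int l" using y(2) by metis
  then have 1: "cg 1 (of_int (n * k))"
    using y(1) by (intro cgI[of _ "y * of_int l"]) (auto simp: mult_ac)
  have "cg (a * 1) (a * of_int (n * k))" "cg (b * 1) (b * of_int (n * k))"
    by (rule cg_mult[OF cg_refl 1]; rule assms)+
  moreover have "cg (a * of_int n * of_int k) (b * of_int n * of_int k)"
    by (rule cg_mult[OF assms(1) cg_refl[OF Zz_of_int]])
  then have "cg (a * of_int (n * k)) (b * of_int (n * k))" by (simp only: of_int_mult mult.assoc)
  ultimately show ?thesis
    using cg_trans[OF cg_trans cg_sym] unfolding mult_1_right by blast
qed

text \<open>Conjugation preserves residues modulo \<open>\<zeta> - 1\<close>, so \<open>x\<close>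
  and \<open>cnj x\<close> have the same \<open>c\<close> and their p-th powers are congruent to
  each other.\<close>

lemma cg_power_p:
  assumes "x = of_int c + (\<zeta> - 1) * t" "t \<in> Zz"
  shows "cg (x ^ p) (of_int (c ^ p))" "cg (cnj x ^ p) (of_int (c ^ p))"
proof -
  obtain y where y: "y \<in> Zz" "x ^ p = of_int (c ^ p) + of_nat p * (\<zeta> - 1) * y"
    by (rule power_p_cong[OF assms])
  show "cg (x ^ p) (of_int (c ^ p))" by (rule cgI[OF _ y]) auto
  have "cnj x = of_int c + (cnj \<zeta> - 1) * cnj t" unfolding assms(1) by simp
  also have "cnj \<zeta> - 1 = (\<zeta> - 1) * (- cnj \<zeta>)" by (simp add: algebra_simps)
  finally have c: "cnj x = of_int c + (\<zeta> - 1) * (- cnj \<zeta> * cnj t)" by (simp only: mult.assoc)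
  have "- cnj \<zeta> * cnj t \<in> Zz" using assms(2) by simp
  with c obtain z where z: "z \<in> Zz" "cnj x ^ p = of_int (c ^ p) + of_nat p * (\<zeta> - 1) * z"
    by (rule power_p_cong)
  show "cg (cnj x ^ p) (of_int (c ^ p))" by (rule cgI[OF _ z]) auto
qed

subsection \<open>The factors of \<open>x\<^sup>p + y\<^sup>p\<close>\<close>

definition gen2 :: "complex \<Rightarrow> complex \<Rightarrow> complex set"
  where "gen2 a b = {a * u + b * v | u v. u \<in> Zz \<and> v \<in> Zz}"

lemma gen2I: "u \<in> Zz \<Longrightarrow> v \<in> Zz \<Longrightarrow> a * u + b * v \<in> gen2 a b"
  by (auto simp: gen2_def)

lemma gen2_add: assumes "x \<in> gen2 a b" "y \<in> gen2 a b" shows "x + y \<in> gen2 a b"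
proof -
  obtain u v u' v' where *: "u \<in> Zz" "v \<in> Zz" "u' \<in> Zz" "v' \<in> Zz" "x = a * u + b * v" "y = a * u' + b * v'"
    using assms by (auto simp: gen2_def)
  then have "x + y = a * (u + u') + b * (v + v')" by (simp add: algebra_simps)
  then show ?thesis using gen2I * by simp
qed

lemma gen2_mult: assumes "c \<in> Zz" "x \<in> gen2 a b" shows "c * x \<in> gen2 a b"
proof -
  obtain u v where *: "u \<in> Zz" "v \<in> Zz" "x = a * u + b * v"
    using assms by (auto simp: gen2_def)
  then have "c * x = a * (c * u) + b * (c * v)" by (simp add: algebra_simps)
  then show ?thesis using gen2I * assms by simp
qed

lemma gen2_mem: "a \<in> gen2 a b" "b \<in> gen2 a b"
  using gen2I[of 1 0 a b] gen2I[of 0 1 a b] by simp_all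

lemma frac_gen2: assumes "a \<in> Zz" "b \<in> Zz" "a \<noteq> 0" shows "frac_ideal (gen2 a b)"
  unfolding frac_ideal_def
proof (intro conjI ballI)
  have sub: "gen2 a b \<subseteq> Zz" using assms by (auto simp: gen2_def)
  then show "gen2 a b \<subseteq> Qz" using Zz_Qz by blast
  show "0 \<in> gen2 a b" using gen2I[of 0 0 a b] by simp
  show "\<exists>x\<in>gen2 a b. x \<noteq> 0" using gen2_mem assms by blast
  show "\<exists>d\<in>Zz. d \<noteq> 0 \<and> (\<forall>x\<in>gen2 a b. d * x \<in> Zz)" using sub by (intro bexI[of _ 1]) auto
qed (auto intro: gen2_add gen2_mult)

lemma gen2_subset_prin: assumes "c \<in> prin a" "a \<in> Zz" shows "gen2 a c \<subseteq> prin a"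
proof -
  obtain d where "d \<in> Zz" "c = a * d" using assms by (auto simp: prin_def)
  then have "a * u + c * v = a * (u + d * v)" "u + d * v \<in> Zz" if "u \<in> Zz" "v \<in> Zz" for u v
    using that by (auto simp: algebra_simps)
  then show ?thesis by (auto simp: gen2_def prin_def)
qed

lemma ipow_gen2_subset: assumes "a \<in> Zz" "c \<in> Zz" shows "ipow (gen2 a c) n \<subseteq> gen2 a (c ^ n)"
proof (induction n)
  case 0
  show ?case using gen2I[of 0 _ a 1] by auto
next
  case (Suc n)
  have "ip (gen2 a c) (gen2 a (c ^ n)) \<subseteq> gen2 a (c ^ Suc n)"
  proof (rule ip_subset)
    fix i j assume "i \<in> gen2 a c" "j \<in> gen2 a (c ^ n)"
    then obtain u v u' v' where *: "u \<in> Zz" "v \<in> Zz" "u' \<in> Zz" "v' \<in> Zz" "i = a * u + c * v" "j = a * u' + c ^ n * v'"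
      by (auto simp: gen2_def)
    have "i * j = a * (u * (a * u' + c ^ n * v') + c * v * u') + c ^ Suc n * (v * v')"
      unfolding * by (simp add: algebra_simps)
    then show "i * j \<in> gen2 a (c ^ Suc n)" using * assms gen2I by simp
  qed (rule gen2_add)
  then show ?case using Suc ip_mono[OF order_refl Suc, of "gen2 a c"] by auto
qed

text \<open>Let D = (a, c) and E = (b, c). Comaximality of \<open>a\<close> and \<open>b\<close>
  gives DE = (c). Now D^n is contained in (a) and E^n in (b), while D^n E^n = (c^n) = (ab), which
  leaves no room for a proper inclusion.\<close>

lemma comaximal_power:
  assumes Z: "a \<in> Zz" "b \<in> Zz" "c \<in> Zz" and ab: "a * b = c ^ n" and n: "n > 0" and c: "c \<noteq> 0"
    and one: "1 \<in> gen2 a b"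
  shows "ipow (gen2 a c) n = prin a"
proof -
  have "a * b \<noteq> 0" unfolding ab using c by simp
  then have nz: "a \<noteq> 0" "b \<noteq> 0" by auto
  let ?D = "gen2 a c" and ?E = "gen2 b c"
  have fr: "frac_ideal ?D" "frac_ideal ?E" using Z nz by (auto intro: frac_gen2)
  obtain m where m: "n = Suc m" using n by (cases n) auto
  have DE: "ip ?D ?E = prin c"
  proof
    show "ip ?D ?E \<subseteq> prin c"
    proof (rule ip_subset)
      fix i j assume "i \<in> ?D" "j \<in> ?E"
      then obtain u v u' v' where *: "u \<in> Zz" "v \<in> Zz" "u' \<in> Zz" "v' \<in> Zz" "i = a * u + c * v" "j = b * u' + c * v'"
        by (auto simp: gen2_def)
      have "i * j = (a * b) * (u * u') + c * (a * u * v' + v * b * u' + c * v * v')"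
        unfolding * by (simp add: algebra_simps)
      also have "\<dots> = c * (c ^ m * (u * u') + (a * u * v' + v * b * u' + c * v * v'))"
        unfolding ab m by (simp add: algebra_simps)
      finally have "i * j = \<dots>" .
      moreover have "c ^ m * (u * u') + (a * u * v' + v * b * u' + c * v * v') \<in> Zz" using * Z by auto
      ultimately show "i * j \<in> prin c" unfolding prin_def by blast
    qed (auto simp: prin_def simp flip: distrib_left)
    obtain u v where uv: "u \<in> Zz" "v \<in> Zz" "1 = a * u + b * v" using one by (auto simp: gen2_def)
    have fi: "frac_ideal (ip ?D ?E)" using fr by (rule frac_ip)
    have "c = (a * u + b * v) * c" by (simp flip: uv(3))
    also have "\<dots> = u * (a * c) + v * (c * b)" by (simp add: algebra_simps)
    also have "\<dots> \<in> ip ?D ?E"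
      using uv fi gen2_mem by (intro frac_add frac_mult ip_mult) auto
    finally have "c \<in> ip ?D ?E" .
    then show "prin c \<subseteq> ip ?D ?E" unfolding prin_def using frac_mult[OF fi] by (auto simp: mult.commute)
  qed
  have "c ^ n \<in> prin a" "c ^ n \<in> prin b"
    unfolding ab[symmetric] prin_def using Z by (auto simp: mult.commute)
  then have sub: "ipow ?D n \<subseteq> prin a" "ipow ?E n \<subseteq> prin b"
    using ipow_gen2_subset[of a c n] ipow_gen2_subset[of b c n] gen2_subset_prin Z by blast+
  \<comment> \<open>\<open>A\<close> and \<open>B\<close> are the integral cofactors of (a) and (b).
    Their product is all of \<open>\<int>[\<zeta>]\<close> and is contained in
    \<open>A\<close>.\<close>
  define A B where "A = (*) (1 / a) ` ipow ?D n" and "B = (*) (1 / b) ` ipow ?E n"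
  have D: "ipow ?D n = (*) a ` A" and E: "ipow ?E n = (*) b ` B"
    unfolding A_def B_def scale_scale using nz by simp_all
  have AZ: "A \<subseteq> Zz" and BZ: "B \<subseteq> Zz"
    using sub nz unfolding A_def B_def prin_def by auto
  have frA: "frac_ideal A" unfolding A_def
    using nz Z fr by (intro frac_scale frac_ipow Qz_divide Zz_Qz) auto
  have 1: "(*) (a * b) ` ip A B = ip (ipow ?D n) (ipow ?E n)"
    unfolding D E ip_scale ip_scale_right scale_scale by (simp only: mult.commute)
  have 2: "ip (ipow ?D n) (ipow ?E n) = prin (c ^ n)"
    by (simp only: ipow_ip[OF fr, symmetric] DE ipow_prin)
  have 3: "prin (c ^ n) = (*) (a * b) ` Zz" by (simp only: prin_def ab)
  have "a * b \<noteq> 0" using nz by simp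
  then have "ip A B = Zz" using trans[OF 1 trans[OF 2 3]] by (rule scale_inj)
  moreover have "ip A B \<subseteq> A"
  proof (rule ip_subset)
    show "i * j \<in> A" if "i \<in> A" "j \<in> B" for i j
      using frac_mult[OF frA, of j i] that BZ by (auto simp: mult.commute)
  qed (rule frac_add[OF frA])
  ultimately have "A = Zz" using AZ by blast
  then show ?thesis unfolding D prin_def by simp
qed

text \<open>The difference is a power of \<open>\<zeta>\<close> times one of the factors in
  \<open>prod_zeta_minus_1\<close>.\<close>

lemma zeta_diff_dvd_p:
  assumes "j < p" "k < p" "j \<noteq> k"
  obtains y where "y \<in> Zz" "of_nat p = (\<zeta> ^ k - \<zeta> ^ j) * y"
proof -
  define i where "i = (k + (p - j)) mod p"
  have "i \<noteq> 0"
  proof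
    assume "i = 0"
    then have "p dvd k + (p - j)" by (auto simp: i_def)
    then obtain q where q: "k + (p - j) = p * q" by (elim dvdE)
    have "0 < k + (p - j)" "k + (p - j) < p * 2" using assms by auto
    then have "0 < p * q" "p * q < p * 2" by (simp_all only: q)
    then have "q = 1" by simp
    then show False using q assms by simp
  qed
  then have i: "i \<in> {1..<p}" using p_pos by (simp add: i_def)
  have e1: "\<zeta> ^ j * \<zeta> ^ (p - j) = 1" using assms by (simp flip: power_add)
  have "\<zeta> ^ j * \<zeta> ^ i = \<zeta> ^ j * (\<zeta> ^ k * \<zeta> ^ (p - j))" unfolding i_def zeta_mod power_add ..
  also have "\<dots> = \<zeta> ^ k * (\<zeta> ^ j * \<zeta> ^ (p - j))" by (simp only: mult_ac)
  finally have e2: "\<zeta> ^ j * \<zeta> ^ i = \<zeta> ^ k" unfolding e1 by simp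
  define R where "R = (\<Prod>l\<in>{1..<p} - {i}. (\<zeta> ^ l - 1))"
  have R: "R \<in> Zz" unfolding R_def by (intro Zz_prod) auto
  have "of_nat p = (\<zeta> ^ i - 1) * R"
    unfolding prod_zeta_minus_1[symmetric] R_def using i by (intro prod.remove) auto
  also have "\<dots> = (\<zeta> ^ j * \<zeta> ^ (p - j)) * ((\<zeta> ^ i - 1) * R)" unfolding e1 by simp
  also have "\<dots> = (\<zeta> ^ j * \<zeta> ^ i - \<zeta> ^ j) * (\<zeta> ^ (p - j) * R)" by (simp add: algebra_simps)
  finally have "of_nat p = (\<zeta> ^ k - \<zeta> ^ j) * (\<zeta> ^ (p - j) * R)" unfolding e2 .
  moreover have "\<zeta> ^ (p - j) * R \<in> Zz" using R by simp
  ultimately show thesis using that by blast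
qed

text \<open>Two factors generate an ideal containing \<open>\<zeta>^k - \<zeta>^j\<close>, as
  \<open>x\<close> and \<open>y\<close> are coprime, hence \<open>p\<close>; it also contains
  \<open>(- z)^p\<close>, which is prime to \<open>p\<close>. So the factors are pairwise comaximal
  and \<open>comaximal_power\<close> yields an explicit p-th root.\<close>

lemma factor_is_power:
  fixes x y z :: int
  assumes eq: "x ^ p + y ^ p + z ^ p = 0" and xy: "coprime x y" and pz: "\<not> int p dvd z" and k: "k < p"
  shows "ipow (gen2 (of_int x + \<zeta> ^ k * of_int y) (of_int (- z))) p = prin (of_int x + \<zeta> ^ k * of_int y)"
    and "of_int x + \<zeta> ^ k * of_int y \<noteq> 0"
proof -
  define \<alpha> :: "nat \<Rightarrow> complex" where "\<alpha> j = of_int x + \<zeta> ^ j * of_int y" for j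
  have \<alpha>Z: "\<alpha> j \<in> Zz" for j unfolding \<alpha>_def by simp
  define b where "b = (\<Prod>j\<in>{..<p} - {k}. \<alpha> j)"
  have bZ: "b \<in> Zz" unfolding b_def by (intro Zz_prod \<alpha>Z)
  have "\<alpha> k * b = (\<Prod>j<p. \<alpha> j)" unfolding b_def using k by (intro prod.remove[symmetric]) auto
  also have "\<dots> = of_int x ^ p + of_int y ^ p" unfolding \<alpha>_def by (rule prod_add_zeta)
  also have "\<dots> = of_int ((- z) ^ p)"
  proof -
    have "x ^ p + y ^ p = (- z) ^ p" using eq odd_p by simp
    then show ?thesis by (metis of_int_add of_int_power)
  qed
  finally have ab: "\<alpha> k * b = of_int (- z) ^ p" by simp
  have z: "z \<noteq> 0" using pz by auto
  obtain s t where st: "s * x + t * y = 1" using xy bezout_int[of x y] by (metis coprime_imp_gcd_eq_1)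
  have pair: "1 \<in> gen2 (\<alpha> k) (\<alpha> j)" if j: "j < p" "j \<noteq> k" for j
  proof -
    let ?G = "gen2 (\<alpha> k) (\<alpha> j)"
    have "(\<zeta> ^ k - \<zeta> ^ j) * of_int y = 1 * \<alpha> k + (-1) * \<alpha> j" by (simp add: \<alpha>_def algebra_simps)
    also have "\<dots> \<in> ?G" by (intro gen2_add gen2_mult gen2_mem) auto
    finally have 1: "(\<zeta> ^ k - \<zeta> ^ j) * of_int y \<in> ?G" .
    have "(\<zeta> ^ k - \<zeta> ^ j) * of_int x = (- (\<zeta> ^ j)) * \<alpha> k + \<zeta> ^ k * \<alpha> j" by (simp add: \<alpha>_def algebra_simps)
    also have "\<dots> \<in> ?G" by (intro gen2_add gen2_mult gen2_mem) auto
    finally have 2: "(\<zeta> ^ k - \<zeta> ^ j) * of_int x \<in> ?G" .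
    have "(\<zeta> ^ k - \<zeta> ^ j) * of_int (s * x + t * y)
        = of_int s * ((\<zeta> ^ k - \<zeta> ^ j) * of_int x) + of_int t * ((\<zeta> ^ k - \<zeta> ^ j) * of_int y)"
      by (simp add: algebra_simps)
    also have "\<dots> \<in> ?G" by (intro gen2_add gen2_mult 1 2) auto
    finally have 3: "\<zeta> ^ k - \<zeta> ^ j \<in> ?G" unfolding st by simp
    obtain w where w: "w \<in> Zz" "of_nat p = (\<zeta> ^ k - \<zeta> ^ j) * w"
      using zeta_diff_dvd_p[of j k] j k by blast
    have p: "of_nat p \<in> ?G" unfolding w(2) mult.commute[of _ w] using w(1) 3 by (rule gen2_mult)
    have zp: "of_int ((- z) ^ p) \<in> ?G"
      using gen2_mult[OF bZ gen2_mem(1), of "\<alpha> k" "\<alpha> j"] ab by (simp add: mult.commute)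
    have "\<not> int p dvd (- z) ^ p" using pz prime_p by (metis dvd_minus_iff prime_dvd_power prime_nat_int_transfer)
    then have "coprime ((- z) ^ p) (int p)"
      using prime_p prime_imp_coprime[of "int p" "(- z) ^ p"] by (metis coprime_commute prime_nat_int_transfer)
    then obtain c d where cd: "c * (- z) ^ p + d * int p = 1"
      using bezout_int[of "(- z) ^ p" "int p"] by (metis coprime_imp_gcd_eq_1)
    have "1 = of_int c * of_int ((- z) ^ p) + of_int d * (of_nat p :: complex)"
      using arg_cong[OF cd, of "of_int :: int \<Rightarrow> complex"] by simp
    also have "\<dots> \<in> ?G" by (intro gen2_add gen2_mult zp p Zz_of_int)
    finally show ?thesis .
  qed
  have "1 \<in> gen2 (\<alpha> k) (\<Prod>j\<in>S. \<alpha> j)" if "finite S" "S \<subseteq> {..<p} - {k}" for S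
    using that
  proof (induction S rule: finite_induct)
    case empty
    show ?case using gen2_mem(2)[of 1] by simp
  next
    case (insert j S)
    obtain u v where uv: "u \<in> Zz" "v \<in> Zz" "1 = \<alpha> k * u + (\<Prod>j\<in>S. \<alpha> j) * v"
      using insert by (auto simp: gen2_def)
    obtain u' v' where uv': "u' \<in> Zz" "v' \<in> Zz" "1 = \<alpha> k * u' + \<alpha> j * v'"
      using pair[of j] insert.prems by (auto simp: gen2_def)
    have P: "(\<Prod>j\<in>S. \<alpha> j) \<in> Zz" by (intro Zz_prod \<alpha>Z)
    have "1 = (\<alpha> k * u + (\<Prod>j\<in>S. \<alpha> j) * v) * (\<alpha> k * u' + \<alpha> j * v')" by (simp flip: uv(3) uv'(3))
    also have "\<dots> = \<alpha> k * (u * (\<alpha> k * u' + \<alpha> j * v') + (\<Prod>j\<in>S. \<alpha> j) * v * u') + (\<alpha> j * (\<Prod>j\<in>S. \<alpha> j)) * (v * v')"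
      by (simp only: algebra_simps)
    also have "\<dots> \<in> gen2 (\<alpha> k) (\<alpha> j * (\<Prod>j\<in>S. \<alpha> j))"
      using uv uv' P \<alpha>Z by (intro gen2I) auto
    finally show ?case using insert.hyps by simp
  qed
  then have one: "1 \<in> gen2 (\<alpha> k) b" unfolding b_def by simp
  show "ipow (gen2 (of_int x + \<zeta> ^ k * of_int y) (of_int (- z))) p = prin (of_int x + \<zeta> ^ k * of_int y)"
    using comaximal_power[OF \<alpha>Z bZ Zz_of_int ab p_pos(1) _ one] z by (simp add: \<alpha>_def)
  have "\<alpha> k * b \<noteq> 0" unfolding ab using z by simp
  then show "of_int x + \<zeta> ^ k * of_int y \<noteq> 0" by (auto simp: \<alpha>_def)
qed

lemma cnj_Zz: "cnj ` Zz = Zz"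
proof
  show "Zz \<subseteq> cnj ` Zz" using Zz_cnj by (metis complex_cnj_cnj image_eqI subsetI)
qed auto

lemma cnj_prin: "cnj ` prin a = prin (cnj a)"
proof -
  have "cnj ` prin a = (*) (cnj a) ` (cnj ` Zz)" by (simp add: prin_def image_image)
  then show ?thesis by (simp only: cnj_Zz prin_def)
qed

lemma cnj_ipow: "cnj ` ipow I n = ipow (cnj ` I) n"
  by (induction n) (simp_all add: cnj_Zz cnj_ip)

text \<open>If \<open>I\<^sup>p\<close> is principal then \<open>I / \<sigma> I\<close>, for \<open>\<sigma>\<close> complex conjugation, lies in the relative class
  group; \<open>I (\<sigma> I)\<^bsup>p-1\<^esup>\<close> is an integral ideal in its class.\<close>
lemma minus_part_of_root:
  assumes I: "frac_ideal I" and Ip: "ipow I p = prin \<alpha>"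
  defines "J \<equiv> ip I (ipow (cnj ` I) (p - 1))"
  shows "frac_ideal J" "ip J (cnj ` J) = prin (\<alpha> * cnj \<alpha>)" "ipow J p = prin (\<alpha> * cnj \<alpha> ^ (p - 1))"
proof -
  have cI: "frac_ideal (cnj ` I)" using I by (rule frac_cnj)
  have cIp: "ipow (cnj ` I) p = prin (cnj \<alpha>)"
    using Ip by (simp add: cnj_prin flip: cnj_ipow)
  show "frac_ideal J" unfolding J_def using I cI by (intro frac_ip frac_ipow)
  have S: "ip L (ipow L (p - 1)) = ipow L p" for L
    using p_pos by (cases p) auto
  have "cnj ` J = ip (ipow I (p - 1)) (cnj ` I)"
    unfolding J_def cnj_ip cnj_ipow image_image complex_cnj_cnj image_ident by (rule ip_comm)
  then have 1: "ip J (cnj ` J) = ip (ip I (ipow I (p - 1))) (ip (ipow (cnj ` I) (p - 1)) (cnj ` I))"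
    unfolding J_def by (simp only: ip_interchange[of I])
  have 2: "ip (ipow (cnj ` I) (p - 1)) (cnj ` I) = ipow (cnj ` I) p"
    unfolding S[symmetric] by (rule ip_comm)
  show "ip J (cnj ` J) = prin (\<alpha> * cnj \<alpha>)"
    unfolding 1 2 S Ip cIp by (rule ip_prin_prin)
  have "ipow (ipow (cnj ` I) (p - 1)) p = ipow (ipow (cnj ` I) p) (p - 1)"
    using cI by (simp add: ipow_ipow mult.commute)
  then show "ipow J p = prin (\<alpha> * cnj \<alpha> ^ (p - 1))"
    unfolding J_def using I cI by (simp add: ipow_ip frac_ipow Ip cIp ipow_prin ip_prin_prin)
qed

lemma prin_eq_prin:
  assumes "prin a = prin b" "a \<noteq> 0"
  obtains u u' where "u \<in> Zz" "u' \<in> Zz" "u * u' = 1" "b = u * a"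
proof -
  have "b \<in> prin a" "a \<in> prin b" using prin_mem assms(1) by auto
  then obtain u v where uv: "u \<in> Zz" "b = a * u" "v \<in> Zz" "a = b * v" unfolding prin_def by blast
  have "a * (u * v) = a * 1" unfolding mult.assoc[symmetric] uv(2)[symmetric] uv(4)[symmetric] by simp
  then have "u * v = 1" using assms(2) by (simp only: mult_cancel_left) simp
  moreover have "b = u * a" using uv(2) by (simp only: mult.commute)
  ultimately show thesis using uv(1,3) that by blast
qed

lemma root_in_Zz: assumes "x \<in> Qz" "x ^ n \<in> Zz" "n > 0" shows "x \<in> Zz"
proof -
  have "algebraic_int x"
    using assms(3) by (intro algebraic_int_root[OF Zz_algebraic_int[OF assms(2)], of "monom 1 n"])
      (auto simp: poly_monom degree_monom_eq)
  then show ?thesis using assms(1) integers_of_Qz by (auto simp: integers_of_def)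
qed

section \<open>Eichler's argument for coprime \<open>x\<close> and \<open>y\<close>\<close>

lemma no_coprime_solution:
  fixes x y z :: int
  assumes eq: "x ^ p + y ^ p + z ^ p = 0" and cop: "coprime x y"
    and px: "\<not> int p dvd x" and py: "\<not> int p dvd y" and pz: "\<not> int p dvd z"
    and pyx: "\<not> int p dvd y - x"
    and rank: "p_rank p (p_part p (relative_class_group Qz Kp)) < r" and r: "r * (r + 1) < p"
  shows False
proof -
  have prime: "Factorial_Ring.prime (int p)" using prime_p by simp
  \<comment> \<open>Modulo \<open>p\<close>, \<open>(x + y)^p\<close> is
    \<open>x^p + y^p = - z^p\<close>.\<close>
  have pxy: "\<not> int p dvd x + y"
  proof
    assume dvd: "int p dvd x + y"
    obtain c where c: "(x + y) ^ p = x ^ p + y ^ p + of_nat p * y * c"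
      by (rule prime_power_sum[OF prime_p])
    have "x + y dvd (x + y) ^ p" using p_pos by (intro dvd_power) auto
    with dvd have "int p dvd (x + y) ^ p" by (rule dvd_trans)
    moreover have "(x + y) ^ p = int p * (y * c) - z ^ p" using c eq by (simp add: mult.assoc)
    ultimately have "int p dvd z ^ p" by (simp add: dvd_diff_right_iff)
    then show False using pz prime prime_dvd_power by blast
  qed
  have kp: "k < p" if "k \<in> {1..r}" for k
  proof -
    have "k \<le> r * (r + 1)" using that by (simp add: trans_le_add1)
    then show ?thesis using r by simp
  qed
  define \<alpha> where "\<alpha> k = of_int x + \<zeta> ^ k * (of_int y :: complex)" for k
  have \<alpha>Z: "\<alpha> k \<in> Zz" for k unfolding \<alpha>_def by simp
  define I where "I k = gen2 (\<alpha> k) (of_int (- z))" for k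
  have Ip: "ipow (I k) p = prin (\<alpha> k)" and \<alpha>0: "\<alpha> k \<noteq> 0" if "k \<in> {1..r}" for k
    using factor_is_power[OF eq cop pz kp[OF that]] unfolding I_def \<alpha>_def by auto
  have fI: "frac_ideal (I k)" if "k \<in> {1..r}" for k
    unfolding I_def using \<alpha>Z \<alpha>0[OF that] by (intro frac_gen2) auto
  define J where "J k = ip (I k) (ipow (cnj ` I k) (p - 1))" for k
  \<comment> \<open>This is the quotient of \<open>\<alpha> k\<close> by its conjugate, made
    integral by the p-th power of the conjugate.\<close>
  define c where "c k = \<alpha> k * cnj (\<alpha> k) ^ (p - 1)" for k
  have cZ: "c k \<in> Zz" for k unfolding c_def using \<alpha>Z by simp
  obtain b :: "nat \<Rightarrow> nat" and k0 \<gamma> where k0: "k0 \<in> {1..r}" "\<not> p dvd b k0"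
    and \<gamma>: "\<gamma> \<in> Qz" "\<gamma> \<noteq> 0" "prin (\<gamma> ^ p) = prin (\<Prod>k\<in>{1..r}. c k ^ b k)"
  proof (rule relative_class_relation[OF rank, of J c])
    fix k assume k: "k \<in> {1..r}"
    have "\<alpha> k * cnj (\<alpha> k) \<in> Kp" using \<alpha>Z[of k] by (auto simp: Kp_iff intro: Zz_Qz)
    moreover have "\<alpha> k * cnj (\<alpha> k) \<noteq> 0" using \<alpha>0[OF k] by simp
    ultimately show "frac_ideal (J k) \<and> (\<exists>a\<in>Kp. a \<noteq> 0 \<and> ip (J k) (cnj ` J k) = prin a)"
      using minus_part_of_root(1,2)[OF fI[OF k] Ip[OF k]] unfolding J_def by blast
    show "c k \<in> Qz \<and> c k \<noteq> 0 \<and> ipow (J k) p = prin (c k)"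
      using minus_part_of_root(3)[OF fI[OF k] Ip[OF k]] \<alpha>0[OF k] cZ[of k] Zz_Qz
      unfolding J_def c_def by auto
  qed
  define \<rho> where "\<rho> = (\<Prod>k\<in>{1..r}. c k ^ b k)"
  have \<rho>Z: "\<rho> \<in> Zz" unfolding \<rho>_def using cZ by (intro Zz_prod Zz_power)
  obtain u u' where u: "u \<in> Zz" "u' \<in> Zz" "u * u' = 1" "\<rho> = u * \<gamma> ^ p"
    using \<gamma>(2,3) unfolding \<rho>_def[symmetric] by (elim prin_eq_prin) auto
  have "u' * \<rho> = \<gamma> ^ p" unfolding u(4) mult.assoc[symmetric] mult.commute[of u'] u(3) by simp
  then have "\<gamma> ^ p \<in> Zz" using Zz_mult[OF u(2) \<rho>Z] by (simp only:)
  then have \<gamma>Z: "\<gamma> \<in> Zz" using root_in_Zz[OF \<gamma>(1) _ p_pos(1)] by blast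
  obtain m s where ms: "m > 0" "\<not> p dvd m" "s < p" "(u * cnj u') ^ m = \<zeta> ^ s"
    using u(1,2,3) by (rule unit_quotient)
  have "cnj u' * cnj u = 1" using arg_cong[OF u(3), of cnj] by (simp add: mult.commute)
  then have "cnj u' * cnj \<rho> = cnj \<gamma> ^ p" unfolding u(4) by (simp flip: mult.assoc)
  \<comment> \<open>The equation \<open>\<rho> = u * \<gamma>^p\<close> divided by its conjugate,
    without denominators; the power \<open>m\<close> taken next makes the unit factor a power of
    \<open>\<zeta>\<close>.\<close>
  then have "\<rho> * cnj \<gamma> ^ p = (u * cnj u') * (cnj \<rho> * \<gamma> ^ p)" unfolding u(4) by (simp add: mult_ac)
  then have "(\<rho> * cnj \<gamma> ^ p) ^ m = ((u * cnj u') * (cnj \<rho> * \<gamma> ^ p)) ^ m" by (simp only:)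
  then have rel: "\<rho> ^ m * (cnj \<gamma> ^ p) ^ m = \<zeta> ^ s * cnj \<rho> ^ m * (\<gamma> ^ p) ^ m"
    unfolding power_mult_distrib[of "u * cnj u'"] ms(4) by (simp only: power_mult_distrib mult.assoc)
  obtain d t where dt: "t \<in> Zz" "\<gamma> = of_int d + (\<zeta> - 1) * t" using \<gamma>Z by (rule Zz_decomp)
  \<comment> \<open>Otherwise \<open>\<zeta> - 1\<close> would divide \<open>\<rho>\<close>, whereas
    modulo \<open>\<zeta> - 1\<close> each \<open>\<alpha> k\<close> and its conjugate are
    \<open>x + y\<close>.\<close>
  have pd: "\<not> int p dvd d"
  proof
    assume "int p dvd d"
    then obtain e where e: "d = int p * e" by (elim dvdE)
    obtain pp where pp: "pp \<in> Zz" "of_nat p = (\<zeta> - 1) * pp" by (rule p_in_pi)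
    have "\<gamma> = (\<zeta> - 1) * (pp * of_int e + t)" unfolding dt(2) e using pp(2) by (simp add: distrib_left mult.assoc)
    moreover have "\<gamma> ^ p = \<gamma> * \<gamma> ^ (p - 1)" using p_pos by (simp flip: power_Suc)
    ultimately have "\<rho> = (\<zeta> - 1) * (u * (pp * of_int e + t) * \<gamma> ^ (p - 1))"
      unfolding u(4) by (simp add: mult_ac)
    moreover have "u * (pp * of_int e + t) * \<gamma> ^ (p - 1) \<in> Zz" using u pp dt \<gamma>Z by simp
    ultimately obtain g where g: "\<rho> = (\<zeta> - 1) * evp \<zeta> g" by (metis ZzE)
    define A where "A = (\<Prod>k\<in>{1..r}. (([:x:] + monom y k) * ([:x:] + monom y (k * (p - 1))) ^ (p - 1)) ^ b k)"
    have ck: "cnj (\<zeta> ^ k) = \<zeta> ^ (k * (p - 1))" for k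
      by (simp add: cnj_zeta power_mult[symmetric] mult.commute)
    have "evp \<zeta> A = \<rho>"
      unfolding A_def \<rho>_def c_def \<alpha>_def by (simp add: ck[simplified] mult.commute)
    then have "evp \<zeta> (A - [:-1, 1:] * g) = 0" using g by (simp only: evp_diff evp_mult) simp
    then have "int p dvd poly (A - [:-1, 1:] * g) 1" by (rule evp_zero_imp_dvd)
    then have "int p dvd (\<Prod>k\<in>{1..r}. ((x + y) * (x + y) ^ (p - 1)) ^ b k)"
      by (simp add: A_def poly_prod poly_monom)
    then obtain k where "int p dvd ((x + y) * (x + y) ^ (p - 1)) ^ b k"
      using prime by (auto simp: prime_dvd_prod_iff)
    then have "int p dvd (x + y) * (x + y) ^ (p - 1)" by (rule prime_dvd_power[OF prime])
    then have "int p dvd x + y \<or> int p dvd (x + y) ^ (p - 1)" by (simp only: prime_dvd_mult_iff[OF prime])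
    then show False using pxy prime_dvd_power[OF prime] by blast
  qed
  have g1: "cg (\<gamma> ^ p) (of_int (d ^ p))" and g2: "cg (cnj \<gamma> ^ p) (of_int (d ^ p))"
    using cg_power_p[OF dt(2,1)] by auto
  have "cg (\<rho> ^ m * of_int (d ^ p) ^ m) (\<rho> ^ m * (cnj \<gamma> ^ p) ^ m)"
    by (rule cg_mult[OF cg_refl cg_power[OF cg_sym[OF g2]]]) (use \<rho>Z in simp)
  moreover have "cg (\<rho> ^ m * (cnj \<gamma> ^ p) ^ m) (\<zeta> ^ s * cnj \<rho> ^ m * of_int (d ^ p) ^ m)"
    unfolding rel by (rule cg_mult[OF cg_refl cg_power[OF g1]]) (use \<rho>Z in simp)
  ultimately have "cg (\<rho> ^ m * of_int ((d ^ p) ^ m)) (\<zeta> ^ s * cnj \<rho> ^ m * of_int ((d ^ p) ^ m))"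
    unfolding of_int_power by (rule cg_trans)
  moreover have "\<not> int p dvd (d ^ p) ^ m" using pd prime by (meson prime_dvd_power)
  ultimately have \<rho>cg: "cg (\<rho> ^ m) (\<zeta> ^ s * cnj \<rho> ^ m)"
    by (rule cg_cancel_int) (use \<rho>Z in auto)
  \<comment> \<open>Multiplying \<open>c k\<close> by \<open>\<alpha> k * cnj (\<alpha> k)\<close>
    gives \<open>\<alpha> k ^ 2 * cnj (\<alpha> k) ^ p\<close>, whence the factor 2. The auxiliary
    \<open>B\<close> is real, so it suits both sides of the congruence, and the p-th powers become
    the integer \<open>W\<close>, which can be cancelled.\<close>
  define e where "e k = 2 * (b k * m)" for k
  define W where "W = (\<Prod>k\<in>{1..r}. ((x + y) ^ p) ^ (b k * m))"
  define B where "B = (\<Prod>k\<in>{1..r}. (\<alpha> k * cnj (\<alpha> k)) ^ (b k * m))"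
  have BZ: "B \<in> Zz" unfolding B_def using \<alpha>Z by (intro Zz_prod Zz_power Zz_mult Zz_cnj)
  have \<alpha>p: "cg (\<alpha> k ^ p) (of_int ((x + y) ^ p))" "cg (cnj (\<alpha> k) ^ p) (of_int ((x + y) ^ p))" for k
  proof -
    have "\<alpha> k = of_int (x + y) + (\<zeta> ^ k - 1) * of_int y" by (simp add: \<alpha>_def algebra_simps)
    also have "\<dots> = of_int (x + y) + (\<zeta> - 1) * ((\<Sum>i<k. \<zeta> ^ i) * of_int y)"
      by (simp only: power_diff_1_eq mult.assoc)
    finally have d: "\<alpha> k = of_int (x + y) + (\<zeta> - 1) * ((\<Sum>i<k. \<zeta> ^ i) * of_int y)" .
    have t: "(\<Sum>i<k. \<zeta> ^ i) * of_int y \<in> Zz" by (intro Zz_mult Zz_sum Zz_power Zz_zeta Zz_of_int)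
    show "cg (\<alpha> k ^ p) (of_int ((x + y) ^ p))" "cg (cnj (\<alpha> k) ^ p) (of_int ((x + y) ^ p))"
      using cg_power_p[OF d t] by auto
  qed
  have pp: "a * a ^ (p - 1) = a ^ p" for a :: complex using p_pos by (simp flip: power_Suc)
  have cg1: "cg (\<rho> ^ m * B) ((\<Prod>k\<in>{1..r}. \<alpha> k ^ e k) * of_int W)"
  proof -
    have "\<rho> ^ m * B = (\<Prod>k\<in>{1..r}. (c k * (\<alpha> k * cnj (\<alpha> k))) ^ (b k * m))"
      unfolding \<rho>_def B_def by (simp add: prod_power_distrib power_mult prod.distrib power_mult_distrib)
    also have "\<dots> = (\<Prod>k\<in>{1..r}. \<alpha> k ^ e k * (cnj (\<alpha> k) ^ p) ^ (b k * m))"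
    proof (intro prod.cong refl)
      fix k
      have "c k * (\<alpha> k * cnj (\<alpha> k)) = \<alpha> k ^ 2 * cnj (\<alpha> k) ^ p"
        unfolding c_def pp[symmetric] power2_eq_square by (simp only: mult_ac)
      then show "(c k * (\<alpha> k * cnj (\<alpha> k))) ^ (b k * m) = \<alpha> k ^ e k * (cnj (\<alpha> k) ^ p) ^ (b k * m)"
        unfolding e_def by (simp only: power_mult_distrib power_mult)
    qed
    finally have 1: "\<rho> ^ m * B = \<dots>" .
    have 2: "(\<Prod>k\<in>{1..r}. \<alpha> k ^ e k) * of_int W = (\<Prod>k\<in>{1..r}. \<alpha> k ^ e k * of_int ((x + y) ^ p) ^ (b k * m))"
      unfolding W_def by (simp add: prod.distrib)
    show ?thesis unfolding 1 2
      by (intro cg_prod cg_mult[OF cg_refl cg_power[OF \<alpha>p(2)]] Zz_power \<alpha>Z)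
  qed
  have cnjB: "cnj B = B" unfolding B_def by (simp add: mult.commute)
  have cg2: "cg (cnj \<rho> ^ m * B) ((\<Prod>k\<in>{1..r}. cnj (\<alpha> k) ^ e k) * of_int W)"
  proof -
    have "cg (cnj a) (cnj b)" if ab: "cg a b" for a b
    proof -
      obtain y where y: "a \<in> Zz" "b \<in> Zz" "y \<in> Zz" "a - b = of_nat p * (\<zeta> - 1) * y"
        using ab by (auto simp: cg_def)
      have "cnj a - cnj b = cnj (a - b)" by simp
      also have "\<dots> = of_nat p * (\<zeta> - 1) * (- cnj \<zeta> * cnj y)" unfolding y(4) by (simp add: algebra_simps)
      finally show ?thesis using y unfolding cg_def by (intro conjI bexI[of _ "- cnj \<zeta> * cnj y"]) auto
    qed
    from this[OF cg1] show ?thesis by (simp add: cnjB)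
  qed
  have "cg (\<rho> ^ m * B) (\<zeta> ^ s * cnj \<rho> ^ m * B)" by (rule cg_mult[OF \<rho>cg cg_refl[OF BZ]])
  moreover have "cg (\<zeta> ^ s * (cnj \<rho> ^ m * B)) (\<zeta> ^ s * ((\<Prod>k\<in>{1..r}. cnj (\<alpha> k) ^ e k) * of_int W))"
    by (rule cg_mult[OF cg_refl cg2]) simp
  ultimately have "cg ((\<Prod>k\<in>{1..r}. \<alpha> k ^ e k) * of_int W) (\<zeta> ^ s * (\<Prod>k\<in>{1..r}. cnj (\<alpha> k) ^ e k) * of_int W)"
    unfolding mult.assoc by (rule cg_trans[OF cg_sym[OF cg1] cg_trans])
  moreover have "\<not> int p dvd W"
  proof
    assume "int p dvd W"
    then obtain k where "int p dvd ((x + y) ^ p) ^ (b k * m)"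
      unfolding W_def using prime by (auto simp: prime_dvd_prod_iff)
    then show False using pxy prime_dvd_power[OF prime] by blast
  qed
  ultimately have main: "cg (\<Prod>k\<in>{1..r}. \<alpha> k ^ e k) (\<zeta> ^ s * (\<Prod>k\<in>{1..r}. cnj (\<alpha> k) ^ e k))"
    by (rule cg_cancel_int) (use \<alpha>Z in \<open>auto intro!: Zz_prod Zz_mult\<close>)
  define F G where "F = (\<Prod>k\<in>{1..r}. ([:x:] + monom y k) ^ e k)" and "G = (\<Prod>k\<in>{1..r}. ([:y:] + monom x k) ^ e k)"
  \<comment> \<open>\<open>\<zeta>^k * cnj (\<alpha> k)\<close> is \<open>y + x \<zeta>^k\<close>,
    the value of a polynomial. \<open>D\<close> collects these powers of \<open>\<zeta>\<close>, and
    \<open>p - s\<close> stands for the exponent \<open>- s\<close>.\<close>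
  define D where "D = (\<Sum>k\<in>{1..r}. k * e k)"
  define H where "H = monom 1 (D + (p - s)) * F - G"
  have evF: "evp \<zeta> F = (\<Prod>k\<in>{1..r}. \<alpha> k ^ e k)" unfolding F_def \<alpha>_def by (simp add: mult.commute)
  have evG: "evp \<zeta> G = \<zeta> ^ D * (\<Prod>k\<in>{1..r}. cnj (\<alpha> k) ^ e k)"
  proof -
    have "evp \<zeta> ([:y:] + monom x k) = \<zeta> ^ k * cnj (\<alpha> k)" for k
    proof -
      have "\<zeta> ^ k * cnj \<zeta> ^ k = 1" unfolding power_mult_distrib[symmetric] by simp
      then have "\<zeta> ^ k * (cnj \<zeta> ^ k * of_int y) = of_int y" by (simp flip: mult.assoc)
      then show ?thesis by (simp add: \<alpha>_def distrib_left mult.commute)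
    qed
    then have "evp \<zeta> G = (\<Prod>k\<in>{1..r}. (\<zeta> ^ k * cnj (\<alpha> k)) ^ e k)"
      unfolding G_def evp_prod evp_power by simp
    also have "\<dots> = (\<Prod>k\<in>{1..r}. \<zeta> ^ (k * e k)) * (\<Prod>k\<in>{1..r}. cnj (\<alpha> k) ^ e k)"
      by (simp add: power_mult_distrib prod.distrib power_mult)
    finally show ?thesis unfolding D_def power_sum .
  qed
  obtain y' where y': "y' \<in> Zz" "evp \<zeta> F - \<zeta> ^ s * (\<Prod>k\<in>{1..r}. cnj (\<alpha> k) ^ e k) = of_nat p * (\<zeta> - 1) * y'"
    using main unfolding evF by (auto simp: cg_def)
  have zs: "\<zeta> ^ (D + (p - s)) * \<zeta> ^ s = \<zeta> ^ D"
    using ms(3) by (simp add: power_add[symmetric] add.assoc) (simp add: power_add)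
  have "evp \<zeta> H = \<zeta> ^ (D + (p - s)) * (evp \<zeta> F - \<zeta> ^ s * (\<Prod>k\<in>{1..r}. cnj (\<alpha> k) ^ e k))"
    unfolding H_def evp_diff evp_mult evG zs[symmetric] by (simp add: right_diff_distrib mult.assoc)
  also have "\<dots> = (\<zeta> - 1) * (of_nat p * (\<zeta> ^ (D + (p - s)) * y'))" unfolding y'(2) by (simp only: mult_ac)
  finally have evH: "evp \<zeta> H = (\<zeta> - 1) * (of_nat p * (\<zeta> ^ (D + (p - s)) * y'))" .
  \<comment> \<open>Splitting off \<open>X - 1\<close> first uses up the factor
    \<open>\<zeta> - 1\<close> of the modulus. The cofactor is then divisible by \<open>p\<close> at
    \<open>\<zeta>\<close>, and its lift with \<open>(X - 1)^(p-1)\<close> gives the full exponent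
    \<open>p\<close> for \<open>H\<close>.\<close>
  have "poly H 1 = 0" unfolding H_def F_def G_def by (simp add: poly_prod poly_monom add.commute)
  then obtain H1 where H1: "H = [:-1, 1:] * H1" using poly_div_X_minus_1[of H] by auto
  have "evp \<zeta> H = (\<zeta> - 1) * evp \<zeta> H1" unfolding H1 by (simp only: evp_mult) simp
  then have "(\<zeta> - 1) * evp \<zeta> H1 = (\<zeta> - 1) * (of_nat p * (\<zeta> ^ (D + (p - s)) * y'))" using evH by simp
  then have eH1: "evp \<zeta> H1 = of_nat p * (\<zeta> ^ (D + (p - s)) * y')"
    by (subst (asm) mult_left_cancel) auto
  have "\<zeta> ^ (D + (p - s)) * y' \<in> Zz" using y'(1) by simp
  then obtain g where "\<zeta> ^ (D + (p - s)) * y' = evp \<zeta> g" by (rule ZzE)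
  then obtain U V where UV: "H1 = of_nat p * U + [:-1, 1:] ^ (p - 1) * V"
    using eH1 p_dvd_evp[of H1 g] by metis
  have "[:-1, 1:] * [:-1, 1:] ^ (p - 1) = ([:-1, 1:] :: int poly) ^ p" using p_pos by (simp flip: power_Suc)
  then have "H = [:int p:] * ([:-1, 1:] * U) + [:-1, 1:] ^ p * V"
    unfolding H1 UV of_nat_poly by (simp only: distrib_left mult_ac)
  then have "monom 1 (D + (p - s)) * (\<Prod>k\<in>{1..r}. ([:x:] + monom y k) ^ e k) - (\<Prod>k\<in>{1..r}. ([:y:] + monom x k) ^ e k)
      = [:int p:] * ([:-1, 1:] * U) + [:-1, 1:] ^ p * V"
    unfolding H_def F_def G_def .
  then have "p dvd e k0"
    by (rule cong_quotient_exponents[OF prime_p r px py pxy pyx _ k0(1)])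
  then have "p dvd 2" using k0(2) ms(2) prime_p unfolding e_def by (simp add: prime_dvd_mult_iff)
  then show False using p_gt_2 by (auto dest: dvd_imp_le)
qed

text \<open>Reduction to coprime \<open>x\<close> and \<open>y\<close>: the common divisor of
  \<open>a\<close> and \<open>b\<close> divides \<open>c\<close> too, because its p-th power divides
  \<open>c^p\<close>.\<close>

lemma no_incongruent_solution:
  fixes a b c :: int
  assumes eq: "a ^ p + b ^ p + c ^ p = 0" and p: "\<not> int p dvd a" "\<not> int p dvd b" "\<not> int p dvd c"
    and ba: "\<not> int p dvd b - a"
    and rank: "p_rank p (p_part p (relative_class_group Qz Kp)) < r" and r: "r * (r + 1) < p"
  shows False
proof -
  define g where "g = gcd a b"
  have "a \<noteq> 0" using p(1) by auto
  then have g0: "g \<noteq> 0" by (simp add: g_def)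
  obtain x y where xy: "a = x * g" "b = y * g" "coprime x y"
    unfolding g_def using gcd_coprime_exists[of a b] \<open>a \<noteq> 0\<close> by auto
  have e: "g ^ p * (x ^ p + y ^ p) + c ^ p = 0" using eq unfolding xy by (simp add: power_mult_distrib algebra_simps)
  then have "c ^ p = - (g ^ p * (x ^ p + y ^ p))" by linarith
  then have "g ^ p dvd c ^ p" by simp
  then have "g dvd c" using p_pos by (simp add: pow_divides_pow_iff)
  then obtain z where z: "c = g * z" by (elim dvdE)
  have "g ^ p * (x ^ p + y ^ p + z ^ p) = 0" using e unfolding z by (simp add: power_mult_distrib algebra_simps)
  then have "x ^ p + y ^ p + z ^ p = 0" using g0 by simp
  moreover have "\<not> int p dvd x" "\<not> int p dvd y" "\<not> int p dvd z" using p unfolding xy(1,2) z by auto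
  moreover have "\<not> int p dvd y - x"
  proof
    assume "int p dvd y - x"
    then have "int p dvd (y - x) * g" by simp
    then show False using ba unfolding xy(1,2) by (simp add: left_diff_distrib)
  qed
  ultimately show False using xy(3) rank r by (intro no_coprime_solution[of x y z r])
qed

end

text \<open>For the exponent 3: a sum of three such cubes is 1, 3, 6 or 8 modulo 9, never 0.\<close>

lemma cube_mod_9:
  fixes a :: int
  assumes "\<not> 3 dvd a"
  shows "a ^ 3 mod 9 = 1 \<or> a ^ 3 mod 9 = 8"
proof -
  have "a mod 9 \<in> {0..8}" by auto
  then have "a mod 9 \<in> {0, 1, 2, 3, 4, 5, 6, 7, 8}" by (simp add: atLeastAtMost_iff) presburger
  moreover have "a mod 9 \<noteq> 0" "a mod 9 \<noteq> 3" "a mod 9 \<noteq> 6" using assms by presburger+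
  moreover have "a ^ 3 mod 9 = (a mod 9) ^ 3 mod 9" by (simp add: power_mod)
  ultimately show ?thesis by auto
qed

theorem theorem3p14:
  fixes p :: nat and \<zeta> :: complex and K :: "complex set"
  assumes "Factorial_Ring.prime p" and "p > 2"
    and "primitive_root_of_unity p \<zeta>"
    and "K = rat_adjoin \<zeta>"
    and "int (p_rank p (p_part p (relative_class_group K (max_real_subfield K))))
           \<le> \<lfloor>sqrt (real p + 1) - 1.5\<rfloor>"
  shows "\<not> (\<exists>a b c :: int. \<not> int p dvd a * b * c \<and> a ^ p + b ^ p + c ^ p = 0)"
proof (rule notI, elim exE conjE)
  fix a b c :: int
  assume pabc: "\<not> int p dvd a * b * c" and eq: "a ^ p + b ^ p + c ^ p = 0"
  interpret cyclotomic p \<zeta> by unfold_locales (rule assms)+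
  have p: "\<not> int p dvd a" "\<not> int p dvd b" "\<not> int p dvd c" using pabc by (auto simp: dvd_mult dvd_mult2)
  have prime: "Factorial_Ring.prime (int p)" using prime_p by simp
  show False
  \<comment> \<open>The permutation argument ends with \<open>p dvd 3\<close>, so the exponent 3 is
    treated directly.\<close>
  proof (cases "p = 3")
    case True
    have "(a ^ 3 mod 9 + b ^ 3 mod 9 + c ^ 3 mod 9) mod 9 = 0"
    proof -
      have "(u mod 9 + v mod 9 + w mod 9) mod 9 = (u + v + w) mod 9" for u v w :: int
        using mod_add_left_eq[of "u mod 9 + v mod 9" 9 "w mod 9"] mod_add_eq[of "u + v" 9 w]
        by (simp only: mod_add_eq)
      then show ?thesis using eq True by simp
    qed
    moreover have "\<not> 3 dvd a" "\<not> 3 dvd b" "\<not> 3 dvd c" using p True by simp_all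
    note this[THEN cube_mod_9]
    ultimately show False by (elim disjE) simp_all
  next
    case False
    define R where "R = p_rank p (p_part p (relative_class_group Qz Kp))"
    have "of_int (int R) \<le> sqrt (real p + 1) - 1.5"
      using assms(5) unfolding assms(4) rat_adjoin_zeta R_def by (simp only: le_floor_iff)
    then have le: "real R + 1.5 \<le> sqrt (real p + 1)" by simp
    have "(real R + 1.5)\<^sup>2 \<le> (sqrt (real p + 1))\<^sup>2" by (rule power_mono[OF le]) simp
    \<comment> \<open>The product is \<open>(R + 1.5)^2 - 1/4\<close>, at most
      \<open>p + 3/4\<close>. As an even integer it is then below the odd number
      \<open>p\<close>.\<close>
    then have "real ((R + 1) * (R + 2)) < real (p + 1)" by (simp add: power2_eq_square algebra_simps)
    then have "(R + 1) * (R + 2) \<le> p" by (simp only: of_nat_less_iff)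
    moreover have "even ((R + 1) * (R + 2))" by simp
    ultimately have "(R + 1) * (R + 2) < p" using odd_p le_neq_implies_less by blast
    then have r: "Suc R * (Suc R + 1) < p" by simp
    have no: "int p dvd v - u"
      if "u ^ p + v ^ p + w ^ p = 0" "\<not> int p dvd u" "\<not> int p dvd v" "\<not> int p dvd w" for u v w
    proof (rule ccontr)
      assume n: "\<not> int p dvd v - u"
      show False by (rule no_incongruent_solution[OF that n _ r]) (simp add: R_def)
    qed
    have "int p dvd b - a" using no[OF eq p] .
    moreover have "int p dvd c - a" using no[of a c b] eq p by (simp add: algebra_simps)
    \<comment> \<open>If no ordering gives an incongruent pair, \<open>a\<close>, \<open>b\<close>,
      \<open>c\<close> agree modulo \<open>p\<close> and the equation reads \<open>3 a^p = 0\<close>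
      modulo \<open>p\<close>.\<close>
    ultimately have "int p dvd b ^ p - a ^ p" "int p dvd c ^ p - a ^ p"
      by (auto simp: power_diff_sumr2)
    then have "int p dvd (b ^ p - a ^ p) + (c ^ p - a ^ p)" by (rule dvd_add)
    also have "(b ^ p - a ^ p) + (c ^ p - a ^ p) = - (3 * a ^ p)" using eq by linarith
    finally have "int p dvd 3 * a ^ p" by simp
    then have "int p dvd 3" using p(1) prime by (metis prime_dvd_mult_iff prime_dvd_power)
    then have "p dvd 3" by (metis int_dvd_int_iff of_nat_numeral)
    then have "p \<le> 3" by (auto dest: dvd_imp_le)
    then show False using p_gt_2 False by simp
  qed
qed

end
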